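(* The sequence $\{ P_{n+1,n} : (J_{n+1},\Phi_{n+1}) \to (J_n, \Phi_n) : n \in \mathbb{N}\}$ of disjoint unions of dumbbells described in the context is an invertible pointed Shimomura sequence which satisfies the factoring property. If $(X,f)$ is its inverse limit (so that $X$ is a Cantor space), then $f \in H(X)$ and $f$ is a conjugacy transitive element of $C_s(X)$ of residual type; that is, the conjugacy class $\{h\circ f\circ h^{-1}:h\in H(X)\}$ is a dense $G_\delta$ subset of $C_s(X)$.
   Context: General notions. $\mathbb{N}$ is the set of positive integers; $\mathcal{I}$ is the set of all nonempty finite subsets of $\mathbb{N}^n$, $n\ge 1$. A Cantor space is a nonempty, compact, zero-dimensional, perfect metric space; $C_s(X)$ is the space of continuous surjections of $X$ with the sup metric and $H(X)$ its subset of homeomorphisms. A surjective relation $\phi$ on $I$ is a subset of $I\times I$ with both projections onto $I$. A map $p:(I,\phi)\to(J,\psi)$ is a function $p:I\to J$ with $(p\times p)(\phi)\subset\psi$; it is a system surjection if $p$ is onto and $(p\times p)(\phi)=\psi$. A Shimomura sequence is a sequence of system surjections $p_{n+1,n}:(I_{n+1},\phi_{n+1})\to(I_n,\phi_n)$ with $I_n\in\mathcal{I}$ and $\phi_n$ surjective such that, with $p_{m,n}=p_{n+1,n}\circ\cdots\circ p_{m,m-1}$: for every $n$ and $x\in I_n$ there are $m>n$ and $y_1\neq y_2\in I_m$ with $p_{m,n}(y_1)=p_{m,n}(y_2)=x$ (bifurcation), and for every $n$ there is $m>n$ with $p_{m,n}\circ\phi_m=\{(a,p_{m,n}(b)):(a,b)\in\phi_m\}$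 a map (Shimomura Condition). It is invertible if the same sequence with every $\phi_n$ replaced by $\phi_n^{-1}$ also satisfies the Shimomura Condition; pointed if $I_1$ is a singleton. Its inverse limit is $X=\{z\in\prod_n I_n:z_n=p_{n+1,n}(z_{n+1})\ \forall n\}$ with $f=\{(x,y)\in X\times X:(x_n,y_n)\in\phi_n\ \forall n\}$. Factoring property: whenever $k>n$ and $q_1:(I_k,\phi_k)\to(I_n,\phi_n)$ is a system surjection, there exist $m>k$ and a system surjection $q_2:(I_m,\phi_m)\to(I_k,\phi_k)$ with $q_1\circ q_2=p_{m,n}$. Dumbbells. For integers $N,M\ge1$, $L\ge0$, an $N$-$L$-$M$ dumbbell is a relation isomorphic to $\phi_{N,L,M}=\{(i,i+1):1\le i\le N+L+M-2\}\cup\{(N,1),(N+L+M-1,N+L)\}$ on $\{1,\dots,N+L+M-1\}$. Its in-loop is the restriction to $\{1,\dots,N\}$, its out-loop the restriction to $\{N+L,\dots,N+L+M-1\}$, and its connecting path the restriction to $\{N,\dots,N+L\}$. The sequence. $(J_1,\Phi_1)$ is the trivial system on a singleton. For $n\ge2$, $(J_n,\Phi_n)$ is the disjoint union of $4^{n-1}$ pairwise disjoint $n!$-$2^{n+1}$-$n!$ dumbbells $(I_{i;n},\phi_{i;n})$, $i=1,\dots,4^{n-1}$. Let $a_{i;n},e_{i;n},b_{i;n}\in I_{i;n}$ be the vertices at positions $n!$, $n!+2^n$, $n!+2^{n+1}$ (left end, midpoint, right end of the connecting path). $P_{2,1}$ is the unique map to the trivial system. For $n\ge2$ and $j=1,\dots,4^{n-1}$,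 the map $P_{n+1,n}$ is defined on $(I_{i;n+1},\phi_{i;n+1})$ as: if $i=4(j-1)+2$ or $i=4(j-1)+3$, the unique map to $(I_{j;n},\phi_{j;n})$ taking $e_{i;n+1}$ to $e_{j;n}$; if $i=4(j-1)+1$, the unique map onto the in-loop of $(I_{j;n},\phi_{j;n})$ taking $e_{i;n+1}$ to $a_{j;n}$; if $i=4j$, the unique map onto the out-loop of $(I_{j;n},\phi_{j;n})$ taking $e_{i;n+1}$ to $b_{j;n}$. (These maps exist and are unique.) *)

theory Defs
  imports "HOL-Analysis.Analysis"
begin

section \<open>Finite systems\<close>

type_synonym 'a sys = "'a set \<times> 'a rel"

definition surjective_rel :: "'a set \<Rightarrow> 'a rel \<Rightarrow> bool" where
  "surjective_rel I \<phi> \<longleftrightarrow> \<phi> \<subseteq> I \<times> I \<and> fst ` \<phi> = I \<and> snd ` \<phi> = I"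

definition system_map :: "('a \<Rightarrow> 'b) \<Rightarrow> 'a sys \<Rightarrow> 'b sys \<Rightarrow> bool" where
  "system_map p A B \<longleftrightarrow> p ` fst A \<subseteq> fst B \<and> map_prod p p ` snd A \<subseteq> snd B"

definition system_surj :: "('a \<Rightarrow> 'b) \<Rightarrow> 'a sys \<Rightarrow> 'b sys \<Rightarrow> bool" where
  "system_surj p A B \<longleftrightarrow> system_map p A B \<and> p ` fst A = fst B \<and> map_prod p p ` snd A = snd B"


section \<open>Shimomura sequences\<close>

text \<open>
  All sequences are indexed by the positive integers; values at index 0 are irrelevant.
  A tuple of positive integers is a list.  The function \<open>p n\<close> stands for
  \<open>p\<^bsub>n+1,n\<^esub>\<close>; only its values on \<open>I (Suc n)\<close> matter.
\<close>

definition finite_tuple_sets :: "nat list set set" where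
  "finite_tuple_sets =
     {A. finite A \<and> A \<noteq> {} \<and> (\<exists>k\<ge>1. \<forall>x\<in>A. length x = k \<and> (\<forall>c\<in>set x. 0 < c))}"

text \<open>\<open>bond p m n\<close> is the composite from level \<open>m\<close> to level \<open>n\<close>, for \<open>m \<ge> n\<close>.\<close>

primrec bond :: "(nat \<Rightarrow> 'a \<Rightarrow> 'a) \<Rightarrow> nat \<Rightarrow> nat \<Rightarrow> 'a \<Rightarrow> 'a" where
  "bond p 0 n = id"
| "bond p (Suc m) n = (if Suc m \<le> n then id else bond p m n \<circ> p m)"

definition bifurcation ::
  "(nat \<Rightarrow> 'a set) \<Rightarrow> (nat \<Rightarrow> 'a \<Rightarrow> 'a) \<Rightarrow> bool" where
  "bifurcation I p \<longleftrightarrow>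
     (\<forall>n\<ge>1. \<forall>x\<in>I n. \<exists>m>n. \<exists>y1\<in>I m. \<exists>y2\<in>I m.
        y1 \<noteq> y2 \<and> bond p m n y1 = x \<and> bond p m n y2 = x)"

definition shimomura_condition ::
  "(nat \<Rightarrow> 'a set) \<Rightarrow> (nat \<Rightarrow> 'a rel) \<Rightarrow> (nat \<Rightarrow> 'a \<Rightarrow> 'a) \<Rightarrow> bool" where
  "shimomura_condition I \<phi> p \<longleftrightarrow>
     (\<forall>n\<ge>1. \<exists>m>n. \<forall>a\<in>I m. \<exists>!c. (a, c) \<in> {(a, bond p m n b) |a b. (a, b) \<in> \<phi> m})"

definition shimomura_sequence ::
  "(nat \<Rightarrow> nat list set) \<Rightarrow> (nat \<Rightarrow> nat list rel) \<Rightarrow> (nat \<Rightarrow> nat list \<Rightarrow> nat list) \<Rightarrow> bool" where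
  "shimomura_sequence I \<phi> p \<longleftrightarrow>
     (\<forall>n\<ge>1. I n \<in> finite_tuple_sets \<and> surjective_rel (I n) (\<phi> n)
           \<and> system_surj (p n) (I (Suc n), \<phi> (Suc n)) (I n, \<phi> n))
     \<and> bifurcation I p \<and> shimomura_condition I \<phi> p"

definition invertible_seq ::
  "(nat \<Rightarrow> 'a set) \<Rightarrow> (nat \<Rightarrow> 'a rel) \<Rightarrow> (nat \<Rightarrow> 'a \<Rightarrow> 'a) \<Rightarrow> bool" where
  "invertible_seq I \<phi> p \<longleftrightarrow> shimomura_condition I (\<lambda>n. (\<phi> n)\<inverse>) p"

definition pointed :: "(nat \<Rightarrow> 'a set) \<Rightarrow> bool" where
  "pointed I \<longleftrightarrow> is_singleton (I 1)"

definition factoring_property ::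
  "(nat \<Rightarrow> 'a set) \<Rightarrow> (nat \<Rightarrow> 'a rel) \<Rightarrow> (nat \<Rightarrow> 'a \<Rightarrow> 'a) \<Rightarrow> bool" where
  "factoring_property I \<phi> p \<longleftrightarrow>
     (\<forall>n\<ge>1. \<forall>k>n. \<forall>q1. system_surj q1 (I k, \<phi> k) (I n, \<phi> n) \<longrightarrow>
        (\<exists>m>k. \<exists>q2. system_surj q2 (I m, \<phi> m) (I k, \<phi> k)
                     \<and> (\<forall>x\<in>I m. q1 (q2 x) = bond p m n x)))"

definition inverse_limit ::
  "(nat \<Rightarrow> 'a set) \<Rightarrow> (nat \<Rightarrow> 'a \<Rightarrow> 'a) \<Rightarrow> (nat \<Rightarrow> 'a) set" where
  "inverse_limit I p = {z \<in> (\<Pi>\<^sub>E n\<in>{1..}. I n). \<forall>n\<ge>1. z n = p n (z (Suc n))}"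

definition inverse_limit_topology ::
  "(nat \<Rightarrow> 'a set) \<Rightarrow> (nat \<Rightarrow> 'a \<Rightarrow> 'a) \<Rightarrow> (nat \<Rightarrow> 'a) topology" where
  "inverse_limit_topology I p =
     subtopology (product_topology (\<lambda>n. discrete_topology (I n)) {1..}) (inverse_limit I p)"

definition inverse_limit_rel ::
  "(nat \<Rightarrow> 'a set) \<Rightarrow> (nat \<Rightarrow> 'a rel) \<Rightarrow> (nat \<Rightarrow> 'a \<Rightarrow> 'a) \<Rightarrow> (nat \<Rightarrow> 'a) rel" where
  "inverse_limit_rel I \<phi> p =
     {(x, y). x \<in> inverse_limit I p \<and> y \<in> inverse_limit I p \<and> (\<forall>n\<ge>1. (x n, y n) \<in> \<phi> n)}"


section \<open>Cantor spaces and spaces of continuous surjections\<close>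

definition cantor_space :: "'a topology \<Rightarrow> bool" where
  "cantor_space T \<longleftrightarrow>
     topspace T \<noteq> {} \<and> metrizable_space T \<and> compact_space T \<and> T dim_le 0
     \<and> T derived_set_of topspace T = topspace T"

text \<open>
  Elements of \<open>cfunspace\<close> are extensional (\<open>undefined\<close> off the space), and its metric is the
  sup metric.  Its boundedness requirement is automatic on a compact space.
\<close>

definition surj_space :: "'a metric \<Rightarrow> ('a \<Rightarrow> 'a) metric" where
  "surj_space X = submetric (cfunspace (mtopology_of X) X) {g. g ` mspace X = mspace X}"

definition homeo_set :: "'a metric \<Rightarrow> ('a \<Rightarrow> 'a) set" where
  "homeo_set X =
     {h \<in> mspace (surj_space X). homeomorphic_map (mtopology_of X) (mtopology_of X) h}"

definition conj_class :: "'a metric \<Rightarrow> ('a \<Rightarrow> 'a) \<Rightarrow> ('a \<Rightarrow> 'a) set" where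
  "conj_class X f =
     {restrict (h \<circ> f \<circ> inv_into (mspace X) h) (mspace X) |h. h \<in> homeo_set X}"


section \<open>The sequence of disjoint unions of dumbbells\<close>

definition dumbbell :: "nat \<Rightarrow> nat \<Rightarrow> nat \<Rightarrow> nat rel" where
  "dumbbell N L M =
     {(i, i + 1) |i. 1 \<le> i \<and> i \<le> N + L + M - 2} \<union> {(N, 1), (N + L + M - 1, N + L)}"

text \<open>
  The dumbbells at each level are only prescribed up to isomorphism.  A choice of them is encoded
  by a labelling \<open>v\<close>: for \<open>n \<ge> 2\<close>, \<open>v n i k\<close> is the vertex at position \<open>k\<close> of the \<open>i\<close>-th dumbbell at
  level \<open>n\<close>, and \<open>v 1 1 1\<close> is the only vertex at level 1.
\<close>

type_synonym labelling = "nat \<Rightarrow> nat \<Rightarrow> nat \<Rightarrow> nat list"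

definition dsize :: "nat \<Rightarrow> nat" where
  "dsize n = fact n + 2 ^ (n + 1) + fact n - 1"

definition dverts :: "labelling \<Rightarrow> nat \<Rightarrow> nat \<Rightarrow> nat list set" where
  "dverts v n i = v n i ` {1..dsize n}"

definition drel :: "labelling \<Rightarrow> nat \<Rightarrow> nat \<Rightarrow> nat list rel" where
  "drel v n i = map_prod (v n i) (v n i) ` dumbbell (fact n) (2 ^ (n + 1)) (fact n)"

definition J :: "labelling \<Rightarrow> nat \<Rightarrow> nat list set" where
  "J v n = (if n = 1 then {v 1 1 1} else (\<Union>i\<in>{1..4 ^ (n - 1)}. dverts v n i))"

definition \<Phi> :: "labelling \<Rightarrow> nat \<Rightarrow> nat list rel" where
  "\<Phi> v n = (if n = 1 then {(v 1 1 1, v 1 1 1)} else (\<Union>i\<in>{1..4 ^ (n - 1)}. drel v n i))"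

definition dumbbell_labelling :: "labelling \<Rightarrow> bool" where
  "dumbbell_labelling v \<longleftrightarrow>
     (\<forall>n\<ge>1. J v n \<in> finite_tuple_sets)
     \<and> (\<forall>n\<ge>2. (\<forall>i\<in>{1..4 ^ (n - 1)}. inj_on (v n i) {1..dsize n})
              \<and> disjoint_family_on (dverts v n) {1..4 ^ (n - 1)})"

lemma dumbbell_labelling_pairs: "dumbbell_labelling (\<lambda>n i k. [i, k])"
  unfolding dumbbell_labelling_def
proof (intro conjI allI impI ballI)
  fix n :: nat
  have "finite (J (\<lambda>n i k. [i, k]) n)"
    by (auto simp: J_def dverts_def)
  moreover have "1 \<le> dsize n"
    using fact_ge_1[of n, where ?'a = nat] unfolding dsize_def by linarith
  then have "J (\<lambda>n i k. [i, k]) n \<noteq> {}"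
    by (auto simp: J_def dverts_def)
  moreover have "\<forall>x\<in>J (\<lambda>n i k. [i, k]) n. length x = 2 \<and> (\<forall>c\<in>set x. 0 < c)"
    by (auto simp: J_def dverts_def)
  ultimately show "J (\<lambda>n i k. [i, k]) n \<in> finite_tuple_sets"
    unfolding finite_tuple_sets_def
    by (intro CollectI conjI exI[of _ "2::nat"]) (assumption | simp)+
qed (auto simp: inj_on_def disjoint_family_on_def dverts_def)

definition left_end :: "labelling \<Rightarrow> nat \<Rightarrow> nat \<Rightarrow> nat list" where
  "left_end v n i = v n i (fact n)"

definition midpoint :: "labelling \<Rightarrow> nat \<Rightarrow> nat \<Rightarrow> nat list" where
  "midpoint v n i = v n i (fact n + 2 ^ n)"

definition right_end :: "labelling \<Rightarrow> nat \<Rightarrow> nat \<Rightarrow> nat list" where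
  "right_end v n i = v n i (fact n + 2 ^ (n + 1))"

definition restrict_sys :: "'a rel \<Rightarrow> 'a set \<Rightarrow> 'a sys" where
  "restrict_sys \<phi> S = (S, \<phi> \<inter> S \<times> S)"

definition in_loop :: "labelling \<Rightarrow> nat \<Rightarrow> nat \<Rightarrow> nat list sys" where
  "in_loop v n i = restrict_sys (drel v n i) (v n i ` {1..fact n})"

definition out_loop :: "labelling \<Rightarrow> nat \<Rightarrow> nat \<Rightarrow> nat list sys" where
  "out_loop v n i = restrict_sys (drel v n i) (v n i ` {fact n + 2 ^ (n + 1)..dsize n})"

text \<open>Extensionality makes a map on a carrier set unique as a total function.\<close>

definition unique_map :: "'a sys \<Rightarrow> 'b sys \<Rightarrow> 'a \<Rightarrow> 'b \<Rightarrow> 'a \<Rightarrow> 'b" where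
  "unique_map A B x y = (THE p. p \<in> extensional (fst A) \<and> system_map p A B \<and> p x = y)"

definition unique_onto_map :: "'a sys \<Rightarrow> 'b sys \<Rightarrow> 'a \<Rightarrow> 'b \<Rightarrow> 'a \<Rightarrow> 'b" where
  "unique_onto_map A B x y =
     (THE p. p \<in> extensional (fst A) \<and> system_map p A B \<and> p ` fst A = fst B \<and> p x = y)"

text \<open>
  The restriction of the bonding map to the \<open>i\<close>-th dumbbell at level \<open>n + 1\<close>, for \<open>n \<ge> 2\<close>;
  here \<open>i = 4 * (j - 1) + r\<close> with \<open>r \<in> {1, 2, 3, 4}\<close>.
\<close>

definition Pcomp :: "labelling \<Rightarrow> nat \<Rightarrow> nat \<Rightarrow> nat list \<Rightarrow> nat list" where
  "Pcomp v n i =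
     (let j = (i - 1) div 4 + 1; r = (i - 1) mod 4 + 1;
          A = (dverts v (n + 1) i, drel v (n + 1) i); e = midpoint v (n + 1) i
      in if r = 1 then unique_onto_map A (in_loop v n j) e (left_end v n j)
         else if r = 4 then unique_onto_map A (out_loop v n j) e (right_end v n j)
         else unique_map A (dverts v n j, drel v n j) e (midpoint v n j))"

definition P :: "labelling \<Rightarrow> nat \<Rightarrow> nat list \<Rightarrow> nat list" where
  "P v n x =
     (if n = 1 then v 1 1 1
      else Pcomp v n (THE i. i \<in> {1..4 ^ n} \<and> x \<in> dverts v (n + 1) i) x)"

end

theory Submission
  imports Defs
begin

text \<open>
  The proof joins a general theorem on invertible pointed Shimomura sequences to the combinatorics
  of dumbbells.

  The general theorem.  Write \<open>X\<close> for the inverse limit and \<open>f\<close> for its map.  The levels are finite,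
  so \<open>X\<close> is compact, every locally constant map on \<open>X\<close> depends on a single coordinate
  (\<open>cylinder_uniform\<close>), and a neighbourhood of \<open>g\<close> in \<open>C\<^sub>s(X)\<close> consists of the maps that agree with
  \<open>g\<close> in some coordinate (\<open>openin_surj_space_iff\<close>).  From here on the topology is a matter of finite
  partitions.

  Call a locally constant \<open>\<alpha>\<close> that carries the graph of \<open>g\<close> onto \<open>\<Phi>\<^sub>n\<close> a factor of \<open>g\<close>, and say
  that \<open>g\<close> is lifting if each factor onto a level \<open>n\<close> is \<open>p\<^bsub>m,n\<^esub> \<circ> \<gamma>\<close> for a factor \<open>\<gamma>\<close> onto some level
  \<open>m > n\<close>, where \<open>\<gamma>\<close> may be demanded to be as fine as one likes.  Starting from the factor onto the
  singleton level 1, a lifting \<open>g\<close> admits an infinite tower of finer and finer factors; its limit is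
  a homeomorphism that conjugates \<open>g\<close> to \<open>f\<close> (\<open>conjugate_if_lifting\<close>).  Conversely \<open>f\<close> is lifting,
  by two applications of the factoring property (\<open>lifting_limmap\<close>).  So the conjugacy class of \<open>f\<close>
  is the set of lifting maps, and this is a \<open>G\<^sub>\<delta>\<close>: there are countably many requirements, and each
  speaks of one coordinate of \<open>g\<close> only.

  For density, the pairs \<open>(x\<^sub>N, g(x)\<^sub>N)\<close> form a surjective relation \<open>R\<close> on the level \<open>N\<close>.  Suppose that
  some level \<open>m\<close> maps onto level \<open>N\<close> and \<open>\<Phi>\<^sub>m\<close> into \<open>R\<close>.  A back-and-forth argument, which uses that
  \<open>X\<close> is perfect, realises the resulting partition of \<open>X\<close> as the inverse image of the partition by
  the coordinate \<open>N\<close> under a homeomorphism \<open>h\<close> (\<open>homeo_matching\<close>), and then \<open>h \<circ> f \<circ> h\<inverse>\<close> is close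
  to \<open>g\<close> (\<open>dense_conj_class\<close>).

  Dumbbells.  A dumbbell is the image of one two-sided walk \<open>\<int> \<rightarrow> V\<close> that winds around the in-loop
  until it leaves along the path and ends by winding around the out-loop; its edges are the pairs of
  consecutive vertices of the walk.  Hence a system map from a dumbbell is a walk in the target with
  the same coincidences, and a walk in a union of dumbbells is determined by very little: it
  crosses one dumbbell, or stays in one of its loops (\<open>walk_classification\<close>).  This computes the
  bonding maps, and it reduces the factoring property to bookkeeping of shifts: a component that
  \<open>q\<^sub>1\<close> sends to a crossing, an in-loop or an out-loop is hit by a component of a high level with the
  same behaviour under \<open>p\<^bsub>m,n\<^esub>\<close>.  The lengths \<open>2\<^bsup>n+1\<^esup>\<close> of the paths leave room for the shifts, the
  lengths \<open>n!\<close> of the loops make all periods divide each other, and the number of components of each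
  kind grows without bound (\<open>factoring_P\<close>).  Finally, in a finite surjective relation each point
  lies on a two-sided path that is periodic at both ends, and all its periods divide \<open>m!\<close> once \<open>m\<close>
  is large, so that a level of dumbbells maps onto the relation (\<open>levels_cover_relations\<close>).
\<close>

section \<open>Bonding maps and inverse limits of surjections\<close>

lemma bond_refl [simp]: "bond p n n = id"
  by (cases n) auto

lemma bond_Suc: "n \<le> m \<Longrightarrow> bond p (Suc m) n = bond p m n \<circ> p m"
  by (cases "n = Suc m") auto

lemma bond_trans:
  assumes "n \<le> k" "k \<le> m"
  shows "bond p m n = bond p k n \<circ> bond p m k"
  using assms(2)
proof (induction m rule: dec_induct)
  case base
  show ?case by simp
next
  case (step m)
  then show ?case using assms(1) by (simp add: bond_Suc comp_assoc)
qed

lemma bond_Suc_left: "n < m \<Longrightarrow> bond p m n = p n \<circ> bond p m (Suc n)"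
  using bond_trans[of n "Suc n" m p] by (simp add: bond_Suc)

locale inverse_system =
  fixes I :: "nat \<Rightarrow> 'a set" and p :: "nat \<Rightarrow> 'a \<Rightarrow> 'a"
  assumes step_surj: "n \<ge> 1 \<Longrightarrow> p n ` I (Suc n) = I n"
begin

abbreviation "limset \<equiv> inverse_limit I p"

lemma limset_coord: "z \<in> limset \<Longrightarrow> n \<ge> 1 \<Longrightarrow> z n \<in> I n"
  unfolding inverse_limit_def PiE_def by blast

lemma limset_step: "z \<in> limset \<Longrightarrow> n \<ge> 1 \<Longrightarrow> p n (z (Suc n)) = z n"
  unfolding inverse_limit_def by (metis (mono_tags, lifting) mem_Collect_eq)

lemma limset_extensional: "z \<in> limset \<Longrightarrow> z \<in> extensional {1..}"
  unfolding inverse_limit_def PiE_def by blast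

lemma limset_ext: "x \<in> limset \<Longrightarrow> y \<in> limset \<Longrightarrow> (\<And>n. n \<ge> 1 \<Longrightarrow> x n = y n) \<Longrightarrow> x = y"
  using limset_extensional extensionalityI[of x "{1..}" y] by simp

lemma limsetI:
  assumes "\<And>n. n \<ge> 1 \<Longrightarrow> z n \<in> I n" "\<And>n. n \<ge> 1 \<Longrightarrow> z n = p n (z (Suc n))" "z 0 = undefined"
  shows "z \<in> limset"
proof -
  have "z n = undefined" if "n \<notin> {1..}" for n
    using assms(3) that by (cases n) simp_all
  then have "z \<in> (\<Pi>\<^sub>E n\<in>{1..}. I n)"
    using assms(1) by (intro PiE_I) simp_all
  then show ?thesis
    unfolding inverse_limit_def using assms(2) by blast
qed

lemma limset_bond:
  assumes "z \<in> limset" "1 \<le> n" "n \<le> m"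
  shows "bond p m n (z m) = z n"
  using assms(3)
proof (induction m rule: dec_induct)
  case (step m)
  then show ?case using limset_step[OF assms(1), of m] assms(2) by (simp add: bond_Suc)
qed simp

lemma limset_eq_mono:
  assumes "x \<in> limset" "y \<in> limset" "1 \<le> n" "n \<le> m" "x m = y m"
  shows "x n = y n"
  using limset_bond[OF assms(1,3,4)] limset_bond[OF assms(2,3,4)] assms(5) by simp

text \<open>A partial thread starting at level \<open>n\<close> is continued upwards by choosing preimages and
  downwards by the bonding maps.\<close>

lemma limset_through:
  assumes "n \<ge> 1" "a \<in> I n"
  obtains z where "z \<in> limset" "z n = a"
proof -
  have "\<exists>b. b 0 = a \<and> (\<forall>i. b i \<in> I (n + i) \<and> p (n + i) (b (Suc i)) = b i)"
  proof -
    have ex: "\<exists>y. y \<in> I (n + Suc i) \<and> p (n + i) y = x" if "x \<in> I (n + i)" for x i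
      using step_surj[of "n + i"] assms(1) that by (force simp: image_iff)
    have "\<exists>b. \<forall>i. (b i \<in> I (n + i) \<and> (i = 0 \<longrightarrow> b i = a)) \<and> p (n + i) (b (Suc i)) = b i"
      by (rule dependent_nat_choice) (use assms ex in auto)
    then show ?thesis by blast
  qed
  then obtain b where b: "b 0 = a" "\<And>i. b i \<in> I (n + i)" "\<And>i. p (n + i) (b (Suc i)) = b i"
    by blast
  define z where "z k = (if k \<ge> 1 then bond p (n + k) k (b k) else undefined)" for k
  have down: "bond p m k x \<in> I k" if "1 \<le> k" "k \<le> m" "x \<in> I m" for k m x
    using that(2,3)
  proof (induction m arbitrary: x rule: dec_induct)
    case (step m)
    then show ?case using step_surj[of m] that(1) by (force simp: bond_Suc)
  qed simp
  have zk: "z k = p k (z (Suc k))" if "k \<ge> 1" for k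
  proof -
    have "p k (z (Suc k)) = bond p (Suc (n + k)) k (b (Suc k))"
      using that bond_Suc_left[of k "Suc (n + k)" p] by (simp add: z_def)
    also have "\<dots> = bond p (n + k) k (b k)"
      using b(3)[of k] by (simp add: bond_Suc)
    finally show ?thesis using that by (simp add: z_def)
  qed
  have "z \<in> limset"
  proof (rule limsetI)
    show "z k \<in> I k" if "k \<ge> 1" for k
      using down[OF that _ b(2)[of k]] that by (simp add: z_def)
  qed (use zk in \<open>auto simp: z_def\<close>)
  moreover have "bond p (n + i) n (b i) = a" for i
    by (induction i) (use b in \<open>auto simp: bond_Suc\<close>)
  then have "z n = a" using assms(1) by (simp add: z_def)
  ultimately show ?thesis using that by blast
qed

text \<open>Compactness in combinatorial form: a sequence of threads whose coordinates stabilise one by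
  one has a limit thread.\<close>

lemma limset_of_stable:
  fixes y :: "nat \<Rightarrow> nat \<Rightarrow> 'a"
  assumes y: "\<And>j. y j \<in> limset"
    and stable: "\<And>n. n \<ge> 1 \<Longrightarrow> \<exists>N c. \<forall>j\<ge>N. y j n = c"
  obtains z where "z \<in> limset" "\<And>n. n \<ge> 1 \<Longrightarrow> \<exists>N. \<forall>j\<ge>N. y j n = z n"
proof -
  obtain N c where Nc: "\<And>n j. n \<ge> 1 \<Longrightarrow> j \<ge> N n \<Longrightarrow> y j n = c n"
  proof -
    have "\<forall>n. \<exists>Nc. n \<ge> 1 \<longrightarrow> (\<forall>j\<ge>fst Nc. y j n = snd Nc)"
      using stable by force
    from choice[OF this] obtain g where "\<forall>n\<ge>1. \<forall>j\<ge>fst (g n). y j n = snd (g n)"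
      by blast
    then show thesis using that[of "fst \<circ> g" "snd \<circ> g"] by simp
  qed
  define z where "z n = (if n \<ge> 1 then c n else undefined)" for n
  have zn: "\<exists>N. \<forall>j\<ge>N. y j n = z n" if "n \<ge> 1" for n
    using Nc that by (auto simp: z_def)
  have "z \<in> limset"
  proof (rule limsetI)
    fix n :: nat assume n: "1 \<le> n"
    then have "y (N n) n = c n" using Nc[of n "N n"] by auto
    then show "z n \<in> I n" using limset_coord[OF y, of n "N n"] n by (simp add: z_def)
  next
    fix n :: nat assume n: "1 \<le> n"
    let ?j = "max (N n) (N (Suc n))"
    have "y ?j n = c n" "y ?j (Suc n) = c (Suc n)" using Nc n by auto
    then show "z n = p n (z (Suc n))" using limset_step[OF y n, of ?j] n by (simp add: z_def)
  qed (simp add: z_def)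
  then show ?thesis using that zn by blast
qed

definition depends :: "nat \<Rightarrow> ((nat \<Rightarrow> 'a) \<Rightarrow> 'k) \<Rightarrow> bool" where
  "depends n u \<longleftrightarrow> (\<forall>x\<in>limset. \<forall>y\<in>limset. x n = y n \<longrightarrow> u x = u y)"

definition separates :: "nat \<Rightarrow> ((nat \<Rightarrow> 'a) \<Rightarrow> 'k) \<Rightarrow> bool" where
  "separates n u \<longleftrightarrow> (\<forall>x\<in>limset. \<forall>y\<in>limset. u x = u y \<longrightarrow> x n = y n)"

text \<open>On a compact limit these are the continuous maps into discrete spaces.\<close>

definition loc_const :: "((nat \<Rightarrow> 'a) \<Rightarrow> 'k) \<Rightarrow> bool" where
  "loc_const u \<longleftrightarrow> (\<exists>n\<ge>1. depends n u)"

text \<open>For finite levels this is continuity; see \<open>continuous_map_limtop_iff\<close>.\<close>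

definition lim_cont :: "((nat \<Rightarrow> 'a) \<Rightarrow> nat \<Rightarrow> 'a) \<Rightarrow> bool" where
  "lim_cont h \<longleftrightarrow> h \<in> limset \<rightarrow> limset \<and> (\<forall>n\<ge>1. loc_const (\<lambda>x. h x n))"

lemma depends_mono: "depends n u \<Longrightarrow> 1 \<le> n \<Longrightarrow> n \<le> m \<Longrightarrow> depends m u"
  unfolding depends_def using limset_eq_mono by metis

lemma separates_mono: "separates m u \<Longrightarrow> 1 \<le> n \<Longrightarrow> n \<le> m \<Longrightarrow> separates n u"
  unfolding separates_def using limset_eq_mono by metis

lemma loc_const_ge:
  assumes "loc_const u"
  obtains m where "m \<ge> k" "m \<ge> 1" "depends m u"
proof -
  obtain n where "n \<ge> 1" "depends n u" using assms by (auto simp: loc_const_def)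
  then show ?thesis using depends_mono[of n u "max n k"] that[of "max n k"] by auto
qed

lemma depends_coord: "1 \<le> n \<Longrightarrow> n \<le> m \<Longrightarrow> depends m (\<lambda>x. q (x n))"
  unfolding depends_def using limset_eq_mono by metis

lemma loc_const_coord: "n \<ge> 1 \<Longrightarrow> loc_const (\<lambda>x. q (x n))"
  unfolding loc_const_def using depends_coord by blast

lemma loc_const_comp:
  assumes u: "loc_const u" and h: "lim_cont h"
  shows "loc_const (\<lambda>x. u (h x))"
proof -
  obtain n where n: "n \<ge> 1" "depends n u" using u by (auto simp: loc_const_def)
  then obtain k where k: "k \<ge> 1" "depends k (\<lambda>x. h x n)" using h by (auto simp: lim_cont_def loc_const_def)
  have "depends k (\<lambda>x. u (h x))"
    using n(2) k(2) h unfolding depends_def lim_cont_def by (metis PiE)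
  then show ?thesis using k(1) by (auto simp: loc_const_def)
qed

lemma loc_const_pair:
  assumes "loc_const u" "loc_const v"
  shows "loc_const (\<lambda>x. q (u x) (v x))"
proof -
  obtain n where n: "n \<ge> 1" "depends n u" using assms by (auto simp: loc_const_def)
  obtain m where m: "m \<ge> n" "m \<ge> 1" "depends m v" using loc_const_ge[OF assms(2)] by blast
  have "depends m u" using depends_mono n m by blast
  with m(3) have "depends m (\<lambda>x. q (u x) (v x))"
    unfolding depends_def by metis
  then show ?thesis using m by (auto simp: loc_const_def)
qed

lemma depends_factor:
  assumes "depends n u" "x \<in> limset"
  shows "u x = u (SOME y. y \<in> limset \<and> y n = x n)"
  using assms someI[of "\<lambda>y. y \<in> limset \<and> y n = x n" x] unfolding depends_def by metis

section \<open>Isomorphic towers of locally constant maps\<close>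

text \<open>Points \<open>y\<^sub>i\<close> with \<open>w\<^sub>i(y\<^sub>i) = u\<^sub>i(x)\<close> exist because the values are the same; their coordinates
  stabilise because the \<open>w\<^sub>i\<close> separate points, and the limit point serves all \<open>i\<close> at once.\<close>

lemma tower_point:
  fixes u w :: "nat \<Rightarrow> (nat \<Rightarrow> 'a) \<Rightarrow> 'k"
  assumes range: "\<And>i. u i ` limset = w i ` limset"
    and ru: "\<And>i x. x \<in> limset \<Longrightarrow> u i x = r i (u (Suc i) x)"
    and rw: "\<And>i x. x \<in> limset \<Longrightarrow> w i x = r i (w (Suc i) x)"
    and w_lc: "\<And>i. loc_const (w i)"
    and w_sep: "\<And>n. n \<ge> 1 \<Longrightarrow> \<exists>i. separates n (w i)"
    and x: "x \<in> limset"
  obtains y where "y \<in> limset" "\<And>i. w i y = u i x"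
proof -
  have "\<forall>i. \<exists>y\<in>limset. w i y = u i x" using range x by (metis imageE imageI)
  then obtain y where y: "\<And>i. y i \<in> limset" "\<And>i. w i (y i) = u i x" by metis
  have later: "w i (y j) = u i x" if "i \<le> j" for i j
  proof -
    have "w i (y j) = u i x" if "w k (y j) = u k x" "i \<le> k" for k
      using that(2,1)
    proof (induction k rule: dec_induct)
      case (step k)
      then show ?case using ru[OF x, of k] rw[OF y(1), of k j] by simp
    qed simp
    then show ?thesis using y(2) that by blast
  qed
  have "\<exists>N c. \<forall>j\<ge>N. y j n = c" if n: "n \<ge> 1" for n
  proof -
    obtain i where i: "separates n (w i)" using w_sep[OF n] by blast
    then have "\<forall>j\<ge>i. y j n = y i n"
      unfolding separates_def by (metis later order_refl y(1))
    then show ?thesis by blast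
  qed
  then obtain z where z: "z \<in> limset" "\<And>n. n \<ge> 1 \<Longrightarrow> \<exists>N. \<forall>j\<ge>N. y j n = z n"
    by (rule limset_of_stable[OF y(1)]) blast+
  have "w i z = u i x" for i
  proof -
    obtain n where n: "n \<ge> 1" "depends n (w i)" using w_lc by (auto simp: loc_const_def)
    obtain N where "\<forall>j\<ge>N. y j n = z n" using z(2)[OF n(1)] by blast
    then have "y (max N i) n = z n" by simp
    then have "w i z = w i (y (max N i))" using n(2) z(1) y(1) unfolding depends_def by metis
    then show ?thesis using later by simp
  qed
  then show ?thesis using that z(1) by blast
qed

lemma separated_points:
  assumes "\<And>n. n \<ge> 1 \<Longrightarrow> \<exists>i. separates n (w i)" "x \<in> limset" "y \<in> limset" "\<And>i. w i x = w i y"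
  shows "x = y"
  using limset_ext[OF assms(2,3)] assms unfolding separates_def by metis

text \<open>Two towers \<open>u\<close> and \<open>w\<close> that take the same values at each stage and are connected by the same
  maps \<open>r\<close> have the same inverse limit.  If both separate points, that limit is the whole space on
  either side, and this matches up the points.\<close>

lemma homeo_from_towers:
  fixes u w :: "nat \<Rightarrow> (nat \<Rightarrow> 'a) \<Rightarrow> 'k"
  assumes range: "\<And>i. u i ` limset = w i ` limset"
    and ru: "\<And>i x. x \<in> limset \<Longrightarrow> u i x = r i (u (Suc i) x)"
    and rw: "\<And>i x. x \<in> limset \<Longrightarrow> w i x = r i (w (Suc i) x)"
    and u_lc: "\<And>i. loc_const (u i)" and w_lc: "\<And>i. loc_const (w i)"
    and u_sep: "\<And>n. n \<ge> 1 \<Longrightarrow> \<exists>i. separates n (u i)"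
    and w_sep: "\<And>n. n \<ge> 1 \<Longrightarrow> \<exists>i. separates n (w i)"
  obtains h where "lim_cont h" "bij_betw h limset limset" "h \<in> extensional limset"
    "\<And>i x. x \<in> limset \<Longrightarrow> w i (h x) = u i x"
proof -
  have "\<forall>x\<in>limset. \<exists>y\<in>limset. \<forall>i. w i y = u i x"
  proof (intro ballI)
    fix x assume x: "x \<in> limset"
    obtain y where "y \<in> limset" "\<And>i. w i y = u i x"
      using tower_point[where u = u and w = w and r = r, OF range ru rw w_lc w_sep x] by blast
    then show "\<exists>y\<in>limset. \<forall>i. w i y = u i x" by blast
  qed
  then obtain h0 where h0: "\<And>x. x \<in> limset \<Longrightarrow> h0 x \<in> limset" "\<And>x i. x \<in> limset \<Longrightarrow> w i (h0 x) = u i x"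
    by metis
  define h where "h = restrict h0 limset"
  have h: "\<And>x. x \<in> limset \<Longrightarrow> h x \<in> limset" "\<And>x i. x \<in> limset \<Longrightarrow> w i (h x) = u i x"
    using h0 by (auto simp: h_def)
  have "inj_on h limset"
    using separated_points[OF u_sep] h(2) by (metis inj_onI)
  moreover have "\<exists>x\<in>limset. h x = y" if y: "y \<in> limset" for y
  proof -
    obtain x where x: "x \<in> limset" "\<And>i. u i x = w i y"
      using tower_point[where u = w and w = u and r = r, OF range[symmetric] rw ru u_lc u_sep y] by blast
    then have "h x = y" using separated_points[OF w_sep, of "h x" y] h y by simp
    then show ?thesis using x by blast
  qed
  ultimately have "bij_betw h limset limset"
    using h(1) by (auto simp: bij_betw_def)
  moreover have "lim_cont h"
    unfolding lim_cont_def
  proof (intro conjI allI impI)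
    fix n :: nat assume "n \<ge> 1"
    then obtain i where i: "separates n (w i)" using w_sep by blast
    obtain k where k: "k \<ge> 1" "depends k (u i)" using u_lc by (auto simp: loc_const_def)
    have "depends k (\<lambda>x. h x n)"
      using i k(2) h unfolding depends_def separates_def by metis
    then show "loc_const (\<lambda>x. h x n)" using k(1) by (auto simp: loc_const_def)
  qed (use h in auto)
  ultimately show ?thesis using that h by (simp add: h_def)
qed

end

section \<open>The topology of the inverse limit in terms of coordinates\<close>

locale finite_inverse_system = inverse_system I p for I :: "nat \<Rightarrow> 'a set" and p +
  assumes finite_level: "n \<ge> 1 \<Longrightarrow> finite (I n)"
    and level_nonempty: "n \<ge> 1 \<Longrightarrow> I n \<noteq> {}"
begin

abbreviation "limtop \<equiv> inverse_limit_topology I p"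
abbreviation "prodtop \<equiv> product_topology (\<lambda>n. discrete_topology (I n)) {1..}"

lemma limset_subset_product: "limset \<subseteq> topspace prodtop"
  by (auto simp: inverse_limit_def)

lemma topspace_limtop [simp]: "topspace limtop = limset"
  using limset_subset_product unfolding inverse_limit_topology_def by auto

lemma limset_nonempty: "limset \<noteq> {}"
  using limset_through[of 1] level_nonempty[of 1] by auto

lemma openin_cylinder:
  assumes "n \<ge> 1"
  shows "openin limtop {z \<in> limset. z n \<in> A}"
proof -
  have "continuous_map prodtop (discrete_topology (I n)) (\<lambda>z. z n)"
    using assms by (intro continuous_map_product_projection) simp
  then have "continuous_map limtop (discrete_topology (I n)) (\<lambda>z. z n)"
    unfolding inverse_limit_topology_def by (rule continuous_map_from_subtopology)
  then have "openin limtop {z \<in> topspace limtop. z n \<in> A \<inter> I n}"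
    by (rule openin_continuous_map_preimage) auto
  moreover have "{z \<in> topspace limtop. z n \<in> A \<inter> I n} = {z \<in> limset. z n \<in> A}"
    using limset_coord assms by auto
  ultimately show ?thesis by simp
qed

lemma openin_cylinder_point: "n \<ge> 1 \<Longrightarrow> openin limtop {z \<in> limset. z n = a}"
  using openin_cylinder[of n "{a}"] by simp

lemma openin_limtop_iff:
  "openin limtop U \<longleftrightarrow> U \<subseteq> limset \<and> (\<forall>x\<in>U. \<exists>n\<ge>1. \<forall>y\<in>limset. y n = x n \<longrightarrow> y \<in> U)"
    (is "?L \<longleftrightarrow> ?R")
proof
  assume L: ?L
  then obtain V where V: "openin prodtop V" "U = V \<inter> limset"
    unfolding inverse_limit_topology_def openin_subtopology by blast
  have "\<exists>n\<ge>1. \<forall>y\<in>limset. y n = x n \<longrightarrow> y \<in> U" if "x \<in> U" for x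
  proof -
    have x: "x \<in> V" "x \<in> limset" using that V by auto
    obtain W where W: "finite {i \<in> {1..}. W i \<noteq> topspace (discrete_topology (I i))}"
        "x \<in> Pi\<^sub>E {1..} W" "Pi\<^sub>E {1..} W \<subseteq> V"
      using V(1) x(1) unfolding openin_product_topology_alt by meson
    define n where "n = Max (insert 1 {i \<in> {1..}. W i \<noteq> I i})"
    have n: "n \<ge> 1" "\<And>i. i \<ge> 1 \<Longrightarrow> W i \<noteq> I i \<Longrightarrow> i \<le> n"
      using W(1) unfolding n_def by (auto intro!: Max_ge)
    have "y \<in> U" if y: "y \<in> limset" "y n = x n" for y
    proof -
      have "y i \<in> W i" if i: "i \<ge> 1" for i
      proof (cases "W i = I i")
        case True
        then show ?thesis using limset_coord[OF y(1) i] by simp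
      next
        case False
        then have "y i = x i" using limset_eq_mono[OF y(1) x(2) i n(2)[OF i False] y(2)] by simp
        then show ?thesis using W(2) i by (auto simp: PiE_iff)
      qed
      then have "y \<in> Pi\<^sub>E {1..} W"
        using limset_extensional[OF y(1)] by (auto simp: PiE_iff)
      then show ?thesis using W(3) V(2) y(1) by auto
    qed
    then show ?thesis using n(1) by blast
  qed
  then show ?R using V by blast
next
  assume R: ?R
  have "\<exists>W. openin limtop W \<and> x \<in> W \<and> W \<subseteq> U" if "x \<in> U" for x
  proof -
    obtain n where n: "n \<ge> 1" "\<forall>y\<in>limset. y n = x n \<longrightarrow> y \<in> U"
      using R \<open>x \<in> U\<close> by (elim conjE) (drule bspec, assumption, blast)
    show ?thesis
      using openin_cylinder[OF n(1), of "{x n}"] n(2) R that by (intro exI[of _ "{z \<in> limset. z n \<in> {x n}}"]) auto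
  qed
  then show ?L by (subst openin_subopen) blast
qed

lemma compact_limtop: "compact_space limtop"
proof -
  have "closedin prodtop {z \<in> topspace prodtop. z n = p n (z (Suc n))}" if n: "n \<ge> 1" for n
  proof -
    have 1: "continuous_map prodtop (discrete_topology (I n)) (\<lambda>z. z n)"
      using n by (intro continuous_map_product_projection) simp
    have 2: "continuous_map prodtop (discrete_topology (I (Suc n))) (\<lambda>z. z (Suc n))"
      by (intro continuous_map_product_projection) simp
    have 3: "continuous_map (discrete_topology (I (Suc n))) (discrete_topology (I n)) (p n)"
      using step_surj[OF n] by auto
    have "continuous_map prodtop (discrete_topology (I n)) (\<lambda>z. p n (z (Suc n)))"
      using continuous_map_compose[OF 2 3] by (simp add: o_def)
    then show ?thesis
      by (intro closedin_continuous_maps_eq[OF _ 1]) simp_all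
  qed
  then have "closedin prodtop (\<Inter>n\<in>{1..}. {z \<in> topspace prodtop. z n = p n (z (Suc n))})"
    by (intro closedin_Inter) auto
  moreover have "(\<Inter>n\<in>{1..}. {z \<in> topspace prodtop. z n = p n (z (Suc n))}) = limset"
    unfolding inverse_limit_def topspace_product_topology topspace_discrete_topology by blast
  moreover have "compact_space prodtop"
    unfolding compact_space_product_topology using finite_level by (simp add: compact_space_discrete_topology)
  ultimately show ?thesis
    unfolding inverse_limit_topology_def
    using closedin_compact_space compact_space_subtopology by metis
qed

lemma metrizable_limtop: "metrizable_space limtop"
  unfolding inverse_limit_topology_def
  by (intro metrizable_space_subtopology) (auto simp: metrizable_space_product_topology)

text \<open>The Lebesgue number argument: what holds for all pairs in some cylinder around each point
  holds for all pairs that agree in one fixed coordinate, by a finite subcover.\<close>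

lemma cylinder_uniform:
  assumes "\<And>x. x \<in> limset \<Longrightarrow>
    \<exists>k\<ge>1. \<forall>y\<in>limset. \<forall>z\<in>limset. y k = x k \<longrightarrow> z k = x k \<longrightarrow> Q y z"
  obtains k where "k \<ge> 1" "\<And>y z. y \<in> limset \<Longrightarrow> z \<in> limset \<Longrightarrow> y k = z k \<Longrightarrow> Q y z"
proof -
  have "\<forall>x\<in>limset. \<exists>k. k \<ge> 1 \<and> (\<forall>y\<in>limset. \<forall>z\<in>limset. y k = x k \<longrightarrow> z k = x k \<longrightarrow> Q y z)"
    using assms by blast
  then obtain k where k: "\<And>x. x \<in> limset \<Longrightarrow> k x \<ge> 1"
      "\<And>x y z. x \<in> limset \<Longrightarrow> y \<in> limset \<Longrightarrow> z \<in> limset \<Longrightarrow> y (k x) = x (k x) \<Longrightarrow> z (k x) = x (k x) \<Longrightarrow> Q y z"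
    by (metis (no_types, lifting))
  define C where "C x = {z \<in> limset. z (k x) \<in> {x (k x)}}" for x
  have "\<exists>\<F>. finite \<F> \<and> \<F> \<subseteq> C ` limset \<and> topspace limtop \<subseteq> \<Union>\<F>"
    using compact_limtop unfolding compact_space_alt
  proof (elim allE[of _ "C ` limset"] impE)
    show "(\<forall>U\<in>C ` limset. openin limtop U) \<and> topspace limtop \<subseteq> \<Union> (C ` limset)"
      using openin_cylinder_point k(1) by (auto simp: C_def)
  qed
  then obtain F where F: "finite F" "F \<subseteq> limset" "limset \<subseteq> \<Union> (C ` F)"
    by (metis finite_subset_image topspace_limtop)
  define K where "K = Max (insert 1 (k ` F))"
  have K: "K \<ge> 1" "\<And>x. x \<in> F \<Longrightarrow> k x \<le> K"
    using F(1) by (auto simp: K_def)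
  have "Q y z" if yz: "y \<in> limset" "z \<in> limset" "y K = z K" for y z
  proof -
    obtain x where x: "x \<in> F" "y (k x) = x (k x)" using F(3) yz(1) by (auto simp: C_def)
    moreover have "y (k x) = z (k x)"
      using limset_eq_mono[OF yz(1,2) k(1) K(2) yz(3)] x(1) F(2) by blast
    ultimately show ?thesis using k(2)[of x y z] F(2) yz by auto
  qed
  then show ?thesis using that K(1) by blast
qed

lemma continuous_map_limtop_iff: "continuous_map limtop limtop h \<longleftrightarrow> lim_cont h"
proof
  assume h: "continuous_map limtop limtop h"
  have hX: "h \<in> limset \<rightarrow> limset" using h by (auto simp: continuous_map_def)
  have "loc_const (\<lambda>x. h x n)" if n: "n \<ge> 1" for n
  proof -
    have "\<exists>k\<ge>1. \<forall>y\<in>limset. \<forall>z\<in>limset. y k = x k \<longrightarrow> z k = x k \<longrightarrow> h y n = h z n"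
      if x: "x \<in> limset" for x
    proof -
      have "openin limtop {y \<in> topspace limtop. h y \<in> {z \<in> limset. z n \<in> {h x n}}}"
        using h openin_cylinder[OF n] by (rule openin_continuous_map_preimage)
      moreover have "x \<in> {y \<in> topspace limtop. h y \<in> {z \<in> limset. z n \<in> {h x n}}}"
        using x hX by auto
      ultimately obtain k where "k \<ge> 1"
          "\<forall>y\<in>limset. y k = x k \<longrightarrow> y \<in> {y \<in> topspace limtop. h y \<in> {z \<in> limset. z n \<in> {h x n}}}"
        unfolding openin_limtop_iff by meson
      then have "k \<ge> 1" "\<And>y. y \<in> limset \<Longrightarrow> y k = x k \<Longrightarrow> h y n = h x n"
        by simp_all
      then show ?thesis by metis
    qed
    then obtain k where "k \<ge> 1" "\<And>y z. y \<in> limset \<Longrightarrow> z \<in> limset \<Longrightarrow> y k = z k \<Longrightarrow> h y n = h z n"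
      by (rule cylinder_uniform[where Q = "\<lambda>y z. h y n = h z n"]) blast+
    then show ?thesis unfolding loc_const_def depends_def by blast
  qed
  then show "lim_cont h" using hX by (simp add: lim_cont_def)
next
  assume h: "lim_cont h"
  show "continuous_map limtop limtop h"
    unfolding continuous_map
  proof (intro conjI allI impI)
    show "h ` topspace limtop \<subseteq> topspace limtop" using h by (auto simp: lim_cont_def)
    fix U assume U: "openin limtop U"
    show "openin limtop {x \<in> topspace limtop. h x \<in> U}"
      unfolding openin_limtop_iff
    proof (intro conjI ballI)
      fix x assume x: "x \<in> {x \<in> topspace limtop. h x \<in> U}"
      then obtain n where n: "n \<ge> 1" "\<And>y. y \<in> limset \<Longrightarrow> y n = h x n \<Longrightarrow> y \<in> U"
        using U unfolding openin_limtop_iff by auto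
      obtain k where k: "k \<ge> 1" "depends k (\<lambda>x. h x n)"
        using h n(1) by (auto simp: lim_cont_def loc_const_def)
      have "\<forall>y\<in>limset. y k = x k \<longrightarrow> y \<in> {x \<in> topspace limtop. h x \<in> U}"
      proof (intro ballI impI)
        fix y assume y: "y \<in> limset" "y k = x k"
        have "x \<in> limset" using x by simp
        then have "h y n = h x n" using k(2) y unfolding depends_def by blast
        then have "h y \<in> U" using n(2)[of "h y"] h y(1) by (auto simp: lim_cont_def)
        then show "y \<in> {x \<in> topspace limtop. h x \<in> U}" using y by simp
      qed
      then show "\<exists>n\<ge>1. \<forall>y\<in>limset. y n = x n \<longrightarrow> y \<in> {x \<in> topspace limtop. h x \<in> U}"
        using k(1) by blast
    qed auto
  qed
qed

lemma dim_limtop: "limtop dim_le 0"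
  unfolding dimension_le_0_neighbourhood_base_of_clopen
proof (subst open_neighbourhood_base_of)
  show "\<forall>W x. openin limtop W \<and> x \<in> W \<longrightarrow>
      (\<exists>U. (closedin limtop U \<and> openin limtop U) \<and> x \<in> U \<and> U \<subseteq> W)"
  proof (intro allI impI)
    fix W x assume W: "openin limtop W \<and> x \<in> W"
    then obtain n where n: "n \<ge> 1" "\<And>y. y \<in> limset \<Longrightarrow> y n = x n \<Longrightarrow> y \<in> W"
      unfolding openin_limtop_iff by blast
    have x: "x \<in> limset" using W openin_subset by fastforce
    let ?U = "{z \<in> limset. z n \<in> {x n}}"
    have "limset - ?U = {z \<in> limset. z n \<in> - {x n}}" by auto
    then have "closedin limtop ?U"
      unfolding closedin_def using openin_cylinder[OF n(1), of "- {x n}"] by auto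
    then show "\<exists>U. (closedin limtop U \<and> openin limtop U) \<and> x \<in> U \<and> U \<subseteq> W"
      using openin_cylinder[OF n(1), of "{x n}"] n(2) x by (intro exI[of _ ?U]) auto
  qed
qed auto

lemma Hausdorff_limtop: "Hausdorff_space limtop"
  using metrizable_limtop metrizable_imp_Hausdorff_space by blast

lemma lim_cont_inverse:
  assumes h: "lim_cont h" "bij_betw h limset limset"
  shows "homeomorphic_map limtop limtop h" "lim_cont (inv_into limset h)"
proof -
  show hom: "homeomorphic_map limtop limtop h"
    by (rule continuous_imp_homeomorphic_map)
      (use h compact_limtop Hausdorff_limtop in \<open>auto simp: continuous_map_limtop_iff bij_betw_def\<close>)
  obtain g where g: "homeomorphic_maps limtop limtop h g"
    using hom homeomorphic_map_maps by blast
  have "g y = inv_into limset h y" if "y \<in> limset" for y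
    using g h that unfolding homeomorphic_maps_def bij_betw_def
    by (metis continuous_map_image_subset_topspace image_subset_iff inv_into_f_f topspace_limtop)
  then have "continuous_map limtop limtop (inv_into limset h)"
    using g unfolding homeomorphic_maps_def by (metis continuous_map_eq topspace_limtop)
  then show "lim_cont (inv_into limset h)" by (simp add: continuous_map_limtop_iff)
qed

section \<open>The space of continuous surjections in terms of coordinates\<close>

context
  fixes X :: "(nat \<Rightarrow> 'a) metric"
  assumes X: "mtopology_of X = limtop"
begin

lemma mspace_X: "mspace X = limset"
  using X by (metis topspace_limtop topspace_mtopology_of)

lemma mball_open: "x \<in> limset \<Longrightarrow> e > 0 \<Longrightarrow> openin limtop {y \<in> limset. mdist X x y < e}"
proof -
  interpret Metric_space "mspace X" "mdist X" by simp
  assume x: "x \<in> limset" and e: "e > 0"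
  have "{y \<in> limset. mdist X x y < e} = mball x e"
    unfolding set_eq_iff in_mball mem_Collect_eq using x by (simp add: mspace_X)
  moreover have "mtopology = limtop" using X unfolding mtopology_of_def .
  ultimately show "openin limtop {y \<in> limset. mdist X x y < e}"
    using openin_mball[of x e] by metis
qed

text \<open>Uniform comparison of the metric with coordinates; both directions rest on compactness.\<close>

lemma mdist_small_if_coord_eq:
  assumes e: "e > 0"
  obtains n where "n \<ge> 1" "\<And>x y. x \<in> limset \<Longrightarrow> y \<in> limset \<Longrightarrow> x n = y n \<Longrightarrow> mdist X x y < e"
proof (rule cylinder_uniform[where Q = "\<lambda>x y. mdist X x y < e"])
  interpret Metric_space "mspace X" "mdist X" by simp
  fix x assume x: "x \<in> limset"
  have "x \<in> {y \<in> limset. mdist X x y < e / 2}" using x e mspace_X by simp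
  then obtain k where k: "k \<ge> 1" "\<And>y. y \<in> limset \<Longrightarrow> y k = x k \<Longrightarrow> mdist X x y < e / 2"
    using mball_open[OF x, of "e / 2"] e unfolding openin_limtop_iff by auto
  have "mdist X y z < e" if "y \<in> limset" "z \<in> limset" "y k = x k" "z k = x k" for y z
    using triangle'[of y x z] commute[of x z] commute[of x y] k(2)[of y] k(2)[of z] that x mspace_X by simp
  then show "\<exists>k\<ge>1. \<forall>y\<in>limset. \<forall>z\<in>limset. y k = x k \<longrightarrow> z k = x k \<longrightarrow> mdist X y z < e"
    using k(1) by blast
qed (use that in blast)

lemma coord_eq_if_mdist_small:
  assumes n: "n \<ge> 1"
  obtains \<delta> where "\<delta> > 0" "\<And>x y. x \<in> limset \<Longrightarrow> y \<in> limset \<Longrightarrow> mdist X x y < \<delta> \<Longrightarrow> x n = y n"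
proof -
  interpret Metric_space "mspace X" "mdist X" by simp
  have T: "mtopology = limtop" using X by (simp add: mtopology_of_def)
  have "compactin mtopology limset"
    using compact_limtop T by (simp add: compact_space_def)
  moreover have "limset \<subseteq> (\<Union>a\<in>I n. {z \<in> limset. z n \<in> {a}})"
    using limset_coord[OF _ n] by auto
  moreover have "\<And>U. U \<in> (\<lambda>a. {z \<in> limset. z n \<in> {a}}) ` I n \<Longrightarrow> openin mtopology U"
    using openin_cylinder_point[OF n] T by auto
  ultimately obtain \<delta> where \<delta>: "\<delta> > 0"
      "\<forall>x\<in>limset. \<exists>U\<in>(\<lambda>a. {z \<in> limset. z n \<in> {a}}) ` I n. mball x \<delta> \<subseteq> U"
    using lebesgue_number by meson
  have "x n = y n" if xy: "x \<in> limset" "y \<in> limset" "mdist X x y < \<delta>" for x y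
  proof -
    have "x \<in> mball x \<delta>" "y \<in> mball x \<delta>" unfolding in_mball using xy \<delta>(1) by (simp_all add: mspace_X)
    moreover obtain a where "mball x \<delta> \<subseteq> {z \<in> limset. z n \<in> {a}}"
      using \<delta>(2) xy(1) by blast
    ultimately have "x \<in> {z \<in> limset. z n \<in> {a}}" "y \<in> {z \<in> limset. z n \<in> {a}}" by blast+
    then show ?thesis by simp
  qed
  then show ?thesis using that \<delta>(1) by blast
qed

lemma mspace_surj_space:
  "mspace (surj_space X) = {g \<in> extensional limset. lim_cont g \<and> g ` limset = limset}"
proof -
  have "compactin (mtopology_of X) (topspace (mtopology_of X))"
    using compact_limtop X by (simp add: compact_space_def)
  then have "mspace (cfunspace (mtopology_of X) X) =
      {f. (\<forall>x\<in>limset. f x \<in> limset) \<and> f \<in> extensional limset \<and> lim_cont f}"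
    by (simp add: compactin_mspace_cfunspace X mspace_X continuous_map_limtop_iff del: mspace_cfunspace)
  then show ?thesis
    unfolding surj_space_def mspace_submetric by (auto simp: mspace_X lim_cont_def)
qed

text \<open>The sup metric enters the proof only through this description: by compactness, uniform
  closeness of two maps and their agreement in a high coordinate imply each other.\<close>

lemma openin_surj_space_iff:
  "openin (mtopology_of (surj_space X)) U \<longleftrightarrow>
     U \<subseteq> mspace (surj_space X) \<and>
     (\<forall>g\<in>U. \<exists>n\<ge>1. \<forall>g'\<in>mspace (surj_space X). (\<forall>x\<in>limset. g' x n = g x n) \<longrightarrow> g' \<in> U)"
    (is "?L \<longleftrightarrow> ?U \<and> ?R")
proof -
  interpret S: Metric_space "mspace (surj_space X)" "mdist (surj_space X)" by simp
  have d: "mdist (surj_space X) = mdist (cfunspace (mtopology_of X) X)"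
    by (simp add: surj_space_def)
  have sub: "mspace (surj_space X) \<subseteq> mspace (cfunspace (mtopology_of X) X)"
    by (simp only: surj_space_def mspace_submetric) blast
  have val: "g x \<in> limset" if "g \<in> mspace (surj_space X)" "x \<in> limset" for g x
    using that by (auto simp: mspace_surj_space)
  have comp: "compactin (mtopology_of X) (topspace (mtopology_of X))"
    using compact_limtop X by (simp add: compact_space_def)
  have op: "?L \<longleftrightarrow> ?U \<and> (\<forall>g. g \<in> U \<longrightarrow> (\<exists>r>0. S.mball g r \<subseteq> U))"
    by (simp add: mtopology_of_def S.openin_mtopology)
  have ball: "(\<exists>r>0. S.mball g r \<subseteq> U) \<longleftrightarrow>
      (\<exists>n\<ge>1. \<forall>g'\<in>mspace (surj_space X). (\<forall>x\<in>limset. g' x n = g x n) \<longrightarrow> g' \<in> U)" (is "?A \<longleftrightarrow> ?B")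
    if g: "g \<in> mspace (surj_space X)" for g
  proof
    assume ?A
    then obtain r where r: "r > 0" "S.mball g r \<subseteq> U" by blast
    obtain n where n: "n \<ge> 1" "\<And>x y. x \<in> limset \<Longrightarrow> y \<in> limset \<Longrightarrow> x n = y n \<Longrightarrow> mdist X x y < r / 2"
      using mdist_small_if_coord_eq[of "r / 2"] r(1) by auto
    have "g' \<in> U" if g': "g' \<in> mspace (surj_space X)" "\<forall>x\<in>limset. g' x n = g x n" for g'
    proof -
      have "mdist X (g x) (g' x) \<le> r / 2" if "x \<in> limset" for x
        using n(2)[of "g x" "g' x"] g' g val that by (simp add: less_imp_le)
      then have "mdist (cfunspace (mtopology_of X) X) g g' \<le> r / 2"
        using r(1) X by (intro mdist_cfunspace_le) auto
      then have "mdist (surj_space X) g g' < r" using r(1) d by simp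
      then have "g' \<in> S.mball g r" using g g'(1) S.in_mball by blast
      then show ?thesis using r(2) by blast
    qed
    then show ?B using n(1) by blast
  next
    assume ?B
    then obtain n where n: "n \<ge> 1"
      "\<And>g'. g' \<in> mspace (surj_space X) \<Longrightarrow> (\<And>x. x \<in> limset \<Longrightarrow> g' x n = g x n) \<Longrightarrow> g' \<in> U" by blast
    obtain \<delta> where \<delta>: "\<delta> > 0" "\<And>x y. x \<in> limset \<Longrightarrow> y \<in> limset \<Longrightarrow> mdist X x y < \<delta> \<Longrightarrow> x n = y n"
      using coord_eq_if_mdist_small[OF n(1)] by blast
    have "g' \<in> U" if "g' \<in> mspace (surj_space X)" "mdist (surj_space X) g g' < \<delta>" for g'
    proof (rule n(2))
      show g': "g' \<in> mspace (surj_space X)" by (rule that(1))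
      fix x assume x: "x \<in> limset"
      have "mdist (cfunspace (mtopology_of X) X) g g' < \<delta>" using that(2) by (simp only: d)
      then have "mdist X (g x) (g' x) < \<delta>"
        by (rule cfunspace_mdist_lt[OF comp subsetD[OF sub g] subsetD[OF sub g']]) (simp add: X x)
      then show "g' x n = g x n" using \<delta>(2)[OF val[OF g x] val[OF g' x]] by simp
    qed
    then have "S.mball g \<delta> \<subseteq> U" using S.in_mball by blast
    then show ?A using \<delta>(1) by blast
  qed
  show ?thesis unfolding op using ball by blast
qed

lemma homeo_set_eq:
  "homeo_set X = {h \<in> extensional limset. lim_cont h \<and> bij_betw h limset limset}"
proof -
  have "h ` limset = limset \<and> inj_on h limset" if "homeomorphic_map limtop limtop h" for h
    using homeomorphic_imp_surjective_map[OF that] homeomorphic_imp_injective_map[OF that] by simp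
  then show ?thesis
    using lim_cont_inverse(1)
    by (auto simp: homeo_set_def mspace_surj_space X bij_betw_def)
qed

end

end

section \<open>The homeomorphism on the inverse limit\<close>

locale shimomura_system = finite_inverse_system I p for I :: "nat \<Rightarrow> 'a set" and p +
  fixes \<phi> :: "nat \<Rightarrow> 'a rel"
  assumes rel_surj: "n \<ge> 1 \<Longrightarrow> surjective_rel (I n) (\<phi> n)"
    and rel_step: "n \<ge> 1 \<Longrightarrow> map_prod (p n) (p n) ` \<phi> (Suc n) = \<phi> n"
    and shimomura: "shimomura_condition I \<phi> p"
begin

abbreviation "limrel \<equiv> inverse_limit_rel I \<phi> p"

lemma limrel_coord: "(x, y) \<in> limrel \<Longrightarrow> x \<in> limset \<and> y \<in> limset \<and> (n \<ge> 1 \<longrightarrow> (x n, y n) \<in> \<phi> n)"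
  unfolding inverse_limit_rel_def by blast

lemma limrelI: "x \<in> limset \<Longrightarrow> y \<in> limset \<Longrightarrow> (\<And>n. n \<ge> 1 \<Longrightarrow> (x n, y n) \<in> \<phi> n) \<Longrightarrow> (x, y) \<in> limrel"
  unfolding inverse_limit_rel_def by blast

lemma rel_in_level: "n \<ge> 1 \<Longrightarrow> (a, b) \<in> \<phi> n \<Longrightarrow> a \<in> I n \<and> b \<in> I n"
  using rel_surj[of n] unfolding surjective_rel_def by blast

lemma rel_descend:
  assumes "x \<in> limset" "y \<in> limset" "1 \<le> n" "n \<le> m" "(x m, y m) \<in> \<phi> m"
  shows "(x n, y n) \<in> \<phi> n"
  using assms(4,5)
proof (induction m rule: dec_induct)
  case (step m)
  have m: "m \<ge> 1" using step.hyps assms(3) by simp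
  have "map_prod (p m) (p m) (x (Suc m), y (Suc m)) \<in> \<phi> m"
    using rel_step[OF m] step.prems by blast
  then show ?case using limset_step[OF assms(1) m] limset_step[OF assms(2) m] step.IH by simp
qed

text \<open>The edge sets form an inverse system of their own, with the bonding maps acting on both ends;
  its threads are the elements of \<open>limrel\<close>.\<close>

lemma edge_through:
  assumes "n \<ge> 1" "(a, b) \<in> \<phi> n"
  obtains x y where "(x, y) \<in> limrel" "x n = a" "y n = b"
proof -
  interpret E: inverse_system \<phi> "\<lambda>n. map_prod (p n) (p n)"
    by unfold_locales (rule rel_step)
  obtain z where z: "z \<in> E.limset" "z n = (a, b)" using E.limset_through assms by blast
  define x y where "x k = (if k \<ge> 1 then fst (z k) else undefined)"
    and "y k = (if k \<ge> 1 then snd (z k) else undefined)" for k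
  have zk: "z k \<in> \<phi> k" "map_prod (p k) (p k) (z (Suc k)) = z k" if "k \<ge> 1" for k
    using E.limset_coord[OF z(1) that] E.limset_step[OF z(1) that] by auto
  have xk: "x k = fst (z k)" "y k = snd (z k)" if "k \<ge> 1" for k
    using that by (simp_all add: x_def y_def)
  have px: "p k (x (Suc k)) = x k" "p k (y (Suc k)) = y k" if "k \<ge> 1" for k
  proof -
    have "x (Suc k) = fst (z (Suc k))" "y (Suc k) = snd (z (Suc k))" by (simp_all add: x_def y_def)
    then show "p k (x (Suc k)) = x k" "p k (y (Suc k)) = y k"
      using arg_cong[OF zk(2)[OF that], of fst] arg_cong[OF zk(2)[OF that], of snd] xk[OF that]
      by simp_all
  qed
  have xy: "(x k, y k) \<in> \<phi> k" if "k \<ge> 1" for k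
    using zk(1)[OF that] xk[OF that] by simp
  have inI: "x k \<in> I k" "y k \<in> I k" if "k \<ge> 1" for k
    using rel_in_level[OF that xy[OF that]] by auto
  have "x \<in> limset"
    by (rule limsetI) (use inI(1) px(1) in \<open>simp_all add: x_def\<close>)
  moreover have "y \<in> limset"
    by (rule limsetI) (use inI(2) px(2) in \<open>simp_all add: y_def\<close>)
  ultimately have "(x, y) \<in> limrel"
    using xy by (intro limrelI)
  then show ?thesis using that z(2) assms(1) xk[OF assms(1)] by simp
qed

lemma shimomura_level:
  assumes "n \<ge> 1"
  obtains m where "m > n" "\<And>a b b'. (a, b) \<in> \<phi> m \<Longrightarrow> (a, b') \<in> \<phi> m \<Longrightarrow> bond p m n b = bond p m n b'"
proof -
  obtain m where m: "m > n" "\<forall>a\<in>I m. \<exists>!c. (a, c) \<in> {(a, bond p m n b) |a b. (a, b) \<in> \<phi> m}"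
    using shimomura assms unfolding shimomura_condition_def by blast
  have "bond p m n b = bond p m n b'" if "(a, b) \<in> \<phi> m" "(a, b') \<in> \<phi> m" for a b b'
  proof -
    have "a \<in> I m" using rel_in_level[of m] m(1) assms that(1) by auto
    then show ?thesis using m(2) that by blast
  qed
  then show ?thesis using that m(1) by blast
qed

lemma limrel_determined:
  assumes "n \<ge> 1"
  obtains m where "m > n"
    "\<And>x y x' y'. (x, y) \<in> limrel \<Longrightarrow> (x', y') \<in> limrel \<Longrightarrow> x m = x' m \<Longrightarrow> y n = y' n"
proof -
  obtain m where m: "m > n" "\<And>a b b'. (a, b) \<in> \<phi> m \<Longrightarrow> (a, b') \<in> \<phi> m \<Longrightarrow> bond p m n b = bond p m n b'"
    using shimomura_level[OF assms] by blast
  have "y n = y' n" if "(x, y) \<in> limrel" "(x', y') \<in> limrel" "x m = x' m" for x y x' y'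
  proof -
    have m1: "m \<ge> 1" "n \<le> m" using m(1) by auto
    have "(x m, y m) \<in> \<phi> m" "(x m, y' m) \<in> \<phi> m" "y \<in> limset" "y' \<in> limset"
      using limrel_coord[OF that(1), of m] limrel_coord[OF that(2), of m] that(3) m1 by auto
    then show ?thesis
      using m(2) limset_bond[OF _ assms m1(2)] by metis
  qed
  then show ?thesis using that m(1) by blast
qed

lemma limrel_image_unique: "(x, y) \<in> limrel \<Longrightarrow> (x, y') \<in> limrel \<Longrightarrow> y = y'"
  using limset_ext[of y y'] limrel_coord limrel_determined by metis

text \<open>Choose threads \<open>y\<^sub>j\<close> that are joined to \<open>x\<close> by an edge at level \<open>j + 1\<close>, hence at all lower
  levels.  The Shimomura condition determines the coordinate \<open>n\<close> of \<open>y\<^sub>j\<close> as soon as \<open>j \<ge> m\<close>, so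
  the sequence converges.\<close>

lemma limrel_image_exists:
  assumes x: "x \<in> limset"
  obtains y where "(x, y) \<in> limrel"
proof -
  have "\<exists>y\<in>limset. (x (Suc j), y (Suc j)) \<in> \<phi> (Suc j)" for j
  proof -
    have "x (Suc j) \<in> fst ` \<phi> (Suc j)"
      using rel_surj[of "Suc j"] limset_coord[OF x, of "Suc j"] by (simp add: surjective_rel_def)
    then obtain b where b: "(x (Suc j), b) \<in> \<phi> (Suc j)" by force
    then have "b \<in> I (Suc j)" using rel_in_level by auto
    then obtain y where "y \<in> limset" "y (Suc j) = b" using limset_through[of "Suc j" b] by auto
    then show ?thesis using b by blast
  qed
  then obtain y where y: "\<And>j. y j \<in> limset" "\<And>j. (x (Suc j), y j (Suc j)) \<in> \<phi> (Suc j)"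
    by metis
  have low: "(x n, y j n) \<in> \<phi> n" if "1 \<le> n" "n \<le> j" for n j
    using rel_descend[OF x y(1) that(1) _ y(2)] that(2) by simp
  have "\<exists>N c. \<forall>j\<ge>N. y j n = c" if n: "n \<ge> 1" for n
  proof -
    obtain m where m: "m > n" "\<And>a b b'. (a, b) \<in> \<phi> m \<Longrightarrow> (a, b') \<in> \<phi> m \<Longrightarrow> bond p m n b = bond p m n b'"
      using shimomura_level[OF n] by blast
    have "y j n = y m n" if "j \<ge> m" for j
      using m(2)[OF low[of m j] low[of m m]] limset_bond[OF y(1) n, of m] m(1) n that by simp
    then show ?thesis by blast
  qed
  then obtain z where z: "z \<in> limset" "\<And>n. n \<ge> 1 \<Longrightarrow> \<exists>N. \<forall>j\<ge>N. y j n = z n"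
    by (rule limset_of_stable[OF y(1)]) blast+
  have "(x n, z n) \<in> \<phi> n" if n: "n \<ge> 1" for n
  proof -
    obtain N where "\<forall>j\<ge>N. y j n = z n" using z(2)[OF n] by blast
    then have "y (max N n) n = z n" by simp
    then show ?thesis using low[OF n, of "max N n"] by simp
  qed
  then show ?thesis using that limrelI[OF x z(1)] by blast
qed

definition limmap :: "(nat \<Rightarrow> 'a) \<Rightarrow> nat \<Rightarrow> 'a" where
  "limmap = restrict (\<lambda>x. SOME y. (x, y) \<in> limrel) limset"

lemma limmap_iff: "x \<in> limset \<Longrightarrow> (x, y) \<in> limrel \<longleftrightarrow> y = limmap x"
  using limrel_image_exists[of x] limrel_image_unique
  unfolding limmap_def restrict_apply by (metis someI)

lemma limmap_in: "x \<in> limset \<Longrightarrow> limmap x \<in> limset"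
  using limmap_iff limrel_coord by blast

lemma limmap_coord: "x \<in> limset \<Longrightarrow> n \<ge> 1 \<Longrightarrow> (x n, limmap x n) \<in> \<phi> n"
  using limmap_iff[of x "limmap x"] limrel_coord[of x "limmap x" n] by simp

lemma limrel_graph: "limrel = {(x, limmap x) |x. x \<in> limset}"
proof (intro equalityI subsetI)
  fix e assume e: "e \<in> limrel"
  obtain x y where xy: "e = (x, y)" by (cases e)
  then have "x \<in> limset" using limrel_coord e by blast
  then show "e \<in> {(x, limmap x) |x. x \<in> limset}" using limmap_iff e xy by blast
next
  fix e assume "e \<in> {(x, limmap x) |x. x \<in> limset}"
  then show "e \<in> limrel" using limmap_iff by blast
qed

lemma lim_cont_limmap: "lim_cont limmap"
  unfolding lim_cont_def
proof (intro conjI allI impI)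
  fix n :: nat assume n: "n \<ge> 1"
  obtain m where m: "m > n"
    "\<And>x y x' y'. (x, y) \<in> limrel \<Longrightarrow> (x', y') \<in> limrel \<Longrightarrow> x m = x' m \<Longrightarrow> y n = y' n"
    using limrel_determined[OF n] by blast
  have "depends m (\<lambda>x. limmap x n)"
    unfolding depends_def using m(2) limmap_iff by blast
  moreover have "m \<ge> 1" using m(1) n by simp
  ultimately show "loc_const (\<lambda>x. limmap x n)" unfolding loc_const_def by blast
qed (use limmap_in in auto)

end

lemma inverse_limit_rel_converse:
  "inverse_limit_rel I (\<lambda>n. (\<phi> n)\<inverse>) p = (inverse_limit_rel I \<phi> p)\<inverse>"
  unfolding inverse_limit_rel_def by blast

lemma surjective_rel_converse: "surjective_rel A R \<Longrightarrow> surjective_rel A (R\<inverse>)"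
  unfolding surjective_rel_def by (intro conjI) (blast, force simp: image_iff Bex_def, force simp: image_iff Bex_def)

lemma map_prod_converse: "map_prod q q ` (R\<inverse>) = (map_prod q q ` R)\<inverse>"
  by force

locale invertible_shimomura_system = shimomura_system I p \<phi> for I :: "nat \<Rightarrow> 'a set" and p \<phi> +
  assumes invertible: "invertible_seq I \<phi> p"
    and bifurcating: "bifurcation I p"
begin

text \<open>Invertibility makes the forward theory applicable to the reversed relations, which gives the
  inverse of \<open>limmap\<close>.\<close>

sublocale inv: shimomura_system I p "\<lambda>n. (\<phi> n)\<inverse>"
  using invertible rel_step rel_surj
  by unfold_locales (auto simp: invertible_seq_def surjective_rel_converse map_prod_converse)

lemma bij_limmap: "bij_betw limmap limset limset"
proof (rule bij_betw_byWitness[where f' = inv.limmap])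
  have eq: "y = limmap x \<longleftrightarrow> x = inv.limmap y" if "x \<in> limset" "y \<in> limset" for x y
    unfolding limmap_iff[OF that(1), symmetric] inv.limmap_iff[OF that(2), symmetric]
      inverse_limit_rel_converse by blast
  show "\<forall>a\<in>limset. inv.limmap (limmap a) = a" using eq limmap_in by metis
  show "\<forall>a\<in>limset. limmap (inv.limmap a) = a" using eq inv.limmap_in by metis
qed (use limmap_in inv.limmap_in in auto)

section \<open>Perfectness, and homeomorphisms matching two partitions\<close>

lemma another_point:
  assumes x: "x \<in> limset" and n: "n \<ge> 1"
  obtains y where "y \<in> limset" "y n = x n" "y \<noteq> x"
proof -
  obtain m a b where m: "m > n" "a \<in> I m" "b \<in> I m" "a \<noteq> b" "bond p m n a = x n" "bond p m n b = x n"
    using bifurcating n limset_coord[OF x n] unfolding bifurcation_def by blast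
  have m1: "m \<ge> 1" using m(1) n by simp
  obtain y where "y \<in> limset" "y m = a" using limset_through[OF m1 m(2)] by blast
  moreover obtain z where "z \<in> limset" "z m = b" using limset_through[OF m1 m(3)] by blast
  ultimately have yz: "y \<in> limset" "y m = a" "z \<in> limset" "z m = b" by blast+
  then have "y n = x n" "z n = x n" "y \<noteq> z"
    using limset_bond[OF _ n, of _ m] m by auto
  then show ?thesis using that yz by metis
qed

lemma cantor_limtop: "cantor_space limtop"
proof -
  have "x \<in> limtop derived_set_of limset" if x: "x \<in> limset" for x
    unfolding in_derived_set_of
  proof (intro conjI allI impI)
    fix U assume "x \<in> U \<and> openin limtop U"
    then obtain n where "n \<ge> 1" "\<And>y. y \<in> limset \<Longrightarrow> y n = x n \<Longrightarrow> y \<in> U"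
      unfolding openin_limtop_iff by blast
    then show "\<exists>y. y \<noteq> x \<and> y \<in> limset \<and> y \<in> U" using another_point[OF x] by metis
  qed (use x in simp)
  then have "limtop derived_set_of topspace limtop = topspace limtop"
    using derived_set_of_subset_topspace[of limtop limset] by auto
  then show ?thesis
    unfolding cantor_space_def
    using limset_nonempty metrizable_limtop compact_limtop dim_limtop by simp
qed

text \<open>Every nonempty clopen set contains two points and is cut in two by a coordinate that tells
  them apart; so it can be cut into any finite number of pieces.\<close>

lemma loc_const_onto:
  assumes "finite F" "F \<noteq> {}" "loc_const (\<lambda>x. x \<in> A)" "A \<subseteq> limset" "A \<noteq> {}"
  shows "\<exists>s. loc_const s \<and> s ` A = F"
  using assms
proof (induction F arbitrary: A rule: finite_ne_induct)
  case (singleton a)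
  have "loc_const (\<lambda>x. a)" by (auto simp: loc_const_def depends_def)
  moreover have "(\<lambda>x. a) ` A = {a}" using singleton by auto
  ultimately show ?case by blast
next
  case (insert a F)
  obtain x where x: "x \<in> A" using insert.prems by blast
  then have xL: "x \<in> limset" using insert.prems by blast
  obtain n where n: "n \<ge> 1" "depends n (\<lambda>x. x \<in> A)" using insert.prems by (auto simp: loc_const_def)
  obtain y where y: "y \<in> limset" "y n = x n" "y \<noteq> x" using another_point[OF xL n(1)] by blast
  have yA: "y \<in> A" using n(2) y xL x unfolding depends_def by metis
  obtain m where m: "m \<ge> 1" "y m \<noteq> x m" using limset_ext[OF y(1) xL] y(3) by blast
  define B where "B = {z \<in> A. z m \<noteq> x m}"
  have "loc_const (\<lambda>z. (z \<in> A) \<and> (z m \<noteq> x m))"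
    using loc_const_pair[OF insert.prems(1) loc_const_coord[OF m(1), of "\<lambda>c. c \<noteq> x m"], of "(\<and>)"] .
  then have "loc_const (\<lambda>z. z \<in> B)" by (simp add: B_def)
  moreover have "B \<subseteq> limset" "B \<noteq> {}" using insert.prems yA m(2) by (auto simp: B_def)
  ultimately obtain s where s: "loc_const s" "s ` B = F" using insert.IH by blast
  define s' where "s' = (\<lambda>z. if z m = x m then a else s z)"
  have "loc_const s'"
    using loc_const_pair[OF loc_const_coord[OF m(1), of "\<lambda>c. c = x m"] s(1), of "\<lambda>b c. if b then a else c"]
    by (simp add: s'_def)
  moreover have "s' ` A = insert a F"
  proof -
    have "A = {z \<in> A. z m = x m} \<union> B" by (auto simp: B_def)
    moreover have "s' ` {z \<in> A. z m = x m} = {a}" using x by (auto simp: s'_def)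
    moreover have "s' ` B = F" using s(2) by (auto simp: s'_def B_def)
    ultimately show ?thesis
      using image_Un[of s' "{z \<in> A. z m = x m}" B] by simp
  qed
  ultimately show ?case by blast
qed

lemma finite_image_loc_const:
  assumes "loc_const u"
  shows "finite (u ` limset)"
proof -
  obtain n where n: "n \<ge> 1" "depends n u" using assms by (auto simp: loc_const_def)
  have "u ` limset \<subseteq> (\<lambda>a. u (SOME y. y \<in> limset \<and> y n = a)) ` I n"
    using depends_factor[OF n(2)] limset_coord[OF _ n(1)] by blast
  then show ?thesis using finite_level[OF n(1)] finite_surj by blast
qed

lemma loc_const_glue:
  assumes w: "loc_const w" and s: "\<And>k. k \<in> w ` limset \<Longrightarrow> loc_const (s k)"
  shows "loc_const (\<lambda>x. s (w x) x)"
proof -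
  have "\<exists>m\<ge>1. \<forall>y\<in>limset. \<forall>z\<in>limset. y m = x m \<longrightarrow> z m = x m \<longrightarrow> s (w y) y = s (w z) z"
    if x: "x \<in> limset" for x
  proof -
    obtain n where n: "n \<ge> 1" "depends n w" using w by (auto simp: loc_const_def)
    obtain m where m: "m \<ge> n" "m \<ge> 1" "depends m (s (w x))"
      using loc_const_ge[OF s[OF imageI[OF x]]] by blast
    have mw: "depends m w" using depends_mono n m by blast
    have "s (w y) y = s (w z) z" if "y \<in> limset" "z \<in> limset" "y m = x m" "z m = x m" for y z
    proof -
      have "w y = w x" "w z = w x" using mw that x unfolding depends_def by metis+
      moreover have "s (w x) y = s (w x) z" using m(3) that unfolding depends_def by metis
      ultimately show ?thesis by simp
    qed
    then show ?thesis using m(2) by blast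
  qed
  then obtain k where "k \<ge> 1" "\<And>y z. y \<in> limset \<Longrightarrow> z \<in> limset \<Longrightarrow> y k = z k \<Longrightarrow> s (w y) y = s (w z) z"
    by (rule cylinder_uniform[where Q = "\<lambda>y z. s (w y) y = s (w z) z"]) blast+
  then show ?thesis unfolding loc_const_def depends_def by blast
qed

text \<open>One step of the back-and-forth: \<open>u\<close> is refined by \<open>v\<close>, and the cells of \<open>w\<close> are cut into as
  many pieces as the corresponding cells of \<open>u\<close>.  The values are natural numbers so that all stages
  of the construction have the same type.\<close>

lemma refine_left:
  fixes u w :: "(nat \<Rightarrow> 'a) \<Rightarrow> nat"
  assumes u: "loc_const u" and w: "loc_const w" and v: "loc_const v"
    and im: "u ` limset = w ` limset"
  obtains u' w' :: "(nat \<Rightarrow> 'a) \<Rightarrow> nat" and r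
  where "loc_const u'" "loc_const w'" "u' ` limset = w' ` limset"
    "\<And>x. x \<in> limset \<Longrightarrow> u x = r (u' x)" "\<And>x. x \<in> limset \<Longrightarrow> w x = r (w' x)"
    "\<And>x y. x \<in> limset \<Longrightarrow> y \<in> limset \<Longrightarrow> u' x = u' y \<Longrightarrow> v x = v y"
proof -
  define V where "V = (\<lambda>x. (u x, v x)) ` limset"
  have "finite V" unfolding V_def using finite_image_loc_const[OF loc_const_pair[OF u v, of Pair]] .
  then obtain e :: "_ \<Rightarrow> nat" where e: "inj_on e V"
    using finite_imp_inj_to_nat_seg by metis
  define F where "F k = v ` {x \<in> limset. u x = k}" for k
  have "\<exists>s. loc_const s \<and> s ` {x \<in> limset. w x = k} = F k" if k: "k \<in> w ` limset" for k
  proof (rule loc_const_onto)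
    show "finite (F k)" using finite_image_loc_const[OF v] unfolding F_def by (rule rev_finite_subset) blast
    show "F k \<noteq> {}" using k im[symmetric] by (auto simp: F_def)
    obtain n where "n \<ge> 1" "depends n w" using w by (auto simp: loc_const_def)
    then show "loc_const (\<lambda>x. x \<in> {x \<in> limset. w x = k})"
      unfolding loc_const_def depends_def by (metis (mono_tags, lifting) mem_Collect_eq)
  qed (use k in auto)
  then obtain s where s: "\<And>k. k \<in> w ` limset \<Longrightarrow> loc_const (s k)"
      "\<And>k. k \<in> w ` limset \<Longrightarrow> s k ` {x \<in> limset. w x = k} = F k"
    by metis
  define u' where "u' x = e (u x, v x)" for x
  define w' where "w' x = e (w x, s (w x) x)" for x
  have Vw: "(\<lambda>x. (w x, s (w x) x)) ` limset = V"
  proof (intro equalityI subsetI)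
    fix c assume "c \<in> (\<lambda>x. (w x, s (w x) x)) ` limset"
    then obtain x where x: "x \<in> limset" "c = (w x, s (w x) x)" by blast
    then have "s (w x) x \<in> F (w x)" using s(2)[of "w x"] by blast
    then obtain y where "y \<in> limset" "u y = w x" "v y = s (w x) x" unfolding F_def by auto
    then show "c \<in> V" unfolding V_def x(2) by (intro image_eqI[of _ _ y]) simp_all
  next
    fix c assume "c \<in> V"
    then obtain x where x: "x \<in> limset" "c = (u x, v x)" by (auto simp: V_def)
    have "v x \<in> F (u x)" unfolding F_def using x(1) by blast
    moreover have "u x \<in> w ` limset" using im x(1) by blast
    ultimately have "v x \<in> s (u x) ` {y \<in> limset. w y = u x}" using s(2)[of "u x"] by simp
    then obtain y where y0: "v x = s (u x) y" "y \<in> {y \<in> limset. w y = u x}" by (rule imageE)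
    then have y: "y \<in> limset" "w y = u x" by simp_all
    show "c \<in> (\<lambda>x. (w x, s (w x) x)) ` limset"
      unfolding x(2) by (rule image_eqI[OF _ y(1)]) (simp add: y(2) y0(1))
  qed
  define r where "r c = fst (inv_into V e c)" for c
  have inV: "(u x, v x) \<in> V" "(w x, s (w x) x) \<in> V" if "x \<in> limset" for x
    using that Vw by (auto simp: V_def)
  show ?thesis
  proof (rule that[of u' w' r])
    show "loc_const u'" unfolding u'_def using loc_const_pair[OF u v, where q = "\<lambda>a b. e (a, b)"] .
    show "loc_const w'" unfolding w'_def
      using loc_const_pair[OF w loc_const_glue[OF w s(1)], where q = "\<lambda>a b. e (a, b)"] .
    have "u' ` limset = e ` V" unfolding u'_def V_def by (simp add: image_image)
    moreover have "w' ` limset = e ` V" unfolding w'_def Vw[symmetric] by (simp add: image_image)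
    ultimately show "u' ` limset = w' ` limset" by simp
    show "u x = r (u' x)" "w x = r (w' x)" if "x \<in> limset" for x
      using inV[OF that] e by (simp_all add: r_def u'_def w'_def)
    show "v x = v y" if "x \<in> limset" "y \<in> limset" "u' x = u' y" for x y
      using inV that e unfolding u'_def by (metis inj_onD prod.inject)
  qed
qed

lemma refine_both:
  fixes u w :: "(nat \<Rightarrow> 'a) \<Rightarrow> nat"
  assumes u: "loc_const u" and w: "loc_const w" and n: "n \<ge> 1"
    and im: "u ` limset = w ` limset"
  obtains u' w' :: "(nat \<Rightarrow> 'a) \<Rightarrow> nat" and r
  where "loc_const u'" "loc_const w'" "u' ` limset = w' ` limset"
    "\<And>x. x \<in> limset \<Longrightarrow> u x = r (u' x)" "\<And>x. x \<in> limset \<Longrightarrow> w x = r (w' x)"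
    "separates n u'" "separates n w'"
proof -
  obtain u1 w1 :: "(nat \<Rightarrow> 'a) \<Rightarrow> nat" and r1 where 1: "loc_const u1" "loc_const w1" "u1 ` limset = w1 ` limset"
    "\<And>x. x \<in> limset \<Longrightarrow> u x = r1 (u1 x)" "\<And>x. x \<in> limset \<Longrightarrow> w x = r1 (w1 x)"
    "\<And>x y. x \<in> limset \<Longrightarrow> y \<in> limset \<Longrightarrow> u1 x = u1 y \<Longrightarrow> x n = y n"
    using refine_left[OF u w loc_const_coord[OF n, of "\<lambda>c. c"] im] by blast
  obtain w2 u2 :: "(nat \<Rightarrow> 'a) \<Rightarrow> nat" and r2 where 2: "loc_const w2" "loc_const u2" "w2 ` limset = u2 ` limset"
    "\<And>x. x \<in> limset \<Longrightarrow> w1 x = r2 (w2 x)" "\<And>x. x \<in> limset \<Longrightarrow> u1 x = r2 (u2 x)"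
    "\<And>x y. x \<in> limset \<Longrightarrow> y \<in> limset \<Longrightarrow> w2 x = w2 y \<Longrightarrow> x n = y n"
    using refine_left[OF 1(2,1) loc_const_coord[OF n, of "\<lambda>c. c"] 1(3)[symmetric]] by blast
  show ?thesis
  proof (rule that[of u2 w2 "r1 \<circ> r2"])
    show "separates n u2" unfolding separates_def using 1(6) 2(5) by metis
    show "separates n w2" unfolding separates_def using 2(6) by blast
  qed (use 1 2 in auto)
qed

text \<open>Any two partitions of the limit into the same number of nonempty clopen cells are matched by a
  homeomorphism: refine them alternately, and compare the two towers obtained.\<close>

lemma homeo_matching:
  assumes u: "loc_const u" and w: "loc_const w" and im: "u ` limset = w ` limset"
  obtains h where "lim_cont h" "bij_betw h limset limset" "h \<in> extensional limset"
    "\<And>x. x \<in> limset \<Longrightarrow> w (h x) = u x"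
proof -
  obtain e :: "_ \<Rightarrow> nat" where e: "inj_on e (u ` limset)"
    using finite_imp_inj_to_nat_seg[OF finite_image_loc_const[OF u]] by blast
  define ok where "ok \<equiv> \<lambda>(i::nat) (uw :: ((nat \<Rightarrow> 'a) \<Rightarrow> nat) \<times> ((nat \<Rightarrow> 'a) \<Rightarrow> nat)).
    loc_const (fst uw) \<and> loc_const (snd uw) \<and> fst uw ` limset = snd uw ` limset \<and>
    (i = 0 \<longrightarrow> uw = (e \<circ> u, e \<circ> w)) \<and> (i \<ge> 1 \<longrightarrow> separates i (fst uw) \<and> separates i (snd uw))"
  define nxt where "nxt \<equiv> \<lambda>(i::nat) (uw :: ((nat \<Rightarrow> 'a) \<Rightarrow> nat) \<times> ((nat \<Rightarrow> 'a) \<Rightarrow> nat)) (uw' :: ((nat \<Rightarrow> 'a) \<Rightarrow> nat) \<times> ((nat \<Rightarrow> 'a) \<Rightarrow> nat)).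
    \<exists>r. \<forall>x\<in>limset. fst uw x = r (fst uw' x) \<and> snd uw x = r (snd uw' x)"
  have "\<exists>f. \<forall>i. ok i (f i) \<and> nxt i (f i) (f (Suc i))"
  proof (rule dependent_nat_choice)
    have "loc_const (e \<circ> u)" "loc_const (e \<circ> w)"
      using loc_const_pair[OF u u, of "\<lambda>a b. e a"] loc_const_pair[OF w w, of "\<lambda>a b. e a"] by (simp_all add: o_def)
    moreover have "(e \<circ> u) ` limset = (e \<circ> w) ` limset" using im by (metis image_comp)
    ultimately show "\<exists>uw. ok 0 uw" by (intro exI[of _ "(e \<circ> u, e \<circ> w)"]) (simp add: ok_def)
    fix uw i assume ok: "ok i uw"
    obtain u' w' :: "(nat \<Rightarrow> 'a) \<Rightarrow> nat" and r where *: "loc_const u'" "loc_const w'" "u' ` limset = w' ` limset"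
      "\<And>x. x \<in> limset \<Longrightarrow> fst uw x = r (u' x)" "\<And>x. x \<in> limset \<Longrightarrow> snd uw x = r (w' x)"
      "separates (Suc i) u'" "separates (Suc i) w'"
      using refine_both[of "fst uw" "snd uw" "Suc i"] ok unfolding ok_def by auto
    then have "ok (Suc i) (u', w')" "nxt i uw (u', w')" by (auto simp: ok_def nxt_def)
    then show "\<exists>uw'. ok (Suc i) uw' \<and> nxt i uw uw'" by blast
  qed
  then obtain f where f: "\<And>i. ok i (f i)" "\<And>i. nxt i (f i) (f (Suc i))" by blast
  obtain r where r: "\<And>i x. x \<in> limset \<Longrightarrow> fst (f i) x = r i (fst (f (Suc i)) x) \<and> snd (f i) x = r i (snd (f (Suc i)) x)"
    using f(2) unfolding nxt_def by metis
  have sep: "\<exists>i. separates n (fst (f i))" "\<exists>i. separates n (snd (f i))" if "n \<ge> 1" for n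
    using f(1)[of n] that unfolding ok_def by blast+
  obtain h where h: "lim_cont h" "bij_betw h limset limset" "h \<in> extensional limset"
    "\<And>i x. x \<in> limset \<Longrightarrow> snd (f i) (h x) = fst (f i) x"
  proof (rule homeo_from_towers[of "\<lambda>i. fst (f i)" "\<lambda>i. snd (f i)" r])
    show "fst (f i) ` limset = snd (f i) ` limset" "loc_const (fst (f i))" "loc_const (snd (f i))" for i
      using f(1)[of i] unfolding ok_def by blast+
    show "fst (f i) x = r i (fst (f (Suc i)) x)" "snd (f i) x = r i (snd (f (Suc i)) x)"
      if "x \<in> limset" for i x
      using r[OF that, of i] by blast+
  qed (use sep in blast)+
  have "f 0 = (e \<circ> u, e \<circ> w)" using f(1)[of 0] by (simp add: ok_def)
  then have ew: "e (w (h x)) = e (u x)" if "x \<in> limset" for x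
    using h(4)[OF that, of 0] by simp
  have "w (h x) = u x" if "x \<in> limset" for x
  proof (rule inj_onD[OF e ew[OF that]])
    have "h x \<in> limset" using h(1) that by (auto simp: lim_cont_def)
    then show "w (h x) \<in> u ` limset" using im by blast
  qed (use that in blast)
  then show ?thesis using that h by blast
qed

section \<open>The conjugacy class as a lifting property\<close>

text \<open>\<open>\<alpha>\<close> is a factor map from the system \<open>(X, g)\<close> onto level \<open>n\<close>.\<close>

definition is_factor :: "((nat \<Rightarrow> 'a) \<Rightarrow> nat \<Rightarrow> 'a) \<Rightarrow> ((nat \<Rightarrow> 'a) \<Rightarrow> 'a) \<Rightarrow> nat \<Rightarrow> bool" where
  "is_factor g \<alpha> n \<longleftrightarrow> loc_const \<alpha> \<and> (\<lambda>x. (\<alpha> x, \<alpha> (g x))) ` limset = \<phi> n"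

text \<open>Factors of \<open>g\<close> lift along the sequence, to factors that are arbitrarily fine.\<close>

definition lifting :: "((nat \<Rightarrow> 'a) \<Rightarrow> nat \<Rightarrow> 'a) \<Rightarrow> bool" where
  "lifting g \<longleftrightarrow> (\<forall>n\<ge>1. \<forall>\<alpha>. is_factor g \<alpha> n \<longrightarrow> (\<forall>l\<ge>1. \<exists>m>n. \<exists>\<gamma>.
     is_factor g \<gamma> m \<and> separates l \<gamma> \<and> (\<forall>x\<in>limset. bond p m n (\<gamma> x) = \<alpha> x)))"

lemma is_factor_coord: "n \<ge> 1 \<Longrightarrow> is_factor limmap (\<lambda>x. x n) n"
  unfolding is_factor_def
proof (intro conjI equalityI subsetI)
  fix e assume n: "n \<ge> 1" and "e \<in> \<phi> n"
  then obtain x y where "(x, y) \<in> limrel" "e = (x n, y n)"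
    by (cases e) (metis edge_through)
  then show "e \<in> (\<lambda>x. (x n, limmap x n)) ` limset" unfolding limrel_graph by blast
qed (use limmap_coord loc_const_coord[of n "\<lambda>c. c"] in auto)

lemma is_factor_image:
  assumes "n \<ge> 1" "is_factor g \<alpha> n"
  shows "\<alpha> ` limset = I n"
proof -
  have "\<alpha> ` limset = fst ` (\<lambda>x. (\<alpha> x, \<alpha> (g x))) ` limset" by (simp add: image_image)
  also have "\<dots> = I n" using assms rel_surj[of n] by (simp add: is_factor_def surjective_rel_def)
  finally show ?thesis .
qed

lemma is_factor_comp:
  assumes q: "system_surj q (I m, \<phi> m) (I n, \<phi> n)" and \<gamma>: "is_factor g \<gamma> m"
  shows "is_factor g (\<lambda>x. q (\<gamma> x)) n"
proof -
  have "(\<lambda>x. (q (\<gamma> x), q (\<gamma> (g x)))) ` limset = map_prod q q ` (\<lambda>x. (\<gamma> x, \<gamma> (g x))) ` limset"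
    by (simp add: image_image)
  also have "\<dots> = \<phi> n" using q \<gamma> by (simp add: is_factor_def system_surj_def)
  finally show ?thesis
    using \<gamma> loc_const_pair[of \<gamma> \<gamma> "\<lambda>a b. q a"] by (simp add: is_factor_def)
qed

text \<open>A factor of \<open>f\<close> onto level \<open>n\<close> is \<open>q\<^sub>1 \<circ> \<pi>\<^sub>k\<close> for a system surjection \<open>q\<^sub>1\<close> and a high level
  \<open>k\<close>.  The factoring property gives \<open>q\<^sub>1 \<circ> q\<^sub>2 = p\<^bsub>m,n\<^esub>\<close>, but \<open>q\<^sub>2\<close> goes from \<open>m\<close> to \<open>k\<close>, the wrong
  direction for a lift of \<open>\<pi>\<^sub>k\<close>.  Applying it again to \<open>q\<^sub>2\<close> gives \<open>q\<^sub>2 \<circ> q\<^sub>3 = p\<^bsub>j,k\<^esub>\<close>, and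
  \<open>q\<^sub>3 \<circ> \<pi>\<^sub>j\<close> is the lift; it is as fine as \<open>\<pi>\<^sub>k = q\<^sub>2 \<circ> q\<^sub>3 \<circ> \<pi>\<^sub>j\<close>.\<close>

lemma lifting_limmap:
  assumes fac: "factoring_property I \<phi> p"
  shows "lifting limmap"
  unfolding lifting_def
proof (intro allI impI)
  fix n \<alpha> and l :: nat
  assume n: "n \<ge> 1" and \<alpha>: "is_factor limmap \<alpha> n" and l: "l \<ge> 1"
  obtain k where k: "k \<ge> max (Suc n) l" "depends k \<alpha>"
    using loc_const_ge \<alpha> unfolding is_factor_def by metis
  have k1: "k \<ge> 1" "k > n" "k \<ge> l" using k(1) by auto
  define q1 where "q1 a = \<alpha> (SOME z. z \<in> limset \<and> z k = a)" for a
  have \<alpha>q: "\<alpha> x = q1 (x k)" if "x \<in> limset" for x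
    using depends_factor[OF k(2) that] by (simp add: q1_def)
  have "map_prod q1 q1 ` \<phi> k = map_prod q1 q1 ` (\<lambda>x. (x k, limmap x k)) ` limset"
    using is_factor_coord[OF k1(1)] by (simp add: is_factor_def)
  also have "\<dots> = (\<lambda>x. (\<alpha> x, \<alpha> (limmap x))) ` limset"
    unfolding image_image by (rule image_cong) (use \<alpha>q limmap_in in auto)
  also have "\<dots> = \<phi> n" using \<alpha> by (simp add: is_factor_def)
  finally have e1: "map_prod q1 q1 ` \<phi> k = \<phi> n" .
  have "q1 ` I k = q1 ` (\<lambda>x. x k) ` limset"
    using is_factor_image[OF k1(1) is_factor_coord[OF k1(1)]] by simp
  also have "\<dots> = \<alpha> ` limset" unfolding image_image by (rule image_cong) (use \<alpha>q in auto)
  also have "\<dots> = I n" by (rule is_factor_image[OF n \<alpha>])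
  finally have "system_surj q1 (I k, \<phi> k) (I n, \<phi> n)"
    using e1 by (simp add: system_surj_def system_map_def)
  then obtain m q2 where m: "m > k" "system_surj q2 (I m, \<phi> m) (I k, \<phi> k)"
      "\<And>x. x \<in> I m \<Longrightarrow> q1 (q2 x) = bond p m n x"
    using fac n k1(2) unfolding factoring_property_def by blast
  obtain j q3 where j: "j > m" "system_surj q3 (I j, \<phi> j) (I m, \<phi> m)"
      "\<And>x. x \<in> I j \<Longrightarrow> q2 (q3 x) = bond p j k x"
    using fac k1(1) m(1,2) unfolding factoring_property_def by blast
  define \<gamma> where "\<gamma> x = q3 (x j)" for x :: "nat \<Rightarrow> 'a"
  have j1: "j \<ge> 1" "k \<le> j" using j(1) m(1) by auto
  have q2\<gamma>: "q2 (\<gamma> x) = x k" if "x \<in> limset" for x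
    using j(3)[OF limset_coord[OF that j1(1)]] limset_bond[OF that k1(1) j1(2)] by (simp add: \<gamma>_def)
  have "is_factor limmap \<gamma> m"
    unfolding \<gamma>_def by (rule is_factor_comp[OF j(2) is_factor_coord[OF j1(1)]])
  moreover have "separates l \<gamma>"
  proof (rule separates_mono[OF _ l k1(3)])
    show "separates k \<gamma>" unfolding separates_def using q2\<gamma> by metis
  qed
  moreover have "bond p m n (\<gamma> x) = \<alpha> x" if x: "x \<in> limset" for x
  proof -
    have "\<gamma> x \<in> I m" using j(2) limset_coord[OF x j1(1)] by (auto simp: \<gamma>_def system_surj_def)
    then show ?thesis using m(3) q2\<gamma>[OF x] \<alpha>q[OF x] by metis
  qed
  ultimately show "\<exists>m>n. \<exists>\<gamma>. is_factor limmap \<gamma> m \<and> separates l \<gamma> \<and>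
      (\<forall>x\<in>limset. bond p m n (\<gamma> x) = \<alpha> x)"
    using m(1) k1(2) by (intro exI[of _ m] exI[of _ \<gamma>]) auto
qed

lemma lifting_conjugate:
  assumes f: "lifting f" and h: "lim_cont h" "bij_betw h limset limset"
    and fX: "f \<in> limset \<rightarrow> limset"
    and g: "\<And>x. x \<in> limset \<Longrightarrow> g (h x) = h (f x)"
  shows "lifting g"
  unfolding lifting_def
proof (intro allI impI)
  fix n \<alpha> and l :: nat
  assume n: "n \<ge> 1" and \<alpha>: "is_factor g \<alpha> n" and l: "l \<ge> 1"
  define k where "k = inv_into limset h"
  have k: "lim_cont k" using lim_cont_inverse(2)[OF h] by (simp add: k_def)
  have hk: "h (k x) = x" "k x \<in> limset" if "x \<in> limset" for x
    using h(2) that unfolding k_def bij_betw_def by (auto simp: f_inv_into_f inv_into_into)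
  have kh: "k (h x) = x" if "x \<in> limset" for x
    using h(2) that unfolding k_def bij_betw_def by (auto simp: inv_into_f_f)
  have him: "h ` limset = limset" using h(2) by (simp add: bij_betw_def)
  have transfer: "(\<lambda>x. (\<beta> x, \<beta> (g x))) ` limset = (\<lambda>x. (\<beta> (h x), \<beta> (h (f x)))) ` limset" for \<beta> :: "_ \<Rightarrow> 'a"
  proof -
    have "(\<lambda>x. (\<beta> x, \<beta> (g x))) ` limset = (\<lambda>x. (\<beta> x, \<beta> (g x))) ` (h ` limset)" by (simp only: him)
    also have "\<dots> = (\<lambda>x. (\<beta> (h x), \<beta> (h (f x)))) ` limset"
      unfolding image_image by (rule image_cong) (simp_all add: g)
    finally show ?thesis .
  qed
  have "loc_const (\<lambda>x. \<alpha> (h x))" using loc_const_comp[OF _ h(1), of \<alpha>] \<alpha> unfolding is_factor_def by blast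
  then have "is_factor f (\<lambda>x. \<alpha> (h x)) n"
    using \<alpha> transfer[of \<alpha>] by (simp add: is_factor_def)
  moreover obtain l' where l': "l' \<ge> 1" "depends l' (\<lambda>x. h x l)"
    using h(1) l by (auto simp: lim_cont_def loc_const_def)
  ultimately obtain m \<gamma> where m: "m > n" "is_factor f \<gamma> m" "separates l' \<gamma>"
      "\<And>x. x \<in> limset \<Longrightarrow> bond p m n (\<gamma> x) = \<alpha> (h x)"
    using f n unfolding lifting_def by blast
  have "loc_const (\<lambda>x. \<gamma> (k x))" using loc_const_comp[OF _ k, of \<gamma>] m(2) unfolding is_factor_def by blast
  moreover have "(\<lambda>x. (\<gamma> (k (h x)), \<gamma> (k (h (f x))))) ` limset = (\<lambda>x. (\<gamma> x, \<gamma> (f x))) ` limset"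
  proof (rule image_cong)
    fix x assume x: "x \<in> limset"
    show "(\<gamma> (k (h x)), \<gamma> (k (h (f x)))) = (\<gamma> x, \<gamma> (f x))" using kh[OF x] kh[OF funcset_mem[OF fX x]] by simp
  qed simp
  ultimately have "is_factor g (\<lambda>x. \<gamma> (k x)) m"
    using m(2) transfer[of "\<lambda>x. \<gamma> (k x)"] by (simp add: is_factor_def)
  moreover have "separates l (\<lambda>x. \<gamma> (k x))"
    using m(3) l'(2) hk unfolding separates_def depends_def by metis
  moreover have "bond p m n (\<gamma> (k x)) = \<alpha> x" if "x \<in> limset" for x
    using m(4)[of "k x"] hk that by simp
  ultimately show "\<exists>m>n. \<exists>\<gamma>. is_factor g \<gamma> m \<and> separates l \<gamma> \<and> (\<forall>x\<in>limset. bond p m n (\<gamma> x) = \<alpha> x)"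
    using m(1) by blast
qed

text \<open>Iterated lifting from level 1 produces levels \<open>m\<^sub>0 < m\<^sub>1 < \<dots>\<close> and factors \<open>\<gamma>\<^sub>i\<close> of \<open>g\<close> onto
  them.  They form a tower with the same values and connecting maps as the coordinates \<open>m\<^sub>i\<close>
  themselves, and the homeomorphism between the two towers takes the graph of \<open>g\<close> into \<open>limrel\<close>.\<close>

lemma conjugate_if_lifting:
  assumes g: "lifting g" "g \<in> limset \<rightarrow> limset" and pt: "pointed I"
  obtains h where "lim_cont h" "bij_betw h limset limset" "h \<in> extensional limset"
    "\<And>x. x \<in> limset \<Longrightarrow> h (g x) = limmap (h x)"
proof -
  obtain c where c: "I 1 = {c}" using pt by (auto simp: pointed_def is_singleton_def)
  have phi1: "\<phi> 1 = {(c, c)}" using rel_surj[of 1] c by (auto simp: surjective_rel_def)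
  define ok where "ok \<equiv> \<lambda>(i::nat) (s :: nat \<times> ((nat \<Rightarrow> 'a) \<Rightarrow> 'a)).
    fst s > i \<and> is_factor g (snd s) (fst s) \<and> (i \<ge> 1 \<longrightarrow> separates i (snd s))"
  define nxt where "nxt \<equiv> \<lambda>(i::nat) (s :: nat \<times> ((nat \<Rightarrow> 'a) \<Rightarrow> 'a)) (s' :: nat \<times> ((nat \<Rightarrow> 'a) \<Rightarrow> 'a)).
    fst s < fst s' \<and> (\<forall>x\<in>limset. bond p (fst s') (fst s) (snd s' x) = snd s x)"
  have "\<exists>s. \<forall>i. ok i (s i) \<and> nxt i (s i) (s (Suc i))"
  proof (rule dependent_nat_choice)
    have "is_factor g (\<lambda>x. c) 1"
      using phi1 limset_nonempty by (auto simp: is_factor_def loc_const_def depends_def)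
    then show "\<exists>s. ok 0 s" by (intro exI[of _ "(1, \<lambda>x. c)"]) (simp add: ok_def)
    fix s i assume s: "ok i s"
    then obtain m \<gamma> where "m > fst s" "is_factor g \<gamma> m" "separates (Suc i) \<gamma>"
        "\<forall>x\<in>limset. bond p m (fst s) (\<gamma> x) = snd s x"
      using g(1)[unfolded lifting_def, rule_format, of "fst s" "snd s" "Suc i"] unfolding ok_def by auto
    then have "ok (Suc i) (m, \<gamma>)" "nxt i s (m, \<gamma>)" using s by (auto simp: ok_def nxt_def)
    then show "\<exists>s'. ok (Suc i) s' \<and> nxt i s s'" by blast
  qed
  then obtain s where s: "\<And>i. ok i (s i)" "\<And>i. nxt i (s i) (s (Suc i))" by blast
  define m where "m i = fst (s i)" for i
  define \<gamma> where "\<gamma> i = snd (s i)" for i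
  have m: "m i > i" "m i < m (Suc i)" for i
    using s(1)[of i] s(2)[of i] by (auto simp: ok_def nxt_def m_def)
  have m1: "m i \<ge> 1" for i using m(1)[of i] by simp
  have \<gamma>: "is_factor g (\<gamma> i) (m i)" "i \<ge> 1 \<Longrightarrow> separates i (\<gamma> i)" for i
    using s(1)[of i] by (auto simp: ok_def m_def \<gamma>_def)
  have \<gamma>s: "\<gamma> i x = bond p (m (Suc i)) (m i) (\<gamma> (Suc i) x)" if "x \<in> limset" for i x
    using s(2)[of i] that by (auto simp: nxt_def m_def \<gamma>_def)
  have sepm: "separates n (\<lambda>x. x (m n))" if "n \<ge> 1" for n
    by (rule separates_mono[of "m n"]) (use that m(1)[of n] in \<open>auto simp: separates_def\<close>)
  obtain h where h: "lim_cont h" "bij_betw h limset limset" "h \<in> extensional limset"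
    "\<And>i x. x \<in> limset \<Longrightarrow> h x (m i) = \<gamma> i x"
  proof (rule homeo_from_towers[of \<gamma> "\<lambda>i x. x (m i)" "\<lambda>i. bond p (m (Suc i)) (m i)"])
    show "\<gamma> i ` limset = (\<lambda>x. x (m i)) ` limset" for i
      using is_factor_image[OF m1 \<gamma>(1)] is_factor_image[OF m1 is_factor_coord[OF m1]] by simp
    show "x (m i) = bond p (m (Suc i)) (m i) (x (m (Suc i)))" if "x \<in> limset" for i x
      using limset_bond[OF that m1, of i "m (Suc i)"] m(2)[of i] by simp
    show "loc_const (\<gamma> i)" for i using \<gamma>(1) by (simp add: is_factor_def)
    show "loc_const (\<lambda>x. x (m i))" for i using loc_const_coord[OF m1, of "\<lambda>c. c"] .
    show "\<exists>i. separates n (\<gamma> i)" if "n \<ge> 1" for n using \<gamma>(2) that by blast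
    show "\<exists>i. separates n (\<lambda>x. x (m i))" if "n \<ge> 1" for n using sepm[OF that] by blast
  qed (use \<gamma>s in blast)+
  have hin: "h x \<in> limset" if "x \<in> limset" for x using h(1) that by (auto simp: lim_cont_def)
  have "h (g x) = limmap (h x)" if x: "x \<in> limset" for x
  proof -
    have gx: "g x \<in> limset" using g(2) x by auto
    have "(h x n, h (g x) n) \<in> \<phi> n" if n: "n \<ge> 1" for n
    proof (rule rel_descend[OF hin[OF x] hin[OF gx] n])
      show "n \<le> m n" using m(1)[of n] by simp
      have "(\<gamma> n x, \<gamma> n (g x)) \<in> \<phi> (m n)" using \<gamma>(1)[of n] x unfolding is_factor_def by blast
      then show "(h x (m n), h (g x) (m n)) \<in> \<phi> (m n)" using h(4) x gx by simp
    qed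
    then have "(h x, h (g x)) \<in> limrel" by (intro limrelI hin x gx)
    then show ?thesis using limmap_iff[OF hin[OF x]] by simp
  qed
  then show ?thesis using that h by blast
qed

section \<open>Residuality of the conjugacy class\<close>

lemma is_factor_cong:
  assumes k: "depends k \<gamma>"
    and g: "g \<in> limset \<rightarrow> limset" "g' \<in> limset \<rightarrow> limset" "\<And>x. x \<in> limset \<Longrightarrow> g' x k = g x k"
  shows "is_factor g' \<gamma> n \<longleftrightarrow> is_factor g \<gamma> n"
proof -
  have "\<gamma> (g' x) = \<gamma> (g x)" if "x \<in> limset" for x
    using k g that unfolding depends_def by (metis PiE)
  then have "(\<lambda>x. (\<gamma> x, \<gamma> (g' x))) ` limset = (\<lambda>x. (\<gamma> x, \<gamma> (g x))) ` limset"
    by (intro image_cong) auto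
  then show ?thesis by (simp add: is_factor_def)
qed

definition lifts_at :: "((nat \<Rightarrow> 'a) \<Rightarrow> nat \<Rightarrow> 'a) \<Rightarrow> nat \<Rightarrow> nat \<Rightarrow> ((nat \<Rightarrow> 'a) \<Rightarrow> 'a) \<Rightarrow> bool" where
  "lifts_at g n l \<alpha> \<longleftrightarrow> (is_factor g \<alpha> n \<longrightarrow> (\<exists>m>n. \<exists>\<gamma>.
     is_factor g \<gamma> m \<and> separates l \<gamma> \<and> (\<forall>x\<in>limset. bond p m n (\<gamma> x) = \<alpha> x)))"

text \<open>A factor depends on one coordinate, so it is given by a map between two finite levels: there
  are countably many of them.\<close>

lemma lifting_iff_lifts_at:
  assumes g: "g \<in> limset \<rightarrow> limset"
  shows "lifting g \<longleftrightarrow> (\<forall>n\<ge>1. \<forall>l\<ge>1. \<forall>k\<ge>1. \<forall>a \<in> I k \<rightarrow>\<^sub>E I n. lifts_at g n l (\<lambda>x. a (x k)))"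
    (is "?L \<longleftrightarrow> ?R")
proof
  assume ?L
  then show ?R unfolding lifting_def lifts_at_def by blast
next
  assume R: ?R
  show ?L unfolding lifting_def
  proof (intro allI impI)
    fix n \<alpha> and l :: nat
    assume n: "n \<ge> 1" and \<alpha>: "is_factor g \<alpha> n" and l: "l \<ge> 1"
    obtain k where k: "k \<ge> 1" "depends k \<alpha>" using \<alpha> by (auto simp: is_factor_def loc_const_def)
    define a where "a = restrict (\<lambda>c. \<alpha> (SOME y. y \<in> limset \<and> y k = c)) (I k)"
    have a\<alpha>: "a (x k) = \<alpha> x" if "x \<in> limset" for x
      using depends_factor[OF k(2) that] limset_coord[OF that k(1)] by (simp add: a_def)
    have "a \<in> I k \<rightarrow>\<^sub>E I n"
    proof (rule PiE_I)
      fix c assume "c \<in> I k"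
      then obtain x where "x \<in> limset" "x k = c" using limset_through[OF k(1)] by blast
      then show "a c \<in> I n" using a\<alpha> is_factor_image[OF n \<alpha>] by blast
    qed (simp add: a_def)
    then have "lifts_at g n l (\<lambda>x. a (x k))" using R n l k(1) by blast
    moreover have "is_factor g (\<lambda>x. a (x k)) n"
    proof -
      have "(\<lambda>x. (a (x k), a (g x k))) ` limset = (\<lambda>x. (\<alpha> x, \<alpha> (g x))) ` limset"
        by (rule image_cong) (use a\<alpha> g in auto)
      then show ?thesis using \<alpha> loc_const_coord[OF k(1), of a] by (simp add: is_factor_def)
    qed
    ultimately obtain m \<gamma> where "m > n" "is_factor g \<gamma> m" "separates l \<gamma>"
        "\<forall>x\<in>limset. bond p m n (\<gamma> x) = a (x k)"
      unfolding lifts_at_def by blast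
    then show "\<exists>m>n. \<exists>\<gamma>. is_factor g \<gamma> m \<and> separates l \<gamma> \<and> (\<forall>x\<in>limset. bond p m n (\<gamma> x) = \<alpha> x)"
      using a\<alpha> by metis
  qed
qed

context
  fixes X :: "(nat \<Rightarrow> 'a) metric"
  assumes X: "mtopology_of X = limtop"
begin

lemmas mspace_X' = mspace_X[OF X]
lemmas surj_space_mem = mspace_surj_space[OF X]

lemma limmap_homeo: "limmap \<in> homeo_set X"
  unfolding homeo_set_eq[OF X] using lim_cont_limmap bij_limmap by (simp add: limmap_def)

lemma conj_classI:
  assumes h: "lim_cont h" "bij_betw h limset limset" "h \<in> extensional limset"
    and g: "g \<in> extensional limset" "\<And>x. x \<in> limset \<Longrightarrow> g (h x) = h (limmap x)"
  shows "g \<in> conj_class X limmap"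
proof -
  have "g = restrict (h \<circ> limmap \<circ> inv_into (mspace X) h) (mspace X)"
  proof (rule extensionalityI[of _ limset])
    fix x assume x: "x \<in> limset"
    then have "x \<in> h ` limset" using h(2) by (simp add: bij_betw_def)
    then have "h (inv_into limset h x) = x" "inv_into limset h x \<in> limset"
      by (simp_all add: f_inv_into_f inv_into_into)
    then show "g x = restrict (h \<circ> limmap \<circ> inv_into (mspace X) h) (mspace X) x"
      using g(2)[of "inv_into limset h x"] x by (simp add: mspace_X')
  qed (simp_all add: g mspace_X')
  moreover have "h \<in> homeo_set X" using h by (simp add: homeo_set_eq[OF X])
  ultimately show ?thesis unfolding conj_class_def by blast
qed

lemma conj_classE:
  assumes "g \<in> conj_class X limmap"
  obtains h where "lim_cont h" "bij_betw h limset limset"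
    "\<And>x. x \<in> limset \<Longrightarrow> g (h x) = h (limmap x)" "g \<in> mspace (surj_space X)"
proof -
  obtain h where h: "lim_cont h" "bij_betw h limset limset"
    and g: "g = restrict (h \<circ> limmap \<circ> inv_into limset h) limset"
    using assms unfolding conj_class_def homeo_set_eq[OF X] mspace_X' by blast
  define k where "k = inv_into limset h"
  have k: "lim_cont k" using lim_cont_inverse(2)[OF h] by (simp add: k_def)
  have kb: "bij_betw k limset limset" unfolding k_def by (rule bij_betw_inv_into[OF h(2)])
  have hL: "h x \<in> limset" and kL: "k x \<in> limset" if "x \<in> limset" for x
    using h(1) k that by (auto simp: lim_cont_def)
  have gx: "g x = h (limmap (k x))" if "x \<in> limset" for x using that g by (simp add: k_def)
  have gh: "g (h x) = h (limmap x)" if "x \<in> limset" for x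
    using gx[OF hL[OF that]] bij_betw_inv_into_left[OF h(2) that] by (simp add: k_def)
  have "loc_const (\<lambda>x. g x n)" if n: "n \<ge> 1" for n
  proof -
    have "loc_const (\<lambda>x. h x n)" using h(1) n by (simp add: lim_cont_def)
    then have "loc_const (\<lambda>x. h (limmap (k x)) n)"
      using loc_const_comp[OF loc_const_comp[OF _ lim_cont_limmap] k] by blast
    then show ?thesis unfolding loc_const_def depends_def by (simp add: gx)
  qed
  moreover have "g ` limset = limset"
  proof -
    have "g ` limset = h ` limmap ` k ` limset"
      unfolding image_image by (rule image_cong) (simp_all add: gx)
    then show ?thesis using h(2) kb bij_limmap by (simp add: bij_betw_def)
  qed
  ultimately have "g \<in> mspace (surj_space X)"
    unfolding surj_space_mem lim_cont_def using g by auto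
  then show ?thesis using that h gh by blast
qed

lemma conj_class_eq_lifting:
  assumes fac: "factoring_property I \<phi> p" and pt: "pointed I"
  shows "conj_class X limmap = {g \<in> mspace (surj_space X). lifting g}"
proof (intro equalityI subsetI)
  fix g assume "g \<in> conj_class X limmap"
  then obtain h where h: "lim_cont h" "bij_betw h limset limset"
    "\<And>x. x \<in> limset \<Longrightarrow> g (h x) = h (limmap x)" "g \<in> mspace (surj_space X)"
    using conj_classE by blast
  have "limmap \<in> limset \<rightarrow> limset" using limmap_in by simp
  then have "lifting g"
    using h(3) by (rule lifting_conjugate[OF lifting_limmap[OF fac] h(1,2)])
  then show "g \<in> {g \<in> mspace (surj_space X). lifting g}" using h(4) by simp
next
  fix g assume "g \<in> {g \<in> mspace (surj_space X). lifting g}"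
  then have g: "lifting g" "g \<in> extensional limset" "g \<in> limset \<rightarrow> limset"
    by (auto simp: surj_space_mem)
  obtain h where h: "lim_cont h" "bij_betw h limset limset" "h \<in> extensional limset"
    "\<And>x. x \<in> limset \<Longrightarrow> h (g x) = limmap (h x)"
    using conjugate_if_lifting[OF g(1,3) pt] by blast
  define k where "k = restrict (inv_into limset h) limset"
  have kb: "bij_betw k limset limset"
    using bij_betw_inv_into[OF h(2)] by (simp add: k_def cong: bij_betw_cong)
  have ke: "k x = inv_into limset h x" if "x \<in> limset" for x using that by (simp add: k_def)
  have hk: "h (k x) = x" "k x \<in> limset" if "x \<in> limset" for x
    using bij_betw_inv_into_right[OF h(2) that] kb that by (auto simp: ke bij_betw_def)
  have kh: "k (h x) = x" if "x \<in> limset" for x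
    using bij_betw_inv_into_left[OF h(2) that] h(1) that by (subst ke) (auto simp: lim_cont_def)
  have kc: "lim_cont k"
    using lim_cont_inverse(2)[OF h(1,2)] ke
    unfolding lim_cont_def loc_const_def depends_def Pi_iff by simp
  show "g \<in> conj_class X limmap"
  proof (rule conj_classI[OF kc kb _ g(2)])
    fix x assume x: "x \<in> limset"
    have "limmap x = limmap (h (k x))" using hk(1)[OF x] by simp
    also have "\<dots> = h (g (k x))" using h(4)[OF hk(2)[OF x]] by simp
    finally have "k (limmap x) = k (h (g (k x)))" by simp
    also have "\<dots> = g (k x)" using kh g(3) hk(2)[OF x] by auto
    finally show "g (k x) = k (limmap x)" by simp
  qed (simp add: k_def)
qed

text \<open>Whether \<open>\<gamma>\<close> is a factor of \<open>g\<close> depends on \<open>g\<close> only through the coordinate on which \<open>\<gamma>\<close>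
  depends, so both the premise and the conclusion of \<open>lifts_at\<close> are clopen conditions on \<open>g\<close>.\<close>

lemma openin_lifts_at:
  assumes k: "k \<ge> 1"
  shows "openin (mtopology_of (surj_space X)) {g \<in> mspace (surj_space X). lifts_at g n l (\<lambda>x. a (x k))}"
  unfolding openin_surj_space_iff[OF X]
proof (intro conjI ballI)
  fix g assume "g \<in> {g \<in> mspace (surj_space X). lifts_at g n l (\<lambda>x. a (x k))}"
  then have g: "g \<in> mspace (surj_space X)" "lifts_at g n l (\<lambda>x. a (x k))" by auto
  have val: "g \<in> limset \<rightarrow> limset" if "g \<in> mspace (surj_space X)" for g
    using that by (auto simp: surj_space_mem)
  have \<alpha>: "depends k (\<lambda>x. a (x k))" by (rule depends_coord[OF k order_refl])
  show "\<exists>N\<ge>1. \<forall>g'\<in>mspace (surj_space X). (\<forall>x\<in>limset. g' x N = g x N) \<longrightarrow>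
      g' \<in> {g \<in> mspace (surj_space X). lifts_at g n l (\<lambda>x. a (x k))}"
  proof (cases "is_factor g (\<lambda>x. a (x k)) n")
    case False
    have "lifts_at g' n l (\<lambda>x. a (x k))"
      if "g' \<in> mspace (surj_space X)" "\<forall>x\<in>limset. g' x k = g x k" for g'
      using is_factor_cong[OF \<alpha> val[OF g(1)] val[OF that(1)], of n] that(2) False
      unfolding lifts_at_def by blast
    then show ?thesis using k by blast
  next
    case True
    then obtain m \<gamma> where m: "m > n" "is_factor g \<gamma> m" "separates l \<gamma>"
        "\<forall>x\<in>limset. bond p m n (\<gamma> x) = a (x k)"
      using g(2) unfolding lifts_at_def by blast
    then obtain N where N: "N \<ge> 1" "depends N \<gamma>" by (auto simp: is_factor_def loc_const_def)
    have "lifts_at g' n l (\<lambda>x. a (x k))"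
      if "g' \<in> mspace (surj_space X)" "\<forall>x\<in>limset. g' x N = g x N" for g'
    proof -
      have "is_factor g' \<gamma> m"
        using is_factor_cong[OF N(2) val[OF g(1)] val[OF that(1)], of m] that(2) m(2) by blast
      then show ?thesis unfolding lifts_at_def using m by blast
    qed
    then show ?thesis using N(1) by blast
  qed
qed auto

lemma gdelta_conj_class:
  assumes fac: "factoring_property I \<phi> p" and pt: "pointed I"
  shows "gdelta_in (mtopology_of (surj_space X)) (conj_class X limmap)"
proof -
  define U where "U n l k a = {g \<in> mspace (surj_space X). lifts_at g n l (\<lambda>x. a (x k))}" for n l k a
  define \<U> where "\<U> = (\<Union>n\<in>{1..}. \<Union>l\<in>{1..}. \<Union>k\<in>{1..}. U n l k ` (I k \<rightarrow>\<^sub>E I n))"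
  have "lifting g \<longleftrightarrow> (\<forall>S\<in>\<U>. g \<in> S)" if "g \<in> mspace (surj_space X)" for g
  proof -
    have "g \<in> limset \<rightarrow> limset" using that by (auto simp: surj_space_mem)
    from lifting_iff_lifts_at[OF this] show ?thesis
      using that by (auto simp add: \<U>_def U_def)
  qed
  then have "conj_class X limmap = \<Inter> (insert (mspace (surj_space X)) \<U>)"
    unfolding conj_class_eq_lifting[OF fac pt] by blast
  moreover have "gdelta_in (mtopology_of (surj_space X)) (\<Inter> (insert (mspace (surj_space X)) \<U>))"
  proof (rule gdelta_in_Inter)
    have "countable (U n l k ` (I k \<rightarrow>\<^sub>E I n))" if "n \<ge> 1" "k \<ge> 1" for n l k
      using finite_level that by (intro countable_finite finite_imageI finite_PiE) auto
    then show "countable (insert (mspace (surj_space X)) \<U>)"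
      unfolding \<U>_def by (intro countable_insert countable_UN) auto
    fix S assume "S \<in> insert (mspace (surj_space X)) \<U>"
    then have "openin (mtopology_of (surj_space X)) S"
      using openin_lifts_at openin_topspace[of "mtopology_of (surj_space X)"]
      unfolding \<U>_def U_def by fastforce
    then show "gdelta_in (mtopology_of (surj_space X)) S" by (rule open_imp_gdelta_in)
  qed simp
  ultimately show ?thesis by simp
qed

text \<open>Continuity of \<open>g\<close> turns closeness at level \<open>n\<close> into a condition on edges at a higher level
  \<open>N\<close>: if every edge of \<open>g'\<close> at level \<open>N\<close> is an edge of \<open>g\<close>, say \<open>(x\<^sub>N, g'(x)\<^sub>N) = (y\<^sub>N, g(y)\<^sub>N)\<close>, then
  \<open>g(y)\<^sub>n = g(x)\<^sub>n\<close> since \<open>x\<close> and \<open>y\<close> agree at level \<open>N\<close>.\<close>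

lemma dense_conj_class:
  assumes univ: "\<And>n R. n \<ge> 1 \<Longrightarrow> surjective_rel (I n) R \<Longrightarrow>
    \<exists>m\<ge>1. \<exists>q. q ` I m = I n \<and> map_prod q q ` \<phi> m \<subseteq> R"
  shows "mtopology_of (surj_space X) closure_of conj_class X limmap = mspace (surj_space X)"
proof -
  have "g \<in> mtopology_of (surj_space X) closure_of conj_class X limmap"
    if g: "g \<in> mspace (surj_space X)" for g
    unfolding in_closure_of
  proof (intro conjI allI impI)
    fix U assume "g \<in> U \<and> openin (mtopology_of (surj_space X)) U"
    then obtain n where n: "n \<ge> 1"
      "\<And>g'. g' \<in> mspace (surj_space X) \<Longrightarrow> \<forall>x\<in>limset. g' x n = g x n \<Longrightarrow> g' \<in> U"
      unfolding openin_surj_space_iff[OF X] by blast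
    have gc: "lim_cont g" and gs: "g ` limset = limset" using g by (auto simp: surj_space_mem)
    have "loc_const (\<lambda>x. g x n)" using gc n(1) by (simp add: lim_cont_def)
    then obtain N where N: "N \<ge> n" "N \<ge> 1" "depends N (\<lambda>x. g x n)" by (rule loc_const_ge[where k = n])
    define R where "R = (\<lambda>x. (x N, g x N)) ` limset"
    have coord: "(\<lambda>x. x N) ` limset = I N" using is_factor_image[OF N(2) is_factor_coord[OF N(2)]] .
    have "fst ` R = I N" using coord by (simp add: R_def image_image)
    moreover have "snd ` R = (\<lambda>x. x N) ` g ` limset" by (simp add: R_def image_image)
    then have "snd ` R = I N" using coord gs by simp
    ultimately have "surjective_rel (I N) R"
      unfolding surjective_rel_def by (metis subset_fst_snd)
    then obtain m q where m: "m \<ge> 1" "q ` I m = I N" "map_prod q q ` \<phi> m \<subseteq> R"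
      using univ N(2) by blast
    have "(\<lambda>x. q (x m)) ` limset = q ` (\<lambda>x. x m) ` limset" by (simp add: image_image)
    also have "\<dots> = (\<lambda>x. x N) ` limset"
      using is_factor_image[OF m(1) is_factor_coord[OF m(1)]] m(2) coord by simp
    finally obtain h where h: "lim_cont h" "bij_betw h limset limset" "h \<in> extensional limset"
      "\<And>x. x \<in> limset \<Longrightarrow> h x N = q (x m)"
      using homeo_matching[OF loc_const_coord[OF m(1), of q] loc_const_coord[OF N(2), of "\<lambda>c. c"]] by blast
    define g' where "g' = restrict (\<lambda>x. h (limmap (inv_into limset h x))) limset"
    have hL: "h x \<in> limset" if "x \<in> limset" for x using h(1) that by (auto simp: lim_cont_def)
    have gh: "g' (h x) = h (limmap x)" if "x \<in> limset" for x
      using bij_betw_inv_into_left[OF h(2) that] hL[OF that] by (simp add: g'_def)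
    have g'C: "g' \<in> conj_class X limmap"
      by (rule conj_classI[OF h(1-3) _ gh]) (simp_all only: g'_def restrict_extensional)
    moreover have "g' x n = g x n" if x: "x \<in> limset" for x
    proof -
      obtain z where z: "z \<in> limset" "x = h z" using h(2) x by (auto simp: bij_betw_def)
      have "(z m, limmap z m) \<in> \<phi> m" by (rule limmap_coord[OF z(1) m(1)])
      then have "(q (z m), q (limmap z m)) \<in> R" using m(3) by force
      then have "(h z N, h (limmap z) N) \<in> R" using h(4) z(1) limmap_in by simp
      then obtain y where y: "y \<in> limset" "y N = h z N" "g y N = h (limmap z) N"
        unfolding R_def by auto
      have "g y n = g x n" using N(3) y(1,2) x z(2) unfolding depends_def by metis
      moreover have "g y n = h (limmap z) n"
      proof (rule limset_eq_mono[OF _ _ n(1) N(1)])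
        show "g y \<in> limset" using gs y(1) by blast
        show "h (limmap z) \<in> limset" by (rule hL[OF limmap_in[OF z(1)]])
      qed (rule y(3))
      ultimately show ?thesis using gh z by simp
    qed
    moreover have "g' \<in> mspace (surj_space X)" using conj_classE[OF g'C] by blast
    ultimately show "\<exists>y. y \<in> conj_class X limmap \<and> y \<in> U" using n(2) by blast
  qed (use g in simp)
  moreover have "mtopology_of (surj_space X) closure_of conj_class X limmap \<subseteq> mspace (surj_space X)"
    using closure_of_subset_topspace[of "mtopology_of (surj_space X)"] by simp
  ultimately show ?thesis by blast
qed

theorem limmap_residual:
  assumes "factoring_property I \<phi> p" "pointed I"
    and "\<And>n R. n \<ge> 1 \<Longrightarrow> surjective_rel (I n) R \<Longrightarrow>
      \<exists>m\<ge>1. \<exists>q. q ` I m = I n \<and> map_prod q q ` \<phi> m \<subseteq> R"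
  shows "\<exists>f\<in>homeo_set X. {(x, f x) |x. x \<in> mspace X} = limrel
    \<and> mtopology_of (surj_space X) closure_of conj_class X f = mspace (surj_space X)
    \<and> gdelta_in (mtopology_of (surj_space X)) (conj_class X f)"
proof (intro bexI[OF _ limmap_homeo] conjI)
  show "{(x, limmap x) |x. x \<in> mspace X} = limrel" unfolding limrel_graph mspace_X' ..
qed (use dense_conj_class gdelta_conj_class assms in blast)+

end

end

section \<open>The universal walk on a dumbbell\<close>

text \<open>The position at time \<open>t\<close> on a dumbbell with loops of length \<open>N\<close> and a path of length \<open>2 * h\<close>, when
  the midpoint is passed at time \<open>0\<close> and each step follows an edge.  Between the times \<open>-h\<close> and \<open>h\<close>
  the walk is on the path; before and after it winds around the two loops.\<close>

definition walk_pos :: "int \<Rightarrow> int \<Rightarrow> int \<Rightarrow> int" where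
  "walk_pos N h t =
     (if t \<le> - h then 1 + (t + h - 1) mod N
      else if t \<le> h then N + h + t
      else N + 2 * h + (t - h) mod N)"

lemma walk_pos_bounds:
  assumes N: "N \<ge> 1" and h: "h \<ge> 1"
  shows "1 \<le> walk_pos N h t" "walk_pos N h t \<le> 2 * N + 2 * h - 1"
proof -
  have m: "0 \<le> (t + h - 1) mod N" "(t + h - 1) mod N < N" "0 \<le> (t - h) mod N" "(t - h) mod N < N"
    using N by simp_all
  show "1 \<le> walk_pos N h t" "walk_pos N h t \<le> 2 * N + 2 * h - 1"
    using m N h unfolding walk_pos_def by (smt (verit))+
qed

lemma walk_pos_in: "t \<le> - h \<Longrightarrow> walk_pos N h t = 1 + (t + h - 1) mod N"
  by (simp add: walk_pos_def)

lemma walk_pos_mid: "N \<ge> 1 \<Longrightarrow> - h \<le> t \<Longrightarrow> t \<le> h \<Longrightarrow> walk_pos N h t = N + h + t"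
  by (auto simp: walk_pos_def zmod_minus1)

lemma walk_pos_out: "N \<ge> 1 \<Longrightarrow> h \<ge> 1 \<Longrightarrow> h \<le> t \<Longrightarrow> walk_pos N h t = N + 2 * h + (t - h) mod N"
  by (auto simp: walk_pos_def)

lemma walk_pos_le_iff:
  assumes N: "N \<ge> 1" and h: "h \<ge> 1"
  shows "walk_pos N h t \<le> N \<longleftrightarrow> t \<le> - h" "walk_pos N h t \<ge> N + 2 * h \<longleftrightarrow> t \<ge> h"
proof -
  have m: "0 \<le> (t + h - 1) mod N" "(t + h - 1) mod N < N" "0 \<le> (t - h) mod N" "(t - h) mod N < N"
    using N by simp_all
  show "walk_pos N h t \<le> N \<longleftrightarrow> t \<le> - h" "walk_pos N h t \<ge> N + 2 * h \<longleftrightarrow> t \<ge> h"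
    using m N h unfolding walk_pos_def by (smt (verit))+
qed

text \<open>The times at which the walk is at the same place; see \<open>walk_pos_eq_iff\<close>.\<close>

definition same_pos :: "int \<Rightarrow> int \<Rightarrow> int \<Rightarrow> int \<Rightarrow> bool" where
  "same_pos N h s t \<longleftrightarrow> s = t \<or> (s \<le> - h \<and> t \<le> - h \<and> N dvd s - t) \<or> (s \<ge> h \<and> t \<ge> h \<and> N dvd s - t)"

lemma walk_pos_eq_iff:
  assumes N: "N \<ge> 1" and h: "h \<ge> 1"
  shows "walk_pos N h s = walk_pos N h t \<longleftrightarrow> same_pos N h s t"
proof -
  consider "s \<le> - h" "t \<le> - h" | "s \<ge> h" "t \<ge> h" | "\<not> (s \<le> - h \<and> t \<le> - h)" "\<not> (s \<ge> h \<and> t \<ge> h)"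
    by linarith
  then show ?thesis
  proof cases
    case 1
    have "walk_pos N h s = walk_pos N h t \<longleftrightarrow> (s + h - 1) mod N = (t + h - 1) mod N"
      using 1 by (simp add: walk_pos_in)
    also have "\<dots> \<longleftrightarrow> N dvd s - t" by (simp add: mod_eq_dvd_iff)
    finally show ?thesis using 1 h by (auto simp: same_pos_def)
  next
    case 2
    have "walk_pos N h s = walk_pos N h t \<longleftrightarrow> (s - h) mod N = (t - h) mod N"
      using 2 N h by (simp add: walk_pos_out)
    also have "\<dots> \<longleftrightarrow> N dvd s - t" by (simp add: mod_eq_dvd_iff)
    finally show ?thesis using 2 h by (auto simp: same_pos_def)
  next
    case 3
    have "s = t" if e: "walk_pos N h s = walk_pos N h t"
    proof -
      have "s \<le> - h \<longleftrightarrow> t \<le> - h" "h \<le> s \<longleftrightarrow> h \<le> t"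
        using walk_pos_le_iff[OF N h, of s] walk_pos_le_iff[OF N h, of t] e by auto
      then show ?thesis using 3 e walk_pos_mid[OF N, of h s] walk_pos_mid[OF N, of h t] by auto
    qed
    then show ?thesis using 3 by (auto simp: same_pos_def)
  qed
qed

lemma walk_pos_surj:
  assumes N: "N \<ge> 1" and h: "h \<ge> 1" and k: "1 \<le> k" "k \<le> 2 * N + 2 * h - 1"
  shows "walk_pos N h (k - N - h) = k"
proof -
  consider "k \<le> N" | "N < k" "k < N + 2 * h" | "N + 2 * h \<le> k" by linarith
  then show ?thesis
  proof cases
    case 1
    have "(k - N - h + h - 1) mod N = (k - 1 - N) mod N" by (simp add: algebra_simps)
    also have "\<dots> = (k - 1) mod N" by simp
    also have "\<dots> = k - 1" using 1 k by simp
    finally show ?thesis using 1 by (simp add: walk_pos_in)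
  next
    case 2
    then show ?thesis using walk_pos_mid[OF N, of h "k - N - h"] by simp
  next
    case 3
    have "(k - N - h - h) mod N = k - N - h - h" using 3 k by (intro mod_pos_pos_trivial) auto
    then show ?thesis using walk_pos_out[OF N h, of "k - N - h"] 3 by simp
  qed
qed

lemma mod_succ:
  assumes "N \<ge> (1::int)"
  shows "(a + 1) mod N = (if a mod N = N - 1 then 0 else a mod N + 1)"
proof (cases "a mod N = N - 1")
  case True
  have "(a + 1) mod N = (a mod N + 1) mod N" by (simp add: mod_simps)
  then show ?thesis using True by simp
next
  case False
  have "(a + 1) mod N = (a mod N + 1) mod N" by (simp add: mod_simps)
  moreover have "a mod N < N" "a mod N \<ge> 0" using assms by simp_all
  with False have "a mod N + 1 < N" "a mod N \<ge> 0" by linarith+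
  ultimately show ?thesis using False by simp
qed

lemma walk_pos_step:
  assumes N: "N \<ge> 1" and h: "h \<ge> 1"
  shows "walk_pos N h (t + 1) = walk_pos N h t + 1 \<and> walk_pos N h t \<le> 2 * N + 2 * h - 2
    \<or> walk_pos N h t = N \<and> walk_pos N h (t + 1) = 1
    \<or> walk_pos N h t = 2 * N + 2 * h - 1 \<and> walk_pos N h (t + 1) = N + 2 * h"
proof -
  consider "t < - h" | "- h \<le> t" "t < h" | "h \<le> t" by linarith
  then show ?thesis
  proof cases
    case 1
    have "(t + 1 + h - 1) mod N = (t + h - 1 + 1) mod N" by (simp add: algebra_simps)
    then have "walk_pos N h (t + 1) = 1 + (if (t + h - 1) mod N = N - 1 then 0 else (t + h - 1) mod N + 1)"
      using 1 mod_succ[OF N, of "t + h - 1"] by (simp add: walk_pos_in)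
    moreover have "walk_pos N h t = 1 + (t + h - 1) mod N" using 1 by (simp add: walk_pos_in)
    moreover have "(t + h - 1) mod N < N" using N by simp
    ultimately show ?thesis using N h by (smt (verit))
  next
    case 2
    then show ?thesis using walk_pos_mid[OF N, of h t] walk_pos_mid[OF N, of h "t + 1"] N h by auto
  next
    case 3
    have "(t + 1 - h) mod N = (t - h + 1) mod N" by (simp add: algebra_simps)
    then have "walk_pos N h (t + 1) = N + 2 * h + (if (t - h) mod N = N - 1 then 0 else (t - h) mod N + 1)"
      using 3 mod_succ[OF N, of "t - h"] walk_pos_out[OF N h, of "t + 1"] by simp
    moreover have "walk_pos N h t = N + 2 * h + (t - h) mod N" using 3 N h by (simp add: walk_pos_out)
    moreover have "(t - h) mod N < N" using N by simp
    ultimately show ?thesis using N h by (smt (verit))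
  qed
qed

text \<open>Two edges do not join consecutive positions.  They close the loops, and the walk takes them at
  the times \<open>-h - N\<close> and \<open>h + N - 1\<close>.\<close>

lemma dumbbell_walk:
  assumes N: "N \<ge> (1::nat)" and h: "h \<ge> (1::nat)"
  shows "dumbbell N (2 * h) N = range (\<lambda>t. (nat (walk_pos N h t), nat (walk_pos N h (t + 1))))"
proof (intro equalityI subsetI)
  have N': "int N \<ge> 1" and h': "int h \<ge> 1" using N h by auto
  note s = walk_pos_surj[OF N' h']
  fix e assume "e \<in> dumbbell N (2 * h) N"
  then consider i where "1 \<le> i" "i \<le> N + 2 * h + N - 2" "e = (i, i + 1)"
    | "e = (N, 1)" | "e = (N + 2 * h + N - 1, N + 2 * h)"
    unfolding dumbbell_def by auto
  then show "e \<in> range (\<lambda>t. (nat (walk_pos N h t), nat (walk_pos N h (t + 1))))"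
  proof cases
    case 1
    have "walk_pos N h (int i - N - h) = i" using s[of i] 1 N h by auto
    moreover have "walk_pos N h (int i - N - h + 1) = i + 1" using s[of "int i + 1"] 1 N h by (auto simp: algebra_simps)
    ultimately have "(nat (walk_pos N h (int i - N - h)), nat (walk_pos N h (int i - N - h + 1))) = (i, i + 1)"
      by (simp add: nat_add_distrib)
    then show ?thesis unfolding 1(3) by (intro range_eqI[where x = "int i - N - h"]) simp
  next
    case 2
    have "walk_pos N h (- int h - N) = walk_pos N h (- int h)"
      using walk_pos_eq_iff[OF N' h'] by (simp add: same_pos_def)
    then have a: "walk_pos N h (- int h - N) = N" using walk_pos_mid[OF N', of h "- int h"] by simp
    have b: "walk_pos N h (- int h - N + 1) = 1" using walk_pos_in[of "- int h - N + 1" h N] N' by simp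
    have "(nat (walk_pos N h (- int h - N)), nat (walk_pos N h (- int h - N + 1))) = e"
      using a b 2 by simp
    then show ?thesis by (intro range_eqI[where x = "- int h - N"]) simp
  next
    case 3
    have a: "walk_pos N h (int h + N - 1) = int N + 2 * int h + (int N - 1)"
    proof -
      have "(int N - 1) mod int N = int N - 1" using N' by (intro mod_pos_pos_trivial) auto
      moreover have "int h + int N - 1 - int h = int N - 1" by simp
      moreover have "int h \<le> int h + int N - 1" using N' by simp
      ultimately show ?thesis using walk_pos_out[OF N' h', of "int h + N - 1"] by metis
    qed
    have b: "walk_pos N h (int h + N - 1 + 1) = N + 2 * h"
      using walk_pos_out[OF N' h', of "int h + N - 1 + 1"] N' by simp
    have "(nat (walk_pos N h (int h + N - 1)), nat (walk_pos N h (int h + N - 1 + 1))) = e"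
      unfolding a b 3 using N by auto
    then show ?thesis by (intro range_eqI[where x = "int h + N - 1"]) simp
  qed
next
  have N': "int N \<ge> 1" and h': "int h \<ge> 1" using N h by auto
  fix e assume "e \<in> range (\<lambda>t. (nat (walk_pos N h t), nat (walk_pos N h (t + 1))))"
  then obtain t where e: "e = (nat (walk_pos N h t), nat (walk_pos N h (t + 1)))" by blast
  have w1: "walk_pos N h t \<ge> 1" by (rule walk_pos_bounds(1)[OF N' h'])
  from walk_pos_step[OF N' h', of t] consider
    "walk_pos N h (t + 1) = walk_pos N h t + 1" "walk_pos N h t \<le> 2 * int N + 2 * int h - 2"
    | "walk_pos N h t = N" "walk_pos N h (t + 1) = 1"
    | "walk_pos N h t = 2 * int N + 2 * int h - 1" "walk_pos N h (t + 1) = int N + 2 * int h"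
    by blast
  then show "e \<in> dumbbell N (2 * h) N"
  proof cases
    case 1
    have "e = (nat (walk_pos N h t), nat (walk_pos N h t) + 1)" unfolding e 1(1) using w1 by auto
    moreover have "1 \<le> nat (walk_pos N h t)" "nat (walk_pos N h t) \<le> N + 2 * h + N - 2" using w1 1(2) N h by auto
    ultimately show ?thesis unfolding dumbbell_def by blast
  next
    case 2
    then show ?thesis unfolding e dumbbell_def by simp
  next
    case 3
    have "nat (2 * int N + 2 * int h - 1) = N + 2 * h + N - 1" "nat (int N + 2 * int h) = N + 2 * h" using N by auto
    then show ?thesis unfolding e 3 dumbbell_def by simp
  qed
qed

section \<open>Iterates on a finite set\<close>

text \<open>By the pigeonhole principle the orbit is periodic after at most \<open>card B\<close> steps, with a period
  that is at most \<open>card B\<close> and so divides \<open>m!\<close>.\<close>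

lemma funpow_eventually_periodic:
  fixes f :: "'b \<Rightarrow> 'b"
  assumes B: "finite B" "x \<in> B" "\<And>y. y \<in> B \<Longrightarrow> f y \<in> B" and m: "card B \<le> m"
    and a: "a \<ge> m" "b \<ge> m" "fact m dvd int a - int b"
  shows "(f ^^ a) x = (f ^^ b) x"
proof -
  have inB: "(f ^^ i) x \<in> B" for i by (induction i) (use B in auto)
  have "\<not> inj_on (\<lambda>i. (f ^^ i) x) {..card B}"
  proof
    assume "inj_on (\<lambda>i. (f ^^ i) x) {..card B}"
    then have "card {..card B} \<le> card B" using inB B(1) by (intro card_inj_on_le) auto
    then show False by simp
  qed
  then obtain i j where ij: "i < j" "j \<le> card B" "(f ^^ i) x = (f ^^ j) x"
    unfolding inj_on_def by (metis atMost_iff linorder_neqE_nat)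
  define r where "r = j - i"
  have r: "1 \<le> r" "r \<le> m" using ij m by (auto simp: r_def)
  have per: "(f ^^ (c + r)) x = (f ^^ c) x" if "c \<ge> i" for c
  proof -
    have e: "c + r = (c - i) + j" "(c - i) + i = c" using that ij(1) by (simp_all add: r_def)
    have "(f ^^ (c + r)) x = (f ^^ (c - i)) ((f ^^ j) x)" unfolding e(1) funpow_add comp_apply ..
    also have "\<dots> = (f ^^ (c - i + i)) x" unfolding funpow_add comp_apply ij(3) ..
    finally show ?thesis unfolding e(2) .
  qed
  have pers: "(f ^^ (c + r * l)) x = (f ^^ c) x" if "c \<ge> i" for c l
  proof (induction l)
    case (Suc l)
    have "(f ^^ (c + r * l + r)) x = (f ^^ (c + r * l)) x" using per that by simp
    then show ?case using Suc by (simp add: algebra_simps)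
  qed simp
  have im: "i \<le> m" using ij m by simp
  have le: "(f ^^ b) x = (f ^^ a) x" if "a \<le> b" "a \<ge> m" "fact m dvd int b - int a" for a b
  proof -
    have "int r dvd fact m" using r by (metis dvd_fact of_nat_dvd_iff of_nat_fact)
    then have "int r dvd int b - int a" using that(3) by (rule dvd_trans)
    then have "int r dvd int (b - a)" using that(1) by (simp add: of_nat_diff)
    then have "r dvd b - a" by (simp only: of_nat_dvd_iff)
    then obtain l where "b - a = r * l" by (rule dvdE)
    then have "b = a + r * l" using that(1) by simp
    then show ?thesis using pers[of a l] that(2) im by simp
  qed
  show ?thesis
  proof (cases "a \<le> b")
    case True
    then show ?thesis using le[OF True a(1)] a(3) by (metis dvd_minus_iff minus_diff_eq)
  next
    case False
    then show ?thesis using le[of b a] a by simp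
  qed
qed

section \<open>Labelled dumbbells and their walks\<close>

locale labelled =
  fixes v :: labelling
  assumes labelling: "dumbbell_labelling v"
begin

abbreviation "loop \<equiv> \<lambda>n. fact n :: int"
abbreviation "half \<equiv> \<lambda>n::nat. 2 ^ n :: int"

definition comps :: "nat \<Rightarrow> nat set" where "comps n = {1..4 ^ (n - 1)}"

definition walk :: "nat \<Rightarrow> nat \<Rightarrow> int \<Rightarrow> nat list" where
  "walk n i t = v n i (nat (walk_pos (loop n) (half n) t))"

text \<open>The periodic walks around the two loops, which are at the left and at the right end of the
  connecting path at time \<open>0\<close>.\<close>

definition in_walk :: "nat \<Rightarrow> nat \<Rightarrow> int \<Rightarrow> nat list" where
  "in_walk n i t = v n i (nat (1 + (t - 1) mod loop n))"

definition out_walk :: "nat \<Rightarrow> nat \<Rightarrow> int \<Rightarrow> nat list" where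
  "out_walk n i t = v n i (nat (loop n + 2 * half n + t mod loop n))"

lemma loop_ge: "loop n \<ge> 1" by (rule fact_ge_1)
lemma half_ge: "half n \<ge> 1" by simp

lemma loop_dvd: "n \<le> m \<Longrightarrow> loop n dvd loop m" by (rule fact_dvd)
lemma half_mono: "n \<le> m \<Longrightarrow> half n \<le> half m" by simp

lemma walk_in: "t \<le> - half n \<Longrightarrow> walk n i t = in_walk n i (t + half n)"
  by (simp add: walk_def in_walk_def walk_pos_in)

lemma walk_out: "t \<ge> half n \<Longrightarrow> walk n i t = out_walk n i (t - half n)"
  unfolding walk_def out_walk_def walk_pos_out[OF loop_ge half_ge] by simp

lemma in_walk_cong: "loop n dvd s - t \<Longrightarrow> in_walk n i s = in_walk n i t"
proof -
  assume "loop n dvd s - t"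
  then have "(s - 1) mod loop n = (t - 1) mod loop n" by (simp add: mod_eq_dvd_iff)
  then show ?thesis by (simp add: in_walk_def)
qed

lemma out_walk_cong: "loop n dvd s - t \<Longrightarrow> out_walk n i s = out_walk n i t"
proof -
  assume "loop n dvd s - t"
  then have "s mod loop n = t mod loop n" by (simp add: mod_eq_dvd_iff)
  then show ?thesis by (simp add: out_walk_def)
qed

text \<open>The in-loop is visited by \<open>walk\<close> at arbitrarily early times, so statements about \<open>walk\<close> before
  any given time apply to the whole loop.\<close>

lemma in_walk_as_walk:
  obtains s where "s \<le> b" "s \<le> - half n" "loop n dvd (s + half n) - t" "in_walk n i t = walk n i s"
proof -
  define K where "K = loop n * (\<bar>t\<bar> + \<bar>b\<bar> + half n)"
  define s where "s = t - half n - K"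
  have "K \<ge> 1 * (\<bar>t\<bar> + \<bar>b\<bar> + half n)"
    unfolding K_def by (rule mult_right_mono[OF loop_ge]) simp
  moreover have "0 < half n" by simp
  ultimately have s: "s \<le> b" "s \<le> - half n" unfolding s_def by (smt (verit))+
  moreover have d: "loop n dvd (s + half n) - t" by (simp add: s_def K_def)
  moreover have "in_walk n i t = walk n i s" using walk_in[OF s(2)] in_walk_cong[OF d] by simp
  ultimately show ?thesis using that by blast
qed

lemma out_walk_as_walk:
  obtains s where "s \<ge> b" "s \<ge> half n" "loop n dvd (s - half n) - t" "out_walk n i t = walk n i s"
proof -
  define K where "K = loop n * (\<bar>t\<bar> + \<bar>b\<bar> + half n)"
  define s where "s = t + half n + K"
  have "K \<ge> 1 * (\<bar>t\<bar> + \<bar>b\<bar> + half n)"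
    unfolding K_def by (rule mult_right_mono[OF loop_ge]) simp
  moreover have "0 < half n" by simp
  ultimately have s: "s \<ge> b" "s \<ge> half n" unfolding s_def by (smt (verit))+
  moreover have d: "loop n dvd (s - half n) - t" by (simp add: s_def K_def)
  moreover have "out_walk n i t = walk n i s" using walk_out[OF s(2)] out_walk_cong[OF d] by simp
  ultimately show ?thesis using that by blast
qed

lemma dsize_eq: "int (dsize n) = 2 * loop n + 2 * half n - 1"
proof -
  have "dsize n + 1 = 2 * fact n + 2 * 2 ^ n"
    using fact_ge_1[of n, where ?'a = nat] unfolding dsize_def power_add by simp
  from arg_cong[OF this, of int] show ?thesis by simp
qed

lemma range_walk_pos: "range (\<lambda>t. nat (walk_pos (loop n) (half n) t)) = {1..dsize n}"
proof (intro equalityI subsetI)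
  fix k assume "k \<in> range (\<lambda>t. nat (walk_pos (loop n) (half n) t))"
  then obtain t where "k = nat (walk_pos (loop n) (half n) t)" by blast
  then show "k \<in> {1..dsize n}"
    using walk_pos_bounds[OF loop_ge half_ge, of n n t] dsize_eq[of n] by auto
next
  fix k assume "k \<in> {1..dsize n}"
  then have "walk_pos (loop n) (half n) (int k - loop n - half n) = int k"
    using dsize_eq[of n] by (intro walk_pos_surj[OF loop_ge half_ge]) auto
  then show "k \<in> range (\<lambda>t. nat (walk_pos (loop n) (half n) t))"
    by (intro range_eqI[where x = "int k - loop n - half n"]) simp
qed

lemma dverts_eq: "dverts v n i = range (walk n i)"
  unfolding dverts_def range_walk_pos[symmetric] image_image walk_def ..

lemma drel_eq: "drel v n i = range (\<lambda>t. (walk n i t, walk n i (t + 1)))"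
proof -
  have "dumbbell (fact n) (2 ^ (n + 1)) (fact n) =
      range (\<lambda>t. (nat (walk_pos (loop n) (half n) t), nat (walk_pos (loop n) (half n) (t + 1))))"
    using dumbbell_walk[of "fact n" "2 ^ n"] fact_ge_1[of n, where ?'a = nat] by simp
  then show ?thesis
    unfolding drel_def by (simp add: image_image walk_def)
qed

lemma walk_eq_iff:
  assumes "n \<ge> 2" "i \<in> comps n"
  shows "walk n i s = walk n i t \<longleftrightarrow> same_pos (loop n) (half n) s t"
proof -
  have inj: "inj_on (v n i) {1..dsize n}"
    using labelling assms unfolding dumbbell_labelling_def comps_def by blast
  have dom: "nat (walk_pos (loop n) (half n) t) \<in> {1..dsize n}" for t
    unfolding range_walk_pos[symmetric] by (rule rangeI)
  have "walk n i s = walk n i t \<longleftrightarrow>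
      nat (walk_pos (loop n) (half n) s) = nat (walk_pos (loop n) (half n) t)"
    unfolding walk_def by (rule inj_on_eq_iff[OF inj dom dom])
  also have "\<dots> \<longleftrightarrow> walk_pos (loop n) (half n) s = walk_pos (loop n) (half n) t"
    using walk_pos_bounds(1)[OF loop_ge half_ge, of n n s] walk_pos_bounds(1)[OF loop_ge half_ge, of n n t]
    by (simp add: eq_nat_nat_iff)
  finally show ?thesis by (simp add: walk_pos_eq_iff[OF loop_ge half_ge])
qed

lemma walk_comp_unique:
  assumes "n \<ge> 2" "i \<in> comps n" "j \<in> comps n" "walk n i s = walk n j t"
  shows "i = j"
proof (rule ccontr)
  assume "i \<noteq> j"
  then have "dverts v n i \<inter> dverts v n j = {}"
    using labelling assms unfolding dumbbell_labelling_def comps_def disjoint_family_on_def by blast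
  then show False using assms(4) unfolding dverts_eq by blast
qed

lemma J_eq: "n \<ge> 2 \<Longrightarrow> J v n = {walk n i t |i t. i \<in> comps n}"
  unfolding J_def dverts_eq comps_def by auto

lemma Phi_eq: "n \<ge> 2 \<Longrightarrow> \<Phi> v n = {(walk n i t, walk n i (t + 1)) |i t. i \<in> comps n}"
  unfolding \<Phi>_def drel_eq comps_def by auto

text \<open>A map on a level is given by one function of time for each component, provided that it takes
  the same value whenever the walk is at the same place.\<close>

lemma map_from_walks:
  assumes n: "n \<ge> 2"
    and F: "\<And>i s t. i \<in> comps n \<Longrightarrow> same_pos (loop n) (half n) s t \<Longrightarrow> F i s = F i t"
  obtains q where "\<And>i t. i \<in> comps n \<Longrightarrow> q (walk n i t) = F i t"
proof -
  define q where "q x = (let (i, t) = (SOME (i, t). i \<in> comps n \<and> x = walk n i t) in F i t)" for x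
  have "q (walk n i t) = F i t" if i: "i \<in> comps n" for i t
  proof -
    obtain j s where js: "(SOME (j, s). j \<in> comps n \<and> walk n i t = walk n j s) = (j, s)"
      by (rule prod.exhaust)
    have "case (SOME (j, s). j \<in> comps n \<and> walk n i t = walk n j s) of (j, s) \<Rightarrow>
        j \<in> comps n \<and> walk n i t = walk n j s"
      by (rule someI[of _ "(i, t)"]) (simp add: i)
    then have *: "j \<in> comps n" "walk n i t = walk n j s" using js by auto
    then have "j = i" using walk_comp_unique[OF n i *(1) *(2)] by simp
    moreover have "same_pos (loop n) (half n) t s"
      using walk_eq_iff[OF n i] * \<open>j = i\<close> by blast
    ultimately show ?thesis using js F[OF i] by (simp add: q_def)
  qed
  then show ?thesis using that by blast
qed

section \<open>Classification of the walks in a union of dumbbells\<close>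

lemma same_pos_shift_up:
  assumes "same_pos N h s t" "- h < s"
  shows "same_pos N h (s + 1) (t + 1)"
  using assms unfolding same_pos_def by auto

lemma same_pos_shift_down:
  assumes "same_pos N h s t" "s < h"
  shows "same_pos N h (s - 1) (t - 1)"
  using assms unfolding same_pos_def by auto

lemma edge_from_walk:
  assumes n: "n \<ge> 2" and i: "i \<in> comps n" and e: "(walk n i s, y) \<in> \<Phi> v n"
  obtains t where "same_pos (loop n) (half n) s t" "y = walk n i (t + 1)"
proof -
  obtain j t where jt: "j \<in> comps n" "walk n i s = walk n j t" "y = walk n j (t + 1)"
    using e unfolding Phi_eq[OF n] by blast
  then have "j = i" using walk_comp_unique[OF n i jt(1,2)] by simp
  then show ?thesis using that jt walk_eq_iff[OF n i] by blast
qed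

lemma edge_to_walk:
  assumes n: "n \<ge> 2" and i: "i \<in> comps n" and e: "(x, walk n i s) \<in> \<Phi> v n"
  obtains t where "same_pos (loop n) (half n) s t" "x = walk n i (t - 1)"
proof -
  obtain j t where jt: "j \<in> comps n" "x = walk n j t" "walk n i s = walk n j (t + 1)"
    using e unfolding Phi_eq[OF n] by blast
  then have "j = i" using walk_comp_unique[OF n i jt(1,3)] by simp
  then show ?thesis using that[of "t + 1"] jt walk_eq_iff[OF n i] by simp
qed

lemma edge_succ:
  assumes "n \<ge> 2" "i \<in> comps n" "(walk n i s, y) \<in> \<Phi> v n" "- half n < s"
  shows "y = walk n i (s + 1)"
  using edge_from_walk[OF assms(1-3)] same_pos_shift_up[OF _ assms(4)] walk_eq_iff[OF assms(1,2)]
  by metis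

lemma edge_pred:
  assumes "n \<ge> 2" "i \<in> comps n" "(x, walk n i s) \<in> \<Phi> v n" "s < half n"
  shows "x = walk n i (s - 1)"
  using edge_to_walk[OF assms(1-3)] same_pos_shift_down[OF _ assms(4)] walk_eq_iff[OF assms(1,2)]
  by metis

lemma int_walk_induct:
  fixes P :: "int \<Rightarrow> bool"
  assumes "P a" "\<And>k. k \<ge> a \<Longrightarrow> P k \<Longrightarrow> P (k + 1)" "\<And>k. k \<le> a \<Longrightarrow> P k \<Longrightarrow> P (k - 1)"
  shows "P t"
  using assms by (rule int_induct[of P a])

text \<open>The only vertex with two successors is the left end of the path and the only one with two
  predecessors is the right end.  From an interior vertex of the path, the walk forwards avoids the
  former and the walk backwards avoids the latter.\<close>

lemma walk_through_interior:
  assumes n: "n \<ge> 2" and j: "j \<in> comps n" and \<tau>: "\<And>t. (\<tau> t, \<tau> (t + 1)) \<in> \<Phi> v n"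
    and s0: "\<tau> t0 = walk n j s0" "- half n < s0" "s0 < half n"
  shows "\<tau> t = walk n j (t - t0 + s0)"
proof (induction t rule: int_walk_induct[where a = t0])
  case 1
  show ?case using s0(1) by simp
next
  case (2 k)
  show ?case
    using edge_succ[OF n j, of "k - t0 + s0" "\<tau> (k + 1)"] \<tau>[of k] 2 s0 by (simp add: algebra_simps)
next
  case (3 k)
  show ?case
    using edge_pred[OF n j, of "\<tau> (k - 1)" "k - t0 + s0"] \<tau>[of "k - 1"] 3 s0 by (simp add: algebra_simps)
qed

lemma in_walk_of_walk:
  assumes "n \<ge> 2" "j \<in> comps n" "walk n j s = in_walk n j a"
  shows "s \<le> - half n" "loop n dvd (s + half n) - a"
proof -
  obtain r where r: "r \<le> - half n" "loop n dvd (r + half n) - a" "in_walk n j a = walk n j r"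
    using in_walk_as_walk[of 0 n a j] by blast
  have sp: "same_pos (loop n) (half n) s r" using walk_eq_iff[OF assms(1,2)] assms(3) r(3) by simp
  have h: "half n > 0" by simp
  show "s \<le> - half n" using sp r(1) h unfolding same_pos_def by linarith
  have "loop n dvd s - r" using sp unfolding same_pos_def by auto
  then have "loop n dvd (s - r) + ((r + half n) - a)" using r(2) by (rule dvd_add)
  then show "loop n dvd (s + half n) - a" by (simp add: algebra_simps)
qed

lemma out_walk_of_walk:
  assumes "n \<ge> 2" "j \<in> comps n" "walk n j s = out_walk n j a"
  shows "s \<ge> half n" "loop n dvd (s - half n) - a"
proof -
  obtain r where r: "r \<ge> half n" "loop n dvd (r - half n) - a" "out_walk n j a = walk n j r"
    using out_walk_as_walk[of 0 n a j] by blast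
  have sp: "same_pos (loop n) (half n) s r" using walk_eq_iff[OF assms(1,2)] assms(3) r(3) by simp
  have h: "half n > 0" by simp
  show "s \<ge> half n" using sp r(1) h unfolding same_pos_def by linarith
  have "loop n dvd s - r" using sp unfolding same_pos_def by auto
  then have "loop n dvd (s - r) + ((r - half n) - a)" using r(2) by (rule dvd_add)
  then show "loop n dvd (s - half n) - a" by (simp add: algebra_simps)
qed

definition path_interior :: "nat \<Rightarrow> nat \<Rightarrow> nat list \<Rightarrow> bool" where
  "path_interior n j x \<longleftrightarrow> (\<exists>s. - half n < s \<and> s < half n \<and> x = walk n j s)"

lemma in_walk_succ:
  assumes n: "n \<ge> 2" and j: "j \<in> comps n" and e: "(in_walk n j a, y) \<in> \<Phi> v n"
    and y: "\<not> path_interior n j y"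
  shows "y = in_walk n j (a + 1)"
proof -
  obtain r where r: "r \<le> - half n" "loop n dvd (r + half n) - a" "in_walk n j a = walk n j r"
    using in_walk_as_walk[of 0 n a j] by blast
  have "(walk n j r, y) \<in> \<Phi> v n" using e r(3) by simp
  then obtain t where t: "same_pos (loop n) (half n) r t" "y = walk n j (t + 1)"
    using edge_from_walk[OF n j] by blast
  have w: "walk n j t = in_walk n j a" using t(1) walk_eq_iff[OF n j, of r t] r(3) by simp
  note t2 = in_walk_of_walk[OF n j w]
  have h: "half n > 0" by simp
  have "t \<noteq> - half n"
  proof
    assume "t = - half n"
    then have "- half n < t + 1 \<and> t + 1 < half n" using n power_increasing[of 1 n "2::int"] by simp
    then show False using y t(2) unfolding path_interior_def by blast
  qed
  then have "y = in_walk n j (t + 1 + half n)" using t2(1) walk_in[of "t + 1" n j] t(2) by simp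
  also have "\<dots> = in_walk n j (a + 1)"
    by (rule in_walk_cong) (use t2(2) in \<open>simp add: algebra_simps\<close>)
  finally show ?thesis .
qed

lemma in_walk_pred:
  assumes n: "n \<ge> 2" and j: "j \<in> comps n" and e: "(x, in_walk n j a) \<in> \<Phi> v n"
  shows "x = in_walk n j (a - 1)"
proof -
  obtain r where r: "r \<le> - half n" "loop n dvd (r + half n) - a" "in_walk n j a = walk n j r"
    using in_walk_as_walk[of 0 n a j] by blast
  have h: "half n > 0" by simp
  have "x = walk n j (r - 1)" using edge_pred[OF n j, of x r] e r(1,3) h by simp
  also have "\<dots> = in_walk n j (r - 1 + half n)" using walk_in[of "r - 1" n j] r(1) by simp
  also have "\<dots> = in_walk n j (a - 1)"
    by (rule in_walk_cong) (use r(2) in \<open>simp add: algebra_simps\<close>)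
  finally show ?thesis .
qed

lemma out_walk_succ:
  assumes n: "n \<ge> 2" and j: "j \<in> comps n" and e: "(out_walk n j a, y) \<in> \<Phi> v n"
  shows "y = out_walk n j (a + 1)"
proof -
  obtain r where r: "r \<ge> half n" "loop n dvd (r - half n) - a" "out_walk n j a = walk n j r"
    using out_walk_as_walk[of 0 n a j] by blast
  have h: "half n > 0" by simp
  have "y = walk n j (r + 1)" using edge_succ[OF n j, of r y] e r(1,3) h by simp
  also have "\<dots> = out_walk n j (r + 1 - half n)" using walk_out[of n "r + 1" j] r(1) by simp
  also have "\<dots> = out_walk n j (a + 1)"
    by (rule out_walk_cong) (use r(2) in \<open>simp add: algebra_simps\<close>)
  finally show ?thesis .
qed

lemma out_walk_pred:
  assumes n: "n \<ge> 2" and j: "j \<in> comps n" and e: "(x, out_walk n j a) \<in> \<Phi> v n"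
    and x: "\<not> path_interior n j x"
  shows "x = out_walk n j (a - 1)"
proof -
  obtain r where r: "r \<ge> half n" "loop n dvd (r - half n) - a" "out_walk n j a = walk n j r"
    using out_walk_as_walk[of 0 n a j] by blast
  have "(x, walk n j r) \<in> \<Phi> v n" using e r(3) by simp
  then obtain t where t: "same_pos (loop n) (half n) r t" "x = walk n j (t - 1)"
    using edge_to_walk[OF n j] by blast
  have w: "walk n j t = out_walk n j a" using t(1) walk_eq_iff[OF n j, of r t] r(3) by simp
  note t2 = out_walk_of_walk[OF n j w]
  have h: "half n > 0" by simp
  have "t \<noteq> half n"
  proof
    assume "t = half n"
    then have "- half n < t - 1 \<and> t - 1 < half n" using n power_increasing[of 1 n "2::int"] by simp
    then show False using x t(2) unfolding path_interior_def by blast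
  qed
  then have "x = out_walk n j (t - 1 - half n)" using t2(1) walk_out[of n "t - 1" j] t(2) by simp
  also have "\<dots> = out_walk n j (a - 1)"
    by (rule out_walk_cong) (use t2(2) in \<open>simp add: algebra_simps\<close>)
  finally show ?thesis .
qed

lemma in_walk_unique:
  assumes n: "n \<ge> 2" and j: "j \<in> comps n" and \<tau>: "\<And>t. (\<tau> t, \<tau> (t + 1)) \<in> \<Phi> v n"
    and ni: "\<And>t. \<not> path_interior n j (\<tau> t)" and a: "\<tau> 0 = in_walk n j a"
  shows "\<tau> t = in_walk n j (t + a)"
proof (induction t rule: int_walk_induct[where a = 0])
  case 1
  show ?case using a by simp
next
  case (2 k)
  show ?case using in_walk_succ[OF n j _ ni, of "k + a" "k + 1"] \<tau>[of k] 2 by (simp add: algebra_simps)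
next
  case (3 k)
  show ?case using in_walk_pred[OF n j, of "\<tau> (k - 1)" "k + a"] \<tau>[of "k - 1"] 3 by (simp add: algebra_simps)
qed

lemma out_walk_unique:
  assumes n: "n \<ge> 2" and j: "j \<in> comps n" and \<tau>: "\<And>t. (\<tau> t, \<tau> (t + 1)) \<in> \<Phi> v n"
    and ni: "\<And>t. \<not> path_interior n j (\<tau> t)" and a: "\<tau> 0 = out_walk n j a"
  shows "\<tau> t = out_walk n j (t + a)"
proof (induction t rule: int_walk_induct[where a = 0])
  case 1
  show ?case using a by simp
next
  case (2 k)
  show ?case using out_walk_succ[OF n j, of "k + a" "\<tau> (k + 1)"] \<tau>[of k] 2 by (simp add: algebra_simps)
next
  case (3 k)
  show ?case using out_walk_pred[OF n j _ ni, of "k - 1" "k + a"] \<tau>[of "k - 1"] 3 by (simp add: algebra_simps)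
qed

text \<open>A walk that visits the interior of a path is forced to cross it.  One that does not cannot
  change from one loop to the other, since the path has interior vertices.\<close>

lemma walk_classification:
  assumes n: "n \<ge> 2" and \<tau>: "\<And>t. (\<tau> t, \<tau> (t + 1)) \<in> \<Phi> v n"
  obtains (mid) j c where "j \<in> comps n" "\<And>t. \<tau> t = walk n j (t + c)"
  | (inn) j c where "j \<in> comps n" "\<And>t. \<tau> t = in_walk n j (t + c)"
  | (out) j c where "j \<in> comps n" "\<And>t. \<tau> t = out_walk n j (t + c)"
proof (cases "\<exists>t j. j \<in> comps n \<and> path_interior n j (\<tau> t)")
  case True
  then obtain t0 j s0 where *: "j \<in> comps n" "\<tau> t0 = walk n j s0" "- half n < s0" "s0 < half n"
    unfolding path_interior_def by blast
  have "\<tau> t = walk n j (t + (s0 - t0))" for t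
    using walk_through_interior[OF n *(1) \<tau> *(2-4), of t] by (simp add: algebra_simps)
  then show thesis using mid *(1) by blast
next
  case False
  obtain j s where j: "j \<in> comps n" "\<tau> 0 = walk n j s"
    using \<tau>[of 0] unfolding Phi_eq[OF n] by blast
  have ni: "\<not> path_interior n j (\<tau> t)" for t using False j(1) by blast
  then have "s \<le> - half n \<or> half n \<le> s" using j(2) unfolding path_interior_def by force
  then show thesis
  proof
    assume "s \<le> - half n"
    then show thesis using inn[OF j(1) in_walk_unique[where \<tau> = \<tau>, OF n j(1) \<tau> ni]] walk_in j(2) by metis
  next
    assume "half n \<le> s"
    then show thesis using out[OF j(1) out_walk_unique[where \<tau> = \<tau>, OF n j(1) \<tau> ni]] walk_out j(2) by metis
  qed
qed

section \<open>The bonding maps on walks\<close>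

definition parent :: "nat \<Rightarrow> nat" where "parent i = (i - 1) div 4 + 1"

lemma parent_comps: "n \<ge> 1 \<Longrightarrow> i \<in> comps (Suc n) \<Longrightarrow> parent i \<in> comps n"
proof -
  assume n: "n \<ge> 1" and i: "i \<in> comps (Suc n)"
  have "4 ^ n = (4::nat) * 4 ^ (n - 1)" using n by (cases n) auto
  then have "i - 1 < 4 * 4 ^ (n - 1)" using i by (auto simp: comps_def)
  then have "(i - 1) div 4 < 4 ^ (n - 1)" by simp
  then show ?thesis by (simp add: parent_def comps_def)
qed

lemma child_comps:
  assumes "n \<ge> 1" "j \<in> comps n" "r < 4"
  shows "4 * (j - 1) + r + 1 \<in> comps (Suc n)" "parent (4 * (j - 1) + r + 1) = j"
    "(4 * (j - 1) + r + 1 - 1) mod 4 = r"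
proof -
  have "4 ^ n = (4::nat) * 4 ^ (n - 1)" using assms(1) by (cases n) auto
  then show "4 * (j - 1) + r + 1 \<in> comps (Suc n)"
    using assms by (auto simp: comps_def)
  show "parent (4 * (j - 1) + r + 1) = j" "(4 * (j - 1) + r + 1 - 1) mod 4 = r"
    using assms by (auto simp: parent_def comps_def)
qed

lemma same_pos_dvd: "same_pos N h s t \<Longrightarrow> N dvd s - t"
  unfolding same_pos_def by auto

text \<open>Passing from level \<open>m\<close> to level \<open>n\<close> shortens the path, so coincidences of positions survive a
  shift by up to the difference of the half-lengths.\<close>

lemma same_pos_shift:
  assumes "same_pos (loop m) (half m) s t" "n \<le> m" "\<bar>c\<bar> \<le> half m - half n"
  shows "same_pos (loop n) (half n) (s + c) (t + c)"
proof -
  have "loop n dvd s - t" using same_pos_dvd[OF assms(1)] loop_dvd[OF assms(2)] dvd_trans by blast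
  moreover have "s + c - (t + c) = s - t" by simp
  moreover have "s = t \<or> s + c \<le> - half n \<and> t + c \<le> - half n \<or> s + c \<ge> half n \<and> t + c \<ge> half n"
    using assms(1,3) unfolding same_pos_def abs_le_iff by linarith
  ultimately show ?thesis unfolding same_pos_def by auto
qed

lemma same_pos_mono: "same_pos (loop m) (half m) s t \<Longrightarrow> n \<le> m \<Longrightarrow> same_pos (loop n) (half n) s t"
  using same_pos_shift[of m s t n 0] half_mono[of n m] by simp

lemma midpoint_eq: "midpoint v n i = walk n i 0"
proof -
  have "walk_pos (loop n) (half n) 0 = int (fact n + 2 ^ n)"
    using walk_pos_mid[OF loop_ge, of "half n" 0 n] by simp
  then show ?thesis unfolding midpoint_def walk_def by (simp only: nat_int)
qed

lemma left_end_eq: "left_end v n i = in_walk n i 0"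
proof -
  have "1 + (0 - 1) mod loop n = int (fact n)" using loop_ge[of n] by (simp add: zmod_minus1)
  then show ?thesis unfolding left_end_def in_walk_def by (simp only: nat_int)
qed

lemma right_end_eq: "right_end v n i = out_walk n i 0"
proof -
  have "loop n + 2 * half n + 0 mod loop n = int (fact n + 2 ^ (n + 1))" by simp
  then show ?thesis unfolding right_end_def out_walk_def by (simp only: nat_int)
qed

lemma in_loop_verts: "v n i ` {1..fact n} = range (in_walk n i)"
proof -
  have "range (\<lambda>t. nat (1 + (t - 1) mod loop n)) = {1..fact n}"
  proof (intro equalityI subsetI)
    fix k assume "k \<in> range (\<lambda>t. nat (1 + (t - 1) mod loop n))"
    then obtain t where t: "k = nat (1 + (t - 1) mod loop n)" by blast
    have m: "0 \<le> (t - 1) mod loop n" "(t - 1) mod loop n < int (fact n)" using loop_ge[of n] by simp_all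
    have "int k = 1 + (t - 1) mod loop n" unfolding t using m(1) by simp
    then have "int 1 \<le> int k" "int k \<le> int (fact n)" using m by linarith+
    then show "k \<in> {1..fact n}" by (simp only: of_nat_le_iff atLeastAtMost_iff)
  next
    fix k :: nat assume "k \<in> {1..fact n}"
    then have k: "k \<ge> 1" "k \<le> fact n" by auto
    then have "int k \<le> int (fact n)" by (simp only: of_nat_le_iff)
    then have "(int k - 1) mod loop n = int k - 1" using k(1) by (intro mod_pos_pos_trivial) auto
    then show "k \<in> range (\<lambda>t. nat (1 + (t - 1) mod loop n))"
      by (intro range_eqI[where x = "int k"]) simp
  qed
  then show ?thesis unfolding in_walk_def by (metis image_image)
qed

lemma out_loop_verts: "v n i ` {fact n + 2 ^ (n + 1)..dsize n} = range (out_walk n i)"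
proof -
  have "range (\<lambda>t. nat (loop n + 2 * half n + t mod loop n)) = {fact n + 2 ^ (n + 1)..dsize n}"
  proof (intro equalityI subsetI)
    fix k assume "k \<in> range (\<lambda>t. nat (loop n + 2 * half n + t mod loop n))"
    then obtain t where t: "k = nat (loop n + 2 * half n + t mod loop n)" by blast
    have m: "0 \<le> t mod loop n" "t mod loop n < loop n" using loop_ge[of n] by simp_all
    have "int k = loop n + 2 * half n + t mod loop n"
      unfolding t using m(1) loop_ge[of n] by simp
    then have "int (fact n + 2 ^ (n + 1)) \<le> int k" "int k \<le> int (dsize n)"
      using m dsize_eq[of n] by simp_all
    then show "k \<in> {fact n + 2 ^ (n + 1)..dsize n}" by (simp only: of_nat_le_iff atLeastAtMost_iff)
  next
    fix k :: nat assume "k \<in> {fact n + 2 ^ (n + 1)..dsize n}"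
    then have "int (fact n + 2 ^ (n + 1)) \<le> int k" "int k \<le> int (dsize n)"
      by (simp_all only: of_nat_le_iff atLeastAtMost_iff)
    then have k: "loop n + 2 * half n \<le> int k" "int k \<le> 2 * loop n + 2 * half n - 1"
      using dsize_eq[of n] by simp_all
    then have "(int k - (loop n + 2 * half n)) mod loop n = int k - (loop n + 2 * half n)"
      by (intro mod_pos_pos_trivial) auto
    then show "k \<in> range (\<lambda>t. nat (loop n + 2 * half n + t mod loop n))"
      by (intro range_eqI[where x = "int k - (loop n + 2 * half n)"]) simp
  qed
  then show ?thesis unfolding out_walk_def by (metis image_image)
qed

lemma walk_edge: "(walk n i t, walk n i (t + 1)) \<in> drel v n i"
  unfolding drel_eq by blast

lemma in_walk_edge: "(in_walk n i t, in_walk n i (t + 1)) \<in> drel v n i"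
proof -
  obtain s where s: "s \<le> - half n - 1" "loop n dvd (s + half n) - t" "in_walk n i t = walk n i s"
    using in_walk_as_walk[of "- half n - 1" n t i] by blast
  have "walk n i (s + 1) = in_walk n i (s + 1 + half n)" using walk_in[of "s + 1" n i] s(1) by simp
  also have "\<dots> = in_walk n i (t + 1)"
    by (rule in_walk_cong) (use s(2) in \<open>simp add: algebra_simps\<close>)
  finally show ?thesis using walk_edge[of n i s] s(3) by simp
qed

lemma out_walk_edge: "(out_walk n i t, out_walk n i (t + 1)) \<in> drel v n i"
proof -
  obtain s where s: "s \<ge> half n" "loop n dvd (s - half n) - t" "out_walk n i t = walk n i s"
    using out_walk_as_walk[of 0 n t i] by blast
  have "walk n i (s + 1) = out_walk n i (s + 1 - half n)" using walk_out[of n "s + 1" i] s(1) by simp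
  also have "\<dots> = out_walk n i (t + 1)"
    by (rule out_walk_cong) (use s(2) in \<open>simp add: algebra_simps\<close>)
  finally show ?thesis using walk_edge[of n i s] s(3) by simp
qed

lemma drel_Phi: "n \<ge> 2 \<Longrightarrow> j \<in> comps n \<Longrightarrow> drel v n j \<subseteq> \<Phi> v n"
  unfolding drel_eq Phi_eq by blast

lemma in_walk_not_interior: "n \<ge> 2 \<Longrightarrow> j \<in> comps n \<Longrightarrow> \<not> path_interior n j (in_walk n j a)"
  unfolding path_interior_def using in_walk_of_walk(1) by (metis linorder_not_le)

lemma out_walk_not_interior: "n \<ge> 2 \<Longrightarrow> j \<in> comps n \<Longrightarrow> \<not> path_interior n j (out_walk n j a)"
  unfolding path_interior_def using out_walk_of_walk(1) by (metis linorder_not_le)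

lemma map_on_component:
  assumes n: "n \<ge> 2" and i: "i \<in> comps n"
    and F: "\<And>s t. same_pos (loop n) (half n) s t \<Longrightarrow> F s = F t"
  obtains p where "p \<in> extensional (dverts v n i)" "\<And>t. p (walk n i t) = F t"
proof -
  obtain q where q: "\<And>j t. j \<in> comps n \<Longrightarrow> q (walk n j t) = F t"
    using map_from_walks[OF n, of "\<lambda>_. F"] F by blast
  show ?thesis
    by (rule that[of "restrict q (dverts v n i)"]) (use q[OF i] in \<open>auto simp: dverts_eq\<close>)
qed

text \<open>Evaluates the definite descriptions that define the bonding maps: if the condition \<open>Q\<close> forces
  the values along the walk to be \<open>F\<close>, the described map exists and has these values.\<close>

lemma the_map_eq:
  assumes n: "n \<ge> 2" and i: "i \<in> comps n"
    and F: "\<And>s t. same_pos (loop n) (half n) s t \<Longrightarrow> F s = F t"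
    and Q: "\<And>p. p \<in> extensional (dverts v n i) \<Longrightarrow> Q p \<longleftrightarrow> (\<forall>t. p (walk n i t) = F t)"
  shows "(THE p. p \<in> extensional (dverts v n i) \<and> Q p) (walk n i t) = F t"
proof -
  obtain p where p: "p \<in> extensional (dverts v n i)" "\<And>t. p (walk n i t) = F t"
    by (rule map_on_component[OF n i, of F], rule F, assumption, blast)
  have "(THE p. p \<in> extensional (dverts v n i) \<and> Q p) = p"
  proof (rule the_equality)
    show "p \<in> extensional (dverts v n i) \<and> Q p" using p Q by blast
    fix p' assume p': "p' \<in> extensional (dverts v n i) \<and> Q p'"
    then have "\<forall>t. p' (walk n i t) = F t" using Q by blast
    then have "p' (walk n i t) = p (walk n i t)" for t using p(2) by simp
    then show "p' = p" using p' p(1) by (intro extensionalityI[of _ "dverts v n i"]) (auto simp: dverts_eq)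
  qed
  then show ?thesis using p(2) by simp
qed

lemma system_map_comp:
  assumes "system_map p (dverts v m i, drel v m i) B"
  shows "(p (walk m i t), p (walk m i (t + 1))) \<in> snd B" "p (walk m i t) \<in> fst B"
proof -
  have "map_prod p p (walk m i t, walk m i (t + 1)) \<in> snd B"
    using assms walk_edge[of m i t] unfolding system_map_def by (metis image_subset_iff snd_conv)
  then show "(p (walk m i t), p (walk m i (t + 1))) \<in> snd B" by simp
  show "p (walk m i t) \<in> fst B"
    using assms unfolding system_map_def dverts_eq fst_conv by blast
qed

lemma system_map_compI:
  assumes "\<And>t. p (walk m i t) \<in> V" "\<And>t. (p (walk m i t), p (walk m i (t + 1))) \<in> R"
  shows "system_map p (dverts v m i, drel v m i) (V, R)"
  using assms unfolding system_map_def dverts_eq drel_eq by auto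

lemma P_comp:
  assumes n: "n \<ge> 2" and i: "i \<in> comps (Suc n)"
  shows "P v n (walk (Suc n) i t) = Pcomp v n i (walk (Suc n) i t)"
proof -
  have "(THE i'. i' \<in> {1..4 ^ n} \<and> walk (Suc n) i t \<in> dverts v (n + 1) i') = i"
  proof (rule the_equality)
    show "i \<in> {1..4 ^ n} \<and> walk (Suc n) i t \<in> dverts v (n + 1) i"
      using i by (auto simp: comps_def dverts_eq)
    fix i' assume "i' \<in> {1..4 ^ n} \<and> walk (Suc n) i t \<in> dverts v (n + 1) i'"
    then have "i' \<in> comps (Suc n)" "\<exists>s. walk (Suc n) i t = walk (Suc n) i' s"
      by (auto simp: comps_def dverts_eq)
    then show "i' = i" using walk_comp_unique[of "Suc n" i i'] n i by auto
  qed
  then show ?thesis using n by (simp add: P_def)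
qed

lemma P_mid:
  assumes n: "n \<ge> 2" and i: "i \<in> comps (Suc n)" and r: "(i - 1) mod 4 = 1 \<or> (i - 1) mod 4 = 2"
  shows "P v n (walk (Suc n) i t) = walk n (parent i) t"
proof -
  have n2: "Suc n \<ge> 2" using n by simp
  have j: "parent i \<in> comps n" using parent_comps i n by simp
  let ?Q = "\<lambda>p. system_map p (dverts v (Suc n) i, drel v (Suc n) i) (dverts v n (parent i), drel v n (parent i))
    \<and> p (midpoint v (Suc n) i) = midpoint v n (parent i)"
  have "(THE p. p \<in> extensional (dverts v (Suc n) i) \<and> ?Q p) (walk (Suc n) i t) = walk n (parent i) t"
  proof (rule the_map_eq[OF n2 i])
    fix s t assume "same_pos (loop (Suc n)) (half (Suc n)) s t"
    then show "walk n (parent i) s = walk n (parent i) t"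
      using walk_eq_iff[OF n j] same_pos_mono[of "Suc n" s t n] by simp
  next
    fix p
    show "?Q p \<longleftrightarrow> (\<forall>t. p (walk (Suc n) i t) = walk n (parent i) t)"
    proof
      assume Q: "?Q p"
      have e: "(p (walk (Suc n) i t), p (walk (Suc n) i (t + 1))) \<in> \<Phi> v n" for t
        using system_map_comp(1)[of p "Suc n" i _ t] Q drel_Phi[OF n j] by auto
      have z: "p (walk (Suc n) i 0) = walk n (parent i) 0" using Q by (simp add: midpoint_eq)
      show "\<forall>t. p (walk (Suc n) i t) = walk n (parent i) t"
        using walk_through_interior[where \<tau> = "\<lambda>t. p (walk (Suc n) i t)", OF n j e z] by simp
    next
      assume p: "\<forall>t. p (walk (Suc n) i t) = walk n (parent i) t"
      have "system_map p (dverts v (Suc n) i, drel v (Suc n) i) (dverts v n (parent i), drel v n (parent i))"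
        by (rule system_map_compI) (use p walk_edge in \<open>auto simp: dverts_eq\<close>)
      then show "?Q p" using p by (simp add: midpoint_eq)
    qed
  qed
  then show ?thesis
    using r unfolding P_comp[OF n i] Pcomp_def unique_map_def parent_def by (auto simp: Let_def)
qed

lemma unique_onto_loop_map:
  assumes n: "n \<ge> 2" and i: "i \<in> comps (Suc n)"
    and per: "\<And>s t. loop n dvd s - t \<Longrightarrow> G s = G t"
    and edge: "\<And>t. (G t, G (t + 1)) \<in> drel v n j"
    and forced: "\<And>\<tau> t. (\<And>t. (\<tau> t, \<tau> (t + 1)) \<in> drel v n j) \<Longrightarrow> (\<And>t. \<tau> t \<in> range G) \<Longrightarrow>
      \<tau> 0 = G 0 \<Longrightarrow> \<tau> t = G t"
  shows "unique_onto_map (dverts v (Suc n) i, drel v (Suc n) i) (restrict_sys (drel v n j) (range G))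
    (midpoint v (Suc n) i) (G 0) (walk (Suc n) i t) = G t"
proof -
  let ?A = "(dverts v (Suc n) i, drel v (Suc n) i)" and ?B = "restrict_sys (drel v n j) (range G)"
  let ?Q = "\<lambda>p. system_map p ?A ?B \<and> p ` dverts v (Suc n) i = fst ?B \<and> p (midpoint v (Suc n) i) = G 0"
  have n2: "Suc n \<ge> 2" using n by simp
  have "(THE p. p \<in> extensional (dverts v (Suc n) i) \<and> ?Q p) (walk (Suc n) i t) = G t"
  proof (rule the_map_eq[OF n2 i])
    fix s t assume "same_pos (loop (Suc n)) (half (Suc n)) s t"
    then have "loop n dvd s - t" using same_pos_dvd same_pos_mono[of "Suc n" s t n] by simp
    then show "G s = G t" by (rule per)
  next
    fix p
    show "?Q p \<longleftrightarrow> (\<forall>t. p (walk (Suc n) i t) = G t)"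
    proof
      assume Q: "?Q p"
      note m = system_map_comp[OF conjunct1[OF Q, unfolded restrict_sys_def], unfolded fst_conv snd_conv]
      have e: "(p (walk (Suc n) i t), p (walk (Suc n) i (t + 1))) \<in> drel v n j" for t
        using m(1) by blast
      have z: "p (walk (Suc n) i 0) = G 0" using Q by (simp add: midpoint_eq)
      show "\<forall>t. p (walk (Suc n) i t) = G t"
        using forced[where \<tau> = "\<lambda>t. p (walk (Suc n) i t)", OF e m(2) z] by blast
    next
      assume p: "\<forall>t. p (walk (Suc n) i t) = G t"
      have "system_map p ?A ?B"
        unfolding restrict_sys_def by (rule system_map_compI) (use p edge in auto)
      moreover have "p ` dverts v (Suc n) i = fst ?B"
        unfolding restrict_sys_def dverts_eq image_image using p by simp
      ultimately show "?Q p" using p by (simp add: midpoint_eq)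
    qed
  qed
  then show ?thesis unfolding unique_onto_map_def by simp
qed

lemma P_in:
  assumes n: "n \<ge> 2" and i: "i \<in> comps (Suc n)" and r: "(i - 1) mod 4 = 0"
  shows "P v n (walk (Suc n) i t) = in_walk n (parent i) t"
proof -
  have j: "parent i \<in> comps n" using parent_comps i n by simp
  have "unique_onto_map (dverts v (Suc n) i, drel v (Suc n) i) (in_loop v n (parent i))
      (midpoint v (Suc n) i) (left_end v n (parent i)) (walk (Suc n) i t) = in_walk n (parent i) t"
    unfolding in_loop_def in_loop_verts left_end_eq
  proof (rule unique_onto_loop_map[where G = "in_walk n (parent i)", OF n i in_walk_cong in_walk_edge])
    fix \<tau> :: "int \<Rightarrow> nat list" and t
    assume e: "\<And>t. (\<tau> t, \<tau> (t + 1)) \<in> drel v n (parent i)"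
      and m: "\<And>t. \<tau> t \<in> range (in_walk n (parent i))" and z: "\<tau> 0 = in_walk n (parent i) 0"
    have "\<not> path_interior n (parent i) (\<tau> t)" for t using m[of t] in_walk_not_interior[OF n j] by auto
    then show "\<tau> t = in_walk n (parent i) t"
      using in_walk_unique[where \<tau> = \<tau>, OF n j subsetD[OF drel_Phi[OF n j] e] _ z] by simp
  qed assumption+
  then show ?thesis
    using r unfolding P_comp[OF n i] Pcomp_def parent_def by (auto simp: Let_def)
qed

lemma P_out:
  assumes n: "n \<ge> 2" and i: "i \<in> comps (Suc n)" and r: "(i - 1) mod 4 = 3"
  shows "P v n (walk (Suc n) i t) = out_walk n (parent i) t"
proof -
  have j: "parent i \<in> comps n" using parent_comps i n by simp
  have "unique_onto_map (dverts v (Suc n) i, drel v (Suc n) i) (out_loop v n (parent i))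
      (midpoint v (Suc n) i) (right_end v n (parent i)) (walk (Suc n) i t) = out_walk n (parent i) t"
    unfolding out_loop_def out_loop_verts right_end_eq
  proof (rule unique_onto_loop_map[where G = "out_walk n (parent i)", OF n i out_walk_cong out_walk_edge])
    fix \<tau> :: "int \<Rightarrow> nat list" and t
    assume e: "\<And>t. (\<tau> t, \<tau> (t + 1)) \<in> drel v n (parent i)"
      and m: "\<And>t. \<tau> t \<in> range (out_walk n (parent i))" and z: "\<tau> 0 = out_walk n (parent i) 0"
    have "\<not> path_interior n (parent i) (\<tau> t)" for t using m[of t] out_walk_not_interior[OF n j] by auto
    then show "\<tau> t = out_walk n (parent i) t"
      using out_walk_unique[where \<tau> = \<tau>, OF n j subsetD[OF drel_Phi[OF n j] e] _ z] by simp
  qed assumption+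
  then show ?thesis
    using r unfolding P_comp[OF n i] Pcomp_def parent_def by (auto simp: Let_def)
qed

lemma P_cases:
  assumes "n \<ge> 2" "i \<in> comps (Suc n)"
  obtains (mid) "\<And>t. P v n (walk (Suc n) i t) = walk n (parent i) t"
    | (inn) "\<And>t. P v n (walk (Suc n) i t) = in_walk n (parent i) t"
    | (out) "\<And>t. P v n (walk (Suc n) i t) = out_walk n (parent i) t"
proof -
  have "(i - 1) mod 4 < 4" by simp
  then consider "(i - 1) mod 4 = 1 \<or> (i - 1) mod 4 = 2" | "(i - 1) mod 4 = 0" | "(i - 1) mod 4 = 3"
    by linarith
  then show thesis
  proof cases
    case 1
    show thesis by (rule mid, rule P_mid[OF assms 1])
  next
    case 2
    show thesis by (rule inn, rule P_in[OF assms 2])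
  next
    case 3
    show thesis by (rule out, rule P_out[OF assms 3])
  qed
qed

section \<open>The Shimomura sequence\<close>

lemma J1: "J v 1 = {v 1 1 1}" and Phi1: "\<Phi> v 1 = {(v 1 1 1, v 1 1 1)}"
  by (simp_all add: J_def \<Phi>_def)

lemma P_edge:
  assumes n: "n \<ge> 2" and i: "i \<in> comps (Suc n)"
  shows "(P v n (walk (Suc n) i t), P v n (walk (Suc n) i (t + 1))) \<in> \<Phi> v n"
proof -
  have j: "parent i \<in> comps n" using parent_comps i n by simp
  show ?thesis
    by (rule P_cases[OF n i])
      (use walk_edge in_walk_edge out_walk_edge drel_Phi[OF n j] in auto)
qed

lemma surjective_Phi: "n \<ge> 1 \<Longrightarrow> surjective_rel (J v n) (\<Phi> v n)"
proof (cases "n = 1")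
  case True
  then show ?thesis using J1 Phi1 by (simp add: surjective_rel_def)
next
  case False
  assume "n \<ge> 1"
  then have n: "n \<ge> 2" using False by simp
  show ?thesis unfolding surjective_rel_def
  proof (intro conjI)
    show "\<Phi> v n \<subseteq> J v n \<times> J v n" unfolding J_eq[OF n] Phi_eq[OF n] by blast
    show "fst ` \<Phi> v n = J v n" unfolding J_eq[OF n] Phi_eq[OF n] by force
    show "snd ` \<Phi> v n = J v n"
    proof (intro equalityI subsetI)
      fix x assume "x \<in> J v n"
      then obtain i t where "i \<in> comps n" "x = walk n i t" unfolding J_eq[OF n] by blast
      then have "(walk n i (t - 1), x) \<in> \<Phi> v n" unfolding Phi_eq[OF n] by force
      then show "x \<in> snd ` \<Phi> v n" by force
    qed (unfold J_eq[OF n] Phi_eq[OF n], force)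
  qed
qed

lemma comps_nonempty: "1 \<in> comps n"
  by (simp add: comps_def)

lemma system_surj_P:
  assumes "n \<ge> 1"
  shows "system_surj (P v n) (J v (Suc n), \<Phi> v (Suc n)) (J v n, \<Phi> v n)"
proof -
  have edges: "map_prod (P v n) (P v n) ` \<Phi> v (Suc n) = \<Phi> v n"
  proof (cases "n = 1")
    case True
    have "(walk 2 1 0, walk 2 1 (0 + 1)) \<in> \<Phi> v 2" unfolding Phi_eq[OF order_refl] using comps_nonempty by blast
    then have "\<Phi> v 2 \<noteq> {}" by blast
    moreover have "map_prod (P v 1) (P v 1) = (\<lambda>e. (v 1 1 1, v 1 1 1))" by (auto simp: P_def)
    ultimately show ?thesis unfolding True using Phi1 by (simp add: numeral_2_eq_2 image_constant_conv)
  next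
    case False
    then have n: "n \<ge> 2" "Suc n \<ge> 2" using assms by auto
    show ?thesis
    proof (intro equalityI subsetI)
      fix e assume "e \<in> map_prod (P v n) (P v n) ` \<Phi> v (Suc n)"
      then show "e \<in> \<Phi> v n" unfolding Phi_eq[OF n(2)] using P_edge[OF n(1)] by auto
    next
      fix e assume "e \<in> \<Phi> v n"
      then obtain j t where j: "j \<in> comps n" "e = (walk n j t, walk n j (t + 1))"
        unfolding Phi_eq[OF n(1)] by blast
      let ?i = "4 * (j - 1) + 1 + 1"
      have i: "?i \<in> comps (Suc n)" "parent ?i = j" "(?i - 1) mod 4 = 1"
        using child_comps[OF assms j(1), of 1] by auto
      have "e = map_prod (P v n) (P v n) (walk (Suc n) ?i t, walk (Suc n) ?i (t + 1))"
        using P_mid[OF n(1) i(1)] i(2,3) j(2) by simp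
      moreover have "(walk (Suc n) ?i t, walk (Suc n) ?i (t + 1)) \<in> \<Phi> v (Suc n)"
        unfolding Phi_eq[OF n(2)] using i(1) by blast
      ultimately show "e \<in> map_prod (P v n) (P v n) ` \<Phi> v (Suc n)" by blast
    qed
  qed
  moreover have "P v n ` J v (Suc n) = J v n"
  proof -
    have "J v (Suc n) = fst ` \<Phi> v (Suc n)" using surjective_Phi[of "Suc n"] by (simp add: surjective_rel_def)
    then have "P v n ` J v (Suc n) = fst ` map_prod (P v n) (P v n) ` \<Phi> v (Suc n)"
      by (simp add: image_image)
    then show ?thesis using edges surjective_Phi[OF assms] by (simp add: surjective_rel_def)
  qed
  ultimately show ?thesis by (simp add: system_surj_def system_map_def)
qed

text \<open>Two different times at which the walk of level \<open>n + 1\<close> is at the same place lie at least \<open>2\<^bsup>n+1\<^esup>\<close> on the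
  same side of the midpoint.  One step more or less still leaves the images in the same loop of level
  \<open>n\<close>, where they are congruent.  This is why the two successors of a left end have the same
  image, and likewise the two predecessors of a right end.\<close>

lemma P_neighbours:
  assumes n: "n \<ge> 2" and i: "i \<in> comps (Suc n)" and st: "same_pos (loop (Suc n)) (half (Suc n)) s t"
    and c: "\<bar>c\<bar> \<le> 1"
  shows "P v n (walk (Suc n) i (s + c)) = P v n (walk (Suc n) i (t + c))"
proof -
  have j: "parent i \<in> comps n" using parent_comps i n by simp
  have "half (Suc n) - half n \<ge> 1" by simp
  then have sp: "same_pos (loop n) (half n) (s + c) (t + c)"
    using c by (intro same_pos_shift[OF st]) linarith+
  then have d: "loop n dvd (s + c) - (t + c)" by (rule same_pos_dvd)
  show ?thesis
    by (rule P_cases[OF n i])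
      (use walk_eq_iff[OF n j] sp in_walk_cong[OF d] out_walk_cong[OF d] in auto)
qed

lemma P_succ_unique:
  assumes n: "n \<ge> 1" and e: "(a, b) \<in> \<Phi> v (Suc n)" "(a, b') \<in> \<Phi> v (Suc n)"
  shows "P v n b = P v n b'"
proof (cases "n = 1")
  case False
  then have n2: "n \<ge> 2" "Suc n \<ge> 2" using n by auto
  obtain i s where i: "i \<in> comps (Suc n)" "a = walk (Suc n) i s" "b = walk (Suc n) i (s + 1)"
    using e(1) unfolding Phi_eq[OF n2(2)] by blast
  obtain t where "same_pos (loop (Suc n)) (half (Suc n)) s t" "b' = walk (Suc n) i (t + 1)"
    using edge_from_walk[OF n2(2) i(1)] e(2) i(2) by blast
  then show ?thesis using P_neighbours[OF n2(1) i(1), of s t 1] i(3) by simp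
qed (simp add: P_def)

lemma P_pred_unique:
  assumes n: "n \<ge> 1" and e: "(b, a) \<in> \<Phi> v (Suc n)" "(b', a) \<in> \<Phi> v (Suc n)"
  shows "P v n b = P v n b'"
proof (cases "n = 1")
  case False
  then have n2: "n \<ge> 2" "Suc n \<ge> 2" using n by auto
  obtain i s where i: "i \<in> comps (Suc n)" "b = walk (Suc n) i s" "a = walk (Suc n) i (s + 1)"
    using e(1) unfolding Phi_eq[OF n2(2)] by blast
  obtain t where "same_pos (loop (Suc n)) (half (Suc n)) (s + 1) t" "b' = walk (Suc n) i (t - 1)"
    using edge_to_walk[OF n2(2) i(1)] e(2) i(3) by blast
  then show ?thesis using P_neighbours[OF n2(1) i(1), of "s + 1" t "- 1"] i(2) by simp
qed (simp add: P_def)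

lemma shimomura_conditionI:
  assumes "\<And>n. n \<ge> 1 \<Longrightarrow> surjective_rel (I n) (\<phi> n)"
    and "\<And>n a b b'. n \<ge> 1 \<Longrightarrow> (a, b) \<in> \<phi> (Suc n) \<Longrightarrow> (a, b') \<in> \<phi> (Suc n) \<Longrightarrow> p n b = p n b'"
  shows "shimomura_condition I \<phi> p"
  unfolding shimomura_condition_def
proof (intro allI impI)
  fix n :: nat assume n: "n \<ge> 1"
  have "\<exists>!c. (a, c) \<in> {(a, bond p (Suc n) n b) |a b. (a, b) \<in> \<phi> (Suc n)}" if "a \<in> I (Suc n)" for a
  proof -
    have "a \<in> fst ` \<phi> (Suc n)" using assms(1)[of "Suc n"] that by (simp add: surjective_rel_def)
    then obtain b where "(a, b) \<in> \<phi> (Suc n)" by force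
    then show ?thesis using assms(2)[OF n] by (auto simp: bond_Suc)
  qed
  then show "\<exists>m>n. \<forall>a\<in>I m. \<exists>!c. (a, c) \<in> {(a, bond p m n b) |a b. (a, b) \<in> \<phi> m}"
    by (intro exI[of _ "Suc n"]) simp
qed

lemma shimomura_P: "shimomura_condition (J v) (\<Phi> v) (P v)"
  using surjective_Phi P_succ_unique by (intro shimomura_conditionI) blast+

lemma invertible_P: "invertible_seq (J v) (\<Phi> v) (P v)"
  unfolding invertible_seq_def
  using surjective_Phi surjective_rel_converse P_pred_unique by (intro shimomura_conditionI) blast+

lemma bifurcation_P: "bifurcation (J v) (P v)"
  unfolding bifurcation_def
proof (intro allI impI ballI)
  fix n x assume n: "n \<ge> 1" and x: "x \<in> J v n"
  have n2: "Suc n \<ge> 2" using n by simp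
  obtain i i' t where i: "i \<in> comps (Suc n)" "i' \<in> comps (Suc n)" "i \<noteq> i'"
      "P v n (walk (Suc n) i t) = x" "P v n (walk (Suc n) i' t) = x"
  proof (cases "n = 1")
    case True
    then show thesis using that[of 1 2 0] x by (auto simp: comps_def J_def P_def)
  next
    case False
    then have n': "n \<ge> 2" using n by simp
    obtain j t where j: "j \<in> comps n" "x = walk n j t" using x unfolding J_eq[OF n'] by blast
    let ?i = "4 * (j - 1) + 1 + 1" and ?i' = "4 * (j - 1) + 2 + 1"
    have c: "?i \<in> comps (Suc n)" "parent ?i = j" "(?i - 1) mod 4 = 1"
        "?i' \<in> comps (Suc n)" "parent ?i' = j" "(?i' - 1) mod 4 = 2"
      using child_comps[OF n j(1), of 1] child_comps[OF n j(1), of 2] by auto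
    have "P v n (walk (Suc n) ?i t) = x" using P_mid[OF n' c(1), of t] c(2,3) j(2) by simp
    moreover have "P v n (walk (Suc n) ?i' t) = x" using P_mid[OF n' c(4), of t] c(5,6) j(2) by simp
    ultimately show thesis using that[of ?i ?i' t] c(1,4) by simp
  qed
  have "walk (Suc n) i t \<noteq> walk (Suc n) i' t" using walk_comp_unique[OF n2 i(1,2)] i(3) by blast
  moreover have "walk (Suc n) i t \<in> J v (Suc n)" "walk (Suc n) i' t \<in> J v (Suc n)"
    using i(1,2) unfolding J_eq[OF n2] by blast+
  ultimately show "\<exists>m>n. \<exists>y1\<in>J v m. \<exists>y2\<in>J v m.
      y1 \<noteq> y2 \<and> bond (P v) m n y1 = x \<and> bond (P v) m n y2 = x"
    using i(4,5) by (intro exI[of _ "Suc n"]) (force simp: bond_Suc)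
qed

lemma J_tuples: "n \<ge> 1 \<Longrightarrow> J v n \<in> finite_tuple_sets"
  using labelling by (simp add: dumbbell_labelling_def)

lemma shimomura_sequence_P: "shimomura_sequence (J v) (\<Phi> v) (P v)"
  unfolding shimomura_sequence_def
  using J_tuples surjective_Phi system_surj_P bifurcation_P shimomura_P by blast

sublocale dumbbells: invertible_shimomura_system "J v" "P v" "\<Phi> v"
  using J_tuples surjective_Phi system_surj_P bifurcation_P shimomura_P invertible_P
  by unfold_locales (auto simp: finite_tuple_sets_def system_surj_def)

lemma pointed_J: "pointed (J v)"
  by (simp add: pointed_def J_def)

section \<open>The factoring property\<close>

lemma walk_shift_respects:
  assumes "2 \<le> n" "n \<le> m" "j \<in> comps n" "\<bar>c\<bar> \<le> half m - half n"
    and "same_pos (loop m) (half m) s t"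
  shows "walk n j (s + c) = walk n j (t + c)"
  using same_pos_shift[OF assms(5,2,4)] walk_eq_iff[OF assms(1,3)] by simp

lemma in_walk_respects:
  assumes "n \<le> m" "same_pos (loop m) (half m) s t"
  shows "in_walk n j (s + c) = in_walk n j (t + c)"
proof -
  have "loop n dvd s - t" using same_pos_dvd[OF assms(2)] loop_dvd[OF assms(1)] dvd_trans by blast
  then show ?thesis by (intro in_walk_cong) simp
qed

lemma out_walk_respects:
  assumes "n \<le> m" "same_pos (loop m) (half m) s t"
  shows "out_walk n j (s + c) = out_walk n j (t + c)"
proof -
  have "loop n dvd s - t" using same_pos_dvd[OF assms(2)] loop_dvd[OF assms(1)] dvd_trans by blast
  then show ?thesis by (intro out_walk_cong) simp
qed

lemma shifted_edges:
  assumes "2 \<le> n" "j \<in> comps n"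
  shows "(walk n j (t + c), walk n j (t + 1 + c)) \<in> \<Phi> v n"
    and "(in_walk n j (t + c), in_walk n j (t + 1 + c)) \<in> \<Phi> v n"
    and "(out_walk n j (t + c), out_walk n j (t + 1 + c)) \<in> \<Phi> v n"
proof -
  have e: "t + 1 + c = (t + c) + 1" by simp
  note sub = subsetD[OF drel_Phi[OF assms]]
  show "(walk n j (t + c), walk n j (t + 1 + c)) \<in> \<Phi> v n"
    unfolding e by (rule sub[OF walk_edge])
  show "(in_walk n j (t + c), in_walk n j (t + 1 + c)) \<in> \<Phi> v n"
    unfolding e by (rule sub[OF in_walk_edge])
  show "(out_walk n j (t + c), out_walk n j (t + 1 + c)) \<in> \<Phi> v n"
    unfolding e by (rule sub[OF out_walk_edge])
qed

text \<open>At an end of the path of level \<open>k\<close> the walk is where it also is at times arbitrarily far out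
  in the adjacent loop.  Those are sent into the corresponding loop of level \<open>n\<close> whatever \<open>c\<close> is, so the
  end of the path must be sent there too.\<close>

lemma crossing_shift_bound:
  assumes n: "2 \<le> n" and j: "j \<in> comps n"
    and \<tau>: "\<And>s t. same_pos (loop k) (half k) s t \<Longrightarrow> walk n j (s + c) = walk n j (t + c)"
  shows "\<bar>c\<bar> \<le> half k - half n"
proof -
  define M where "M = loop k * (\<bar>c\<bar> + half n + half k)"
  have "M \<ge> 1 * (\<bar>c\<bar> + half n + half k)"
    unfolding M_def by (rule mult_right_mono[OF loop_ge]) simp
  moreover have h: "half n > 0" "half k > 0" by simp_all
  ultimately have M: "M > 0" "M \<ge> \<bar>c\<bar> + half n + half k" by (smt (verit))+
  have "same_pos (loop k) (half k) (- half k) (- half k - M)"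
    using M(1) by (simp add: same_pos_def M_def)
  from walk_eq_iff[OF n j, THEN iffD1, OF \<tau>[OF this]]
  have 1: "- half k + c \<le> - half n" using M h unfolding same_pos_def by linarith
  have "same_pos (loop k) (half k) (half k) (half k + M)"
    using M(1) by (simp add: same_pos_def M_def)
  from walk_eq_iff[OF n j, THEN iffD1, OF \<tau>[OF this]]
  have 2: "half k + c \<ge> half n" using M h unfolding same_pos_def by linarith
  show ?thesis using 1 2 by linarith
qed

text \<open>A map that crosses \<open>j\<close> along a component wraps the loops of that component around the loops of
  \<open>j\<close>.  The new shift accounts for the different times at which the two paths are entered.\<close>

lemma crossing_on_in_walk:
  assumes q: "\<And>t. q (walk k C t) = walk n j (t + c)" and nk: "n \<le> k"
  shows "q (in_walk k C t) = in_walk n j (t + (c + half n - half k))"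
proof -
  obtain s where s: "s \<le> - half n - c" "loop k dvd (s + half k) - t" "in_walk k C t = walk k C s"
    using in_walk_as_walk[of "- half n - c" k t C] by blast
  have "q (in_walk k C t) = in_walk n j (s + c + half n)"
    using q[of s] s(1,3) walk_in[of "s + c" n j] by simp
  also have "\<dots> = in_walk n j (t + (c + half n - half k))"
    using dvd_trans[OF loop_dvd[OF nk] s(2)] by (intro in_walk_cong) (simp add: algebra_simps)
  finally show ?thesis .
qed

lemma crossing_on_out_walk:
  assumes q: "\<And>t. q (walk k C t) = walk n j (t + c)" and nk: "n \<le> k"
  shows "q (out_walk k C t) = out_walk n j (t + (c - half n + half k))"
proof -
  obtain s where s: "s \<ge> half n - c" "loop k dvd (s - half k) - t" "out_walk k C t = walk k C s"
    using out_walk_as_walk[of "half n - c" k t C] by blast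
  have "q (out_walk k C t) = out_walk n j (s + c - half n)"
    using q[of s] s(1,3) walk_out[of n "s + c" j] by simp
  also have "\<dots> = out_walk n j (t + (c - half n + half k))"
    using dvd_trans[OF loop_dvd[OF nk] s(2)] by (intro out_walk_cong) (simp add: algebra_simps)
  finally show ?thesis .
qed

text \<open>Here \<open>G\<close> stands for \<open>in_walk n j\<close> or \<open>out_walk n j\<close>: a map that sends a whole component
  around one loop sends both loops of the component around it.\<close>

lemma walk_around_loop:
  assumes q: "\<And>t. q (walk k C t) = G (t + c)" and nk: "n \<le> k"
    and G: "\<And>s t. loop n dvd s - t \<Longrightarrow> G s = G t"
  shows "q (in_walk k C t) = G (t + (c - half k))" "q (out_walk k C t) = G (t + (c + half k))"
proof -
  obtain s where s: "loop k dvd (s + half k) - t" "in_walk k C t = walk k C s"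
    using in_walk_as_walk[of 0 k t C] by blast
  have "G (s + c) = G (t + (c - half k))"
    by (rule G) (use dvd_trans[OF loop_dvd[OF nk] s(1)] in \<open>simp add: algebra_simps\<close>)
  then show "q (in_walk k C t) = G (t + (c - half k))" using q[of s] s(2) by simp
next
  obtain s where s: "loop k dvd (s - half k) - t" "out_walk k C t = walk k C s"
    using out_walk_as_walk[of 0 k t C] by blast
  have "G (s + c) = G (t + (c + half k))"
    by (rule G) (use dvd_trans[OF loop_dvd[OF nk] s(1)] in \<open>simp add: algebra_simps\<close>)
  then show "q (out_walk k C t) = G (t + (c + half k))" using q[of s] s(2) by simp
qed

text \<open>A composite of bonding maps that crosses a dumbbell takes midpoint to midpoint, so no shift
  occurs in this case.  A component that has been sent into a loop stays in a loop at all lower levels.\<close>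

lemma bond_on_walk:
  assumes n: "2 \<le> n" and nm: "n \<le> m" and i: "i \<in> comps m"
  obtains (mid) j where "j \<in> comps n" "\<And>t. bond (P v) m n (walk m i t) = walk n j t"
    | (inn) j c where "j \<in> comps n" "\<And>t. bond (P v) m n (walk m i t) = in_walk n j (t + c)"
    | (out) j c where "j \<in> comps n" "\<And>t. bond (P v) m n (walk m i t) = out_walk n j (t + c)"
proof -
  have "(\<exists>j\<in>comps n. \<forall>t. bond (P v) m n (walk m i t) = walk n j t) \<or>
      (\<exists>j\<in>comps n. \<exists>c. \<forall>t. bond (P v) m n (walk m i t) = in_walk n j (t + c)) \<or>
      (\<exists>j\<in>comps n. \<exists>c. \<forall>t. bond (P v) m n (walk m i t) = out_walk n j (t + c))"
    using nm i
  proof (induction m arbitrary: i rule: dec_induct)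
    case base
    then show ?case by auto
  next
    case (step m)
    have m: "2 \<le> m" "n \<le> m" using n step.hyps by auto
    let ?b = "bond (P v) m n" and ?i = "parent i"
    have "?i \<in> comps m" using parent_comps step.prems m(1) by simp
    note IH = step.IH[OF this]
    have b: "bond (P v) (Suc m) n x = ?b (P v m x)" for x using m(2) by (simp add: bond_Suc)
    show ?case
    proof (rule P_cases[OF m(1) step.prems])
      assume "\<And>t. P v m (walk (Suc m) i t) = walk m ?i t"
      then show ?thesis unfolding b using IH by simp
    next
      assume *: "\<And>t. P v m (walk (Suc m) i t) = in_walk m ?i t"
      from IH show ?thesis
      proof (elim disjE bexE exE)
        fix j assume j: "j \<in> comps n" "\<forall>t. ?b (walk m ?i t) = walk n j t"
        have "?b (walk m ?i t) = walk n j (t + 0)" for t using j(2) by simp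
        from crossing_on_in_walk[OF this m(2)] show ?thesis using j(1) unfolding b * by blast
      next
        fix j c assume j: "j \<in> comps n" and c: "\<forall>t. ?b (walk m ?i t) = in_walk n j (t + c)"
        from walk_around_loop(1)[where G = "in_walk n j", OF c[rule_format] m(2) in_walk_cong]
          show ?thesis using j unfolding b * by blast
      next
        fix j c assume j: "j \<in> comps n" and c: "\<forall>t. ?b (walk m ?i t) = out_walk n j (t + c)"
        from walk_around_loop(1)[where G = "out_walk n j", OF c[rule_format] m(2) out_walk_cong]
          show ?thesis using j unfolding b * by blast
      qed
    next
      assume *: "\<And>t. P v m (walk (Suc m) i t) = out_walk m ?i t"
      from IH show ?thesis
      proof (elim disjE bexE exE)
        fix j assume j: "j \<in> comps n" "\<forall>t. ?b (walk m ?i t) = walk n j t"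
        have "?b (walk m ?i t) = walk n j (t + 0)" for t using j(2) by simp
        from crossing_on_out_walk[OF this m(2)] show ?thesis using j(1) unfolding b * by blast
      next
        fix j c assume j: "j \<in> comps n" and c: "\<forall>t. ?b (walk m ?i t) = in_walk n j (t + c)"
        from walk_around_loop(2)[where G = "in_walk n j", OF c[rule_format] m(2) in_walk_cong]
          show ?thesis using j unfolding b * by blast
      next
        fix j c assume j: "j \<in> comps n" and c: "\<forall>t. ?b (walk m ?i t) = out_walk n j (t + c)"
        from walk_around_loop(2)[where G = "out_walk n j", OF c[rule_format] m(2) out_walk_cong]
          show ?thesis using j unfolding b * by blast
      qed
    qed
  qed
  then show thesis using mid inn out by blast
qed

text \<open>Each component has two children that are mapped across it, namely those with residue 1 and 2;
  \<open>descendant i d x\<close> follows \<open>d\<close> generations of them, directed by the binary digits of \<open>x\<close>.\<close>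

primrec descendant :: "nat \<Rightarrow> nat \<Rightarrow> nat \<Rightarrow> nat" where
  "descendant i 0 x = i"
| "descendant i (Suc d) x = 4 * (descendant i d (x div 2) - 1) + (1 + x mod 2) + 1"

lemma descendant_comps:
  assumes l: "l \<ge> 2" and i: "i \<in> comps l"
  shows "descendant i d x \<in> comps (l + d)"
proof (induction d arbitrary: x)
  case (Suc d)
  then show ?case using child_comps(1)[of "l + d" "descendant i d (x div 2)" "1 + x mod 2"] l by simp
qed (simp add: i)

lemma bond_descendant:
  assumes l: "l \<ge> 2" "n \<le> l" and i: "i \<in> comps l"
  shows "bond (P v) (l + d) n (walk (l + d) (descendant i d x) t) = bond (P v) l n (walk l i t)"
proof (induction d arbitrary: x)
  case (Suc d)
  have c: "descendant i d (x div 2) \<in> comps (l + d)" by (rule descendant_comps[OF l(1) i])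
  have r: "1 + x mod 2 < 4" "1 + x mod 2 = 1 \<or> 1 + x mod 2 = 2" by auto
  have ld: "1 \<le> l + d" "2 \<le> l + d" using l(1) by simp_all
  note cc = child_comps[OF ld(1) c r(1)]
  have "P v (l + d) (walk (Suc (l + d)) (descendant i (Suc d) x) t) = walk (l + d) (descendant i d (x div 2)) t"
    using P_mid[OF ld(2) cc(1), of t] r(2) unfolding cc(2,3) descendant.simps(2) by blast
  then show ?case using Suc.IH[of "x div 2"] l(2) by (simp add: bond_Suc del: descendant.simps)
qed simp

text \<open>The digits can be read off from the descendant whatever the ancestor; hence descendants with
  different digits are different even if their ancestors differ.\<close>

lemma descendant_inj:
  assumes "descendant i d x = descendant i' d y" "x < 2 ^ d" "y < 2 ^ d" "i \<ge> 1" "i' \<ge> 1"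
  shows "x = y"
  using assms(1-3)
proof (induction d arbitrary: x y)
  case (Suc d)
  have ge: "descendant i e z \<ge> 1" "descendant i' e z \<ge> 1" for e z using assms(4,5) by (cases e; simp)+
  have e: "4 * (descendant i d (x div 2) - 1) + x mod 2 = 4 * (descendant i' d (y div 2) - 1) + y mod 2"
    using Suc.prems(1) by simp
  have digits: "u = w \<and> A = A'" if "4 * A + u = 4 * A' + w" "u < 2" "w < 2" for A A' u w :: nat
    using that by presburger
  have *: "x mod 2 = y mod 2" "descendant i d (x div 2) - 1 = descendant i' d (y div 2) - 1"
    using digits[OF e] by simp_all
  have "descendant i d (x div 2) = descendant i' d (y div 2)"
    using *(2) ge(1)[of d "x div 2"] ge(2)[of d "y div 2"] by linarith
  then have "x div 2 = y div 2" using Suc.IH[of "x div 2" "y div 2"] Suc.prems by simp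
  then show ?case using *(1) by (metis div_mult_mod_eq)
qed simp

text \<open>The map \<open>q\<^sub>1\<close> acts on each component \<open>C\<close> of level \<open>k\<close> as a crossing or as a walk around a loop,
  shifted in time.  Level \<open>n + 1\<close> has a component on which the bonding map does the same without
  the shift, and a descendant \<open>\<rho> C\<close> of it at level \<open>m\<close> is sent onto \<open>C\<close> by the walk on \<open>C\<close> with a
  shift that compensates.  These descendants are made pairwise distinct, so that \<open>q\<^sub>2\<close> is onto.  The other
  components of level \<open>m\<close> are sent to some \<open>C\<close> that \<open>q\<^sub>1\<close> maps across the right dumbbell of level
  \<open>n\<close>; at least one exists because \<open>q\<^sub>1\<close> hits the midpoint.\<close>

lemma factoring_P: "factoring_property (J v) (\<Phi> v) (P v)"
  unfolding factoring_property_def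
proof (intro allI impI)
  fix n k :: nat and q1
  assume n1: "n \<ge> 1" and nk: "k > n" and q1: "system_surj q1 (J v k, \<Phi> v k) (J v n, \<Phi> v n)"
  show "\<exists>m>k. \<exists>q2. system_surj q2 (J v m, \<Phi> v m) (J v k, \<Phi> v k)
      \<and> (\<forall>x\<in>J v m. q1 (q2 x) = bond (P v) m n x)"
  proof (cases "n = 1")
    case True
    have k: "k \<ge> 1" using nk by simp
    have bJ: "bond (P v) m 1 x \<in> J v 1" if "x \<in> J v m" "m \<ge> 1" for m x
      using that(2,1)
    proof (induction m arbitrary: x rule: dec_induct)
      case (step m)
      then show ?case using dumbbells.step_surj[of m] by (auto simp: bond_Suc)
    qed simp
    have "q1 (P v k x) = bond (P v) (Suc k) n x" if x: "x \<in> J v (Suc k)" for x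
    proof -
      have "P v k x \<in> J v k" using dumbbells.step_surj[OF k] x by blast
      then have "q1 (P v k x) \<in> J v 1" using q1 True by (auto simp: system_surj_def)
      then show ?thesis using bJ[OF x] True J1 by auto
    qed
    then show ?thesis using system_surj_P[OF k] by (intro exI[of _ "Suc k"] exI[of _ "P v k"]) auto
  next
    case False
    then have n: "n \<ge> 2" and k: "k \<ge> 2" and nk': "n \<le> k" using n1 nk by auto
    \<comment> \<open>The summand \<open>2 * k\<close> provides a descendant for each of the \<open>4\<^bsup>k-1\<^esup>\<close> components of level \<open>k\<close>, and
      \<open>fact n\<close> makes the paths long enough for shifts by a full loop of level \<open>n\<close>.\<close>
    define d where "d = 2 * k + fact n"
    define m where "m = Suc n + d"
    have m: "m \<ge> 2" "k < m" "k \<le> m" "n \<le> m" using n by (auto simp: m_def d_def)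
    have room: "loop n \<le> half m - half k" "half k \<le> half m - half k"
    proof -
      have "half k * (loop n + 1) \<le> half k * half (fact n)"
        using of_nat_less_two_power[of "fact n", where ?'a = int] by (intro mult_left_mono) simp_all
      also have "\<dots> = half (k + fact n)" by (simp add: power_add)
      also have "\<dots> \<le> half m" by (rule half_mono) (simp add: m_def d_def)
      finally have "half k * loop n + half k \<le> half m" by (simp add: distrib_left)
      moreover have "1 * loop n \<le> half k * loop n"
        using loop_ge[of n] by (intro mult_right_mono) simp_all
      moreover have "half k * 1 \<le> half k * loop n"
        using loop_ge[of n] by (intro mult_left_mono) simp_all
      ultimately show "loop n \<le> half m - half k" "half k \<le> half m - half k" by linarith+
    qed
    have q1edge: "(q1 (walk k C t), q1 (walk k C (t + 1))) \<in> \<Phi> v n" if "C \<in> comps k" for C t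
    proof -
      have "(walk k C t, walk k C (t + 1)) \<in> \<Phi> v k" unfolding Phi_eq[OF k] using that by blast
      then have "map_prod q1 q1 (walk k C t, walk k C (t + 1)) \<in> map_prod q1 q1 ` \<Phi> v k" by (rule imageI)
      then show ?thesis using q1 by (simp add: system_surj_def)
    qed
    have q1same: "q1 (walk k C s) = q1 (walk k C t)"
      if "C \<in> comps k" "same_pos (loop k) (half k) s t" for C s t
      using walk_eq_iff[OF k that(1), THEN iffD2, OF that(2)] by (rule arg_cong)
    have base: "\<exists>i c. i \<in> comps (Suc n) \<and> \<bar>c\<bar> \<le> half m - half k \<and>
        (\<forall>t. q1 (walk k C (t + c)) = P v n (walk (Suc n) i t))" if C: "C \<in> comps k" for C
    proof (rule walk_classification[of n "\<lambda>t. q1 (walk k C t)", OF n q1edge[OF C]])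
      fix j c assume j: "j \<in> comps n" and c: "\<And>t. q1 (walk k C t) = walk n j (t + c)"
      let ?i = "4 * (j - 1) + 1 + 1"
      have i: "?i \<in> comps (Suc n)" "parent ?i = j" "(?i - 1) mod 4 = 1"
        using child_comps[OF n1 j, of 1] by auto
      have "\<bar>c\<bar> \<le> half k - half n"
        by (rule crossing_shift_bound[OF n j]) (use q1same[OF C] c in metis)
      then have "\<bar>- c\<bar> \<le> half m - half k" using room(2) half_ge[of n] unfolding abs_minus_cancel by linarith
      moreover have "q1 (walk k C (t + - c)) = P v n (walk (Suc n) ?i t)" for t
        using c[of "t + - c"] P_mid[OF n i(1), of t] i(2,3) by simp
      ultimately show ?thesis using i(1) by blast
    next
      fix j c assume j: "j \<in> comps n" and c: "\<And>t. q1 (walk k C t) = in_walk n j (t + c)"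
      let ?i = "4 * (j - 1) + 0 + 1"
      have i: "?i \<in> comps (Suc n)" "parent ?i = j" "(?i - 1) mod 4 = 0"
        using child_comps[OF n1 j, of 0] by auto
      have "0 \<le> (- c) mod loop n" "(- c) mod loop n < loop n" using loop_ge[of n] by simp_all
      then have "\<bar>(- c) mod loop n\<bar> \<le> half m - half k" using room(1) by linarith
      moreover have "q1 (walk k C (t + (- c) mod loop n)) = P v n (walk (Suc n) ?i t)" for t
      proof -
        have "loop n dvd (- c) mod loop n - (- c)" by (rule mod_eq_dvd_iff[THEN iffD1]) simp
        then have "in_walk n j (t + (- c) mod loop n + c) = in_walk n j t"
          by (intro in_walk_cong) (simp add: algebra_simps)
        then show ?thesis using c[of "t + (- c) mod loop n"] P_in[OF n i(1,3), of t] i(2) by simp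
      qed
      ultimately show ?thesis using i(1) by blast
    next
      fix j c assume j: "j \<in> comps n" and c: "\<And>t. q1 (walk k C t) = out_walk n j (t + c)"
      let ?i = "4 * (j - 1) + 3 + 1"
      have i: "?i \<in> comps (Suc n)" "parent ?i = j" "(?i - 1) mod 4 = 3"
        using child_comps[OF n1 j, of 3] by auto
      have "0 \<le> (- c) mod loop n" "(- c) mod loop n < loop n" using loop_ge[of n] by simp_all
      then have "\<bar>(- c) mod loop n\<bar> \<le> half m - half k" using room(1) by linarith
      moreover have "q1 (walk k C (t + (- c) mod loop n)) = P v n (walk (Suc n) ?i t)" for t
      proof -
        have "loop n dvd (- c) mod loop n - (- c)" by (rule mod_eq_dvd_iff[THEN iffD1]) simp
        then have "out_walk n j (t + (- c) mod loop n + c) = out_walk n j t"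
          by (intro out_walk_cong) (simp add: algebra_simps)
        then show ?thesis using c[of "t + (- c) mod loop n"] P_out[OF n i(1,3), of t] i(2) by simp
      qed
      ultimately show ?thesis using i(1) by blast
    qed
    then obtain base shift where bs: "\<And>C. C \<in> comps k \<Longrightarrow> base C \<in> comps (Suc n)"
        "\<And>C. C \<in> comps k \<Longrightarrow> \<bar>shift C\<bar> \<le> half m - half k"
        "\<And>C t. C \<in> comps k \<Longrightarrow> q1 (walk k C (t + shift C)) = P v n (walk (Suc n) (base C) t)"
      by metis
    define \<rho> where "\<rho> C = descendant (base C) d (C - 1)" for C
    have \<rho>: "\<rho> C \<in> comps m" if "C \<in> comps k" for C
      unfolding \<rho>_def m_def by (rule descendant_comps) (use n bs(1)[OF that] in auto)
    have \<rho>bond: "bond (P v) m n (walk m (\<rho> C) t) = q1 (walk k C (t + shift C))" if "C \<in> comps k" for C t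
      using bond_descendant[of "Suc n" n "base C" d "C - 1" t] bs(1,3)[OF that] n
      unfolding \<rho>_def m_def by (simp add: bond_Suc)
    have \<rho>inj: "C = C'" if "C \<in> comps k" "C' \<in> comps k" "\<rho> C = \<rho> C'" for C C'
    proof -
      have "(4::nat) ^ (k - 1) \<le> 4 ^ k" by (intro power_increasing) auto
      also have "\<dots> = 2 ^ (2 * k)" by (simp add: power_mult)
      also have "\<dots> \<le> 2 ^ d" by (intro power_increasing) (auto simp: d_def)
      finally have "C - 1 < 2 ^ d" "C' - 1 < 2 ^ d" "C \<ge> 1" "C' \<ge> 1"
        using that(1,2) by (auto simp: comps_def)
      moreover have "base C \<ge> 1" "base C' \<ge> 1" using bs(1) that(1,2) by (auto simp: comps_def)
      ultimately show ?thesis using descendant_inj[of "base C" d "C - 1" "base C'" "C' - 1"] that(3)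
        unfolding \<rho>_def by linarith
    qed
    have cross: "\<exists>C c. C \<in> comps k \<and> (\<forall>t. q1 (walk k C t) = walk n j (t + c))" if j: "j \<in> comps n" for j
    proof -
      have "walk n j 0 \<in> J v n" unfolding J_eq[OF n] using j by blast
      then have "walk n j 0 \<in> q1 ` J v k" using q1 by (simp add: system_surj_def)
      then obtain C t0 where C: "C \<in> comps k" "q1 (walk k C t0) = walk n j 0"
        unfolding J_eq[OF k] by auto
      have "q1 (walk k C t) = walk n j (t + (- t0))" for t
        using walk_through_interior[of n j "\<lambda>t. q1 (walk k C t)" t0 0 t, OF n j q1edge[OF C(1)] C(2)] by simp
      then show ?thesis using C(1) by blast
    qed
    have "\<exists>F. (\<forall>s t. same_pos (loop m) (half m) s t \<longrightarrow> F s = F t)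
        \<and> (\<forall>t. (F t, F (t + 1)) \<in> \<Phi> v k)
        \<and> (\<forall>t. q1 (F t) = bond (P v) m n (walk m D t))
        \<and> (\<forall>C\<in>comps k. D = \<rho> C \<longrightarrow> (\<forall>t. F t = walk k C (t + shift C)))"
      (is "\<exists>F. ?R F \<and> ?E F \<and> ?B F \<and> ?C F") if D: "D \<in> comps m" for D
    proof (cases "\<exists>C\<in>comps k. D = \<rho> C")
      case True
      then obtain C where C: "C \<in> comps k" "D = \<rho> C" by blast
      let ?F = "\<lambda>t. walk k C (t + shift C)"
      have "?R ?F" using walk_shift_respects[OF k m(3) C(1) bs(2)[OF C(1)]] by blast
      moreover have "?E ?F" using shifted_edges(1)[OF k C(1)] by blast
      moreover have "?B ?F" using \<rho>bond[OF C(1)] C(2) by simp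
      moreover have "?C ?F" using \<rho>inj C by blast
      ultimately have "?R ?F \<and> ?E ?F \<and> ?B ?F \<and> ?C ?F" by (intro conjI)
      then show ?thesis by (rule exI[of _ ?F])
    next
      case False
      then have vac: "?C F" for F by blast
      show ?thesis
      proof (rule bond_on_walk[OF n m(4) D])
        fix j assume j: "j \<in> comps n" and b: "\<And>t. bond (P v) m n (walk m D t) = walk n j t"
        obtain C c where C: "C \<in> comps k" and c: "\<And>t. q1 (walk k C t) = walk n j (t + c)"
          using cross[OF j] by blast
        let ?F = "\<lambda>t. walk k C (t + - c)"
        have "\<bar>c\<bar> \<le> half k - half n"
          by (rule crossing_shift_bound[OF n j]) (use q1same[OF C] c in metis)
        then have "\<bar>- c\<bar> \<le> half m - half k" using room(2) half_ge[of n] unfolding abs_minus_cancel by linarith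
        then have "?R ?F" using walk_shift_respects[OF k m(3) C] by blast
        moreover have "?E ?F" using shifted_edges(1)[OF k C] by blast
        moreover have "?B ?F" using b c by simp
        ultimately have "?R ?F \<and> ?E ?F \<and> ?B ?F \<and> ?C ?F" using vac[of ?F] by (intro conjI)
        then show ?thesis by (rule exI[of _ ?F])
      next
        fix j c' assume j: "j \<in> comps n" and b: "\<And>t. bond (P v) m n (walk m D t) = in_walk n j (t + c')"
        obtain C c where C: "C \<in> comps k" and c: "\<And>t. q1 (walk k C t) = walk n j (t + c)"
          using cross[OF j] by blast
        \<comment> \<open>The in-loop of \<open>C\<close> suffices as image, since \<open>D\<close> need not be sent onto a component.\<close>
        let ?s = "c' - (c + half n - half k)"
        let ?F = "\<lambda>t. in_walk k C (t + ?s)"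
        have "?R ?F" using in_walk_respects[OF m(3)] by blast
        moreover have "?E ?F" using shifted_edges(2)[OF k C] by blast
        moreover have "?B ?F" using b crossing_on_in_walk[OF c nk'] by (simp add: algebra_simps)
        ultimately have "?R ?F \<and> ?E ?F \<and> ?B ?F \<and> ?C ?F" using vac[of ?F] by (intro conjI)
        then show ?thesis by (rule exI[of _ ?F])
      next
        fix j c' assume j: "j \<in> comps n" and b: "\<And>t. bond (P v) m n (walk m D t) = out_walk n j (t + c')"
        obtain C c where C: "C \<in> comps k" and c: "\<And>t. q1 (walk k C t) = walk n j (t + c)"
          using cross[OF j] by blast
        let ?s = "c' - (c - half n + half k)"
        let ?F = "\<lambda>t. out_walk k C (t + ?s)"
        have "?R ?F" using out_walk_respects[OF m(3)] by blast
        moreover have "?E ?F" using shifted_edges(3)[OF k C] by blast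
        moreover have "?B ?F" using b crossing_on_out_walk[OF c nk'] by (simp add: algebra_simps)
        ultimately have "?R ?F \<and> ?E ?F \<and> ?B ?F \<and> ?C ?F" using vac[of ?F] by (intro conjI)
        then show ?thesis by (rule exI[of _ ?F])
      qed
    qed
    then have "\<forall>D\<in>comps m. \<exists>F. (\<forall>s t. same_pos (loop m) (half m) s t \<longrightarrow> F s = F t)
        \<and> (\<forall>t. (F t, F (t + 1)) \<in> \<Phi> v k)
        \<and> (\<forall>t. q1 (F t) = bond (P v) m n (walk m D t))
        \<and> (\<forall>C\<in>comps k. D = \<rho> C \<longrightarrow> (\<forall>t. F t = walk k C (t + shift C)))"
      by (rule ballI)
    from bchoice[OF this] obtain F where
      "\<forall>D\<in>comps m. (\<forall>s t. same_pos (loop m) (half m) s t \<longrightarrow> F D s = F D t)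
        \<and> (\<forall>t. (F D t, F D (t + 1)) \<in> \<Phi> v k)
        \<and> (\<forall>t. q1 (F D t) = bond (P v) m n (walk m D t))
        \<and> (\<forall>C\<in>comps k. D = \<rho> C \<longrightarrow> (\<forall>t. F D t = walk k C (t + shift C)))"
      by (rule exE)
    note F0 = bspec[OF this]
    have F: "F D s = F D t" if "D \<in> comps m" "same_pos (loop m) (half m) s t" for D s t
      using F0[OF that(1)] that(2) by blast
    have F': "(F D t, F D (t + 1)) \<in> \<Phi> v k" "q1 (F D t) = bond (P v) m n (walk m D t)"
      if "D \<in> comps m" for D t
      using F0[OF that] by blast+
    have F\<rho>: "F (\<rho> C) t = walk k C (t + shift C)" if "C \<in> comps k" for C t
      using F0[OF \<rho>[OF that]] that by blast
    obtain q2 where q2: "\<And>D t. D \<in> comps m \<Longrightarrow> q2 (walk m D t) = F D t"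
      by (rule map_from_walks[OF m(1), of F], rule F, assumption+, blast)
    have onto: "q2 (walk m (\<rho> C) (t - shift C)) = walk k C t" if "C \<in> comps k" for C t
      using q2[OF \<rho>[OF that]] F\<rho>[OF that] by simp
    have edges: "map_prod q2 q2 ` \<Phi> v m = \<Phi> v k"
    proof (intro equalityI subsetI)
      fix e assume "e \<in> map_prod q2 q2 ` \<Phi> v m"
      then show "e \<in> \<Phi> v k" unfolding Phi_eq[OF m(1)] using q2 F'(1) by auto
    next
      fix e assume "e \<in> \<Phi> v k"
      then obtain C t where C: "C \<in> comps k" "e = (walk k C t, walk k C (t + 1))"
        unfolding Phi_eq[OF k] by blast
      have "e = map_prod q2 q2 (walk m (\<rho> C) (t - shift C), walk m (\<rho> C) (t - shift C + 1))"
        using onto[OF C(1), of t] onto[OF C(1), of "t + 1"] C(2) by (simp add: algebra_simps)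
      moreover have "(walk m (\<rho> C) (t - shift C), walk m (\<rho> C) (t - shift C + 1)) \<in> \<Phi> v m"
        unfolding Phi_eq[OF m(1)] using \<rho>[OF C(1)] by blast
      ultimately show "e \<in> map_prod q2 q2 ` \<Phi> v m" by blast
    qed
    have "q2 ` J v m = J v k"
    proof -
      have "fst ` \<Phi> v m = J v m" "fst ` \<Phi> v k = J v k"
        using surjective_Phi[of m] surjective_Phi[of k] m(1) k by (auto simp: surjective_rel_def)
      then have "q2 ` J v m = fst ` map_prod q2 q2 ` \<Phi> v m" by (metis (no_types) fst_comp_map_prod image_comp)
      then show ?thesis using edges \<open>fst ` \<Phi> v k = J v k\<close> by simp
    qed
    then have "system_surj q2 (J v m, \<Phi> v m) (J v k, \<Phi> v k)"
      using edges by (simp add: system_surj_def system_map_def)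
    moreover have "q1 (q2 x) = bond (P v) m n x" if "x \<in> J v m" for x
      using that q2 F'(2) unfolding J_eq[OF m(1)] by auto
    ultimately show ?thesis using m(2) by blast
  qed
qed

section \<open>Every finite surjective relation is covered by dumbbells\<close>

text \<open>Choose a successor map \<open>s\<close> and a predecessor map \<open>r\<close> inside \<open>R\<close>.  For each point \<open>b\<close> of \<open>B\<close> a
  component is sent along the path \<open>\<dots>, r(b), b, s(b), \<dots>\<close> with the midpoint at \<open>b\<close>.  This path is
  periodic from time \<open>\<plusminus>card B\<close> on, which comes before the ends \<open>\<plusminus>2\<^bsup>m\<^esup>\<close> of the connecting path.\<close>

lemma levels_cover_relations:
  assumes B: "finite B" "B \<noteq> {}" and R: "surjective_rel B R"
  shows "\<exists>m\<ge>1. \<exists>q. q ` J v m = B \<and> map_prod q q ` \<Phi> v m \<subseteq> R"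
proof -
  define m where "m = card B + 2"
  have m: "m \<ge> 2" "m \<ge> 1" "card B \<le> m" by (auto simp: m_def)
  have "\<exists>s. \<forall>x\<in>B. (x, s x) \<in> R \<and> s x \<in> B" "\<exists>r. \<forall>x\<in>B. (r x, x) \<in> R \<and> r x \<in> B"
    using R unfolding surjective_rel_def by (intro bchoice ballI; force)+
  then obtain s r where s: "\<And>x. x \<in> B \<Longrightarrow> (x, s x) \<in> R" "\<And>x. x \<in> B \<Longrightarrow> s x \<in> B"
    and r: "\<And>x. x \<in> B \<Longrightarrow> (r x, x) \<in> R" "\<And>x. x \<in> B \<Longrightarrow> r x \<in> B" by blast
  obtain e where e: "bij_betw e {0..<card B} B" using ex_bij_betw_nat_finite[OF B(1)] by blast
  have cB: "card B > 0" using B by (simp add: card_gt_0_iff)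
  define b where "b i = e (if i - 1 < card B then i - 1 else 0)" for i
  have bB: "b i \<in> B" for i using e cB by (auto simp: b_def bij_betw_def)
  have b_onto: "\<exists>i\<in>comps m. b i = x" if "x \<in> B" for x
  proof -
    have "x \<in> e ` {0..<card B}" using e that by (simp add: bij_betw_def)
    then obtain i where i: "i < card B" "e i = x" by auto
    have "card B < 2 ^ card B" by (rule less_exp)
    also have "\<dots> \<le> (4::nat) ^ card B" by (rule power_mono) auto
    also have "\<dots> \<le> 4 ^ (m - 1)" by (rule power_increasing) (auto simp: m_def)
    finally have "Suc i \<in> comps m" using i(1) by (simp add: comps_def)
    moreover have "b (Suc i) = x" using i by (simp add: b_def)
    ultimately show ?thesis by blast
  qed
  define F where "F i t = (if t \<ge> 0 then (s ^^ nat t) (b i) else (r ^^ nat (- t)) (b i))" for i and t :: int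
  have sB: "(s ^^ l) (b i) \<in> B" and rB: "(r ^^ l) (b i) \<in> B" for l i
    by (induction l) (use bB s(2) r(2) in auto)
  have FB: "F i t \<in> B" for i t using sB rB by (simp add: F_def)
  have Fedge: "(F i t, F i (t + 1)) \<in> R" for i t
  proof -
    consider "t \<ge> 0" | "t < 0" by linarith
    then show ?thesis
    proof cases
      case 1
      then have "nat (t + 1) = Suc (nat t)" by simp
      then show ?thesis using 1 s(1)[OF sB[of "nat t" i]] by (simp add: F_def)
    next
      case 2
      then have "nat (- t) = Suc (nat (- (t + 1)))" by simp
      moreover have "F i (t + 1) = (r ^^ nat (- (t + 1))) (b i)" using 2 by (auto simp: F_def)
      ultimately show ?thesis using 2 r(1)[OF rB[of "nat (- (t + 1))" i]] by (simp add: F_def)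
    qed
  qed
  have "int m \<le> half m" using of_nat_less_two_power[of m, where ?'a = int] by simp
  have Fsame: "F i x = F i y" if "same_pos (loop m) (half m) x y" for i x y
  proof -
    consider "x = y" | "x \<le> - half m" "y \<le> - half m" "loop m dvd x - y"
      | "x \<ge> half m" "y \<ge> half m" "loop m dvd x - y"
      using \<open>same_pos (loop m) (half m) x y\<close> unfolding same_pos_def by blast
    then show ?thesis
    proof cases
      case 2
      then have l: "int m \<le> - x" "int m \<le> - y" using \<open>int m \<le> half m\<close> by linarith+
      have "loop m dvd - (x - y)" using 2(3) by (simp only: dvd_minus_iff)
      then have "(r ^^ nat (- x)) (b i) = (r ^^ nat (- y)) (b i)"
        using l by (intro funpow_eventually_periodic[OF B(1) bB r(2) m(3)]) auto
      moreover have "\<not> 0 \<le> x" "\<not> 0 \<le> y" using l m(1) by linarith+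
      ultimately show ?thesis by (simp add: F_def)
    next
      case 3
      then have l: "int m \<le> x" "int m \<le> y" using \<open>int m \<le> half m\<close> by linarith+
      then have "(s ^^ nat x) (b i) = (s ^^ nat y) (b i)"
        using 3(3) by (intro funpow_eventually_periodic[OF B(1) bB s(2) m(3)]) auto
      moreover have "0 \<le> x" "0 \<le> y" using l by linarith+
      ultimately show ?thesis by (simp add: F_def)
    qed simp
  qed
  obtain q where q: "\<And>i t. i \<in> comps m \<Longrightarrow> q (walk m i t) = F i t"
    using map_from_walks[OF m(1), of F] Fsame by blast
  have "q ` J v m = B"
  proof (intro equalityI subsetI)
    fix x assume "x \<in> q ` J v m"
    then show "x \<in> B" unfolding J_eq[OF m(1)] using q FB by auto
  next
    fix x assume "x \<in> B"
    then obtain i where i: "i \<in> comps m" "b i = x" using b_onto by blast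
    then have "q (walk m i 0) = x" using q by (simp add: F_def)
    moreover have "walk m i 0 \<in> J v m" unfolding J_eq[OF m(1)] using i(1) by blast
    ultimately show "x \<in> q ` J v m" by blast
  qed
  moreover have "map_prod q q ` \<Phi> v m \<subseteq> R"
    unfolding Phi_eq[OF m(1)] using q Fedge by auto
  ultimately show ?thesis using m(2) by blast
qed

end

theorem theorem4p4:
  fixes v :: labelling
  assumes "dumbbell_labelling v"
  shows "shimomura_sequence (J v) (\<Phi> v) (P v)
    \<and> invertible_seq (J v) (\<Phi> v) (P v)
    \<and> pointed (J v)
    \<and> factoring_property (J v) (\<Phi> v) (P v)
    \<and> cantor_space (inverse_limit_topology (J v) (P v))
    \<and> (\<forall>X :: (nat \<Rightarrow> nat list) metric.
         mtopology_of X = inverse_limit_topology (J v) (P v) \<longrightarrow>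
         (\<exists>f \<in> homeo_set X.
            {(x, f x) |x. x \<in> mspace X} = inverse_limit_rel (J v) (\<Phi> v) (P v)
            \<and> mtopology_of (surj_space X) closure_of conj_class X f = mspace (surj_space X)
            \<and> gdelta_in (mtopology_of (surj_space X)) (conj_class X f)))"
proof -
  interpret labelled v by (rule labelled.intro) (rule assms)
  have "\<exists>m\<ge>1. \<exists>q. q ` J v m = J v n \<and> map_prod q q ` \<Phi> v m \<subseteq> R"
    if "n \<ge> 1" "surjective_rel (J v n) R" for n R
    using levels_cover_relations[OF dumbbells.finite_level[OF that(1)] dumbbells.level_nonempty[OF that(1)] that(2)] .
  then show ?thesis
    using shimomura_sequence_P invertible_P pointed_J factoring_P dumbbells.cantor_limtop
      dumbbells.limmap_residual[OF _ factoring_P pointed_J] by blast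
qed

end
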